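(* Let $K$ be a real closed field and let $A=K[X_1,\ldots,X_n]/\mathfrak{a}$ be a $K$-algebra of finite type, where $\mathfrak{a}\subseteq K[X_1,\ldots,X_n]$ is an ideal. Then $A$ is semi-real if and only if $\mathrm{V}_K(\mathfrak{a})\neq\emptyset$.
   Context: A commutative ring $A$ is called semi-real if $-1$ is not a finite sum of squares of elements of $A$. A field is real if it is semi-real; it is real closed if it is real and has no nontrivial algebraic extension that is real. $\mathrm{V}_K(\mathfrak{a}):=\{a\in K^n\mid f(a)=0\text{ for all }f\in\mathfrak{a}\}$. *)

theory Defs
  imports "HOL-Library.Poly_Mapping" "HOL-Algebra.Algebraic_Closure_Type"
begin

definition semi_real :: "('a, 'b) ring_scheme \<Rightarrow> bool" where
  "semi_real A \<longleftrightarrow>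
     \<not> (\<exists>(m::nat) f. f \<in> {..<m} \<rightarrow> carrier A \<and>
          \<ominus>\<^bsub>A\<^esub> \<one>\<^bsub>A\<^esub> = (\<Oplus>\<^bsub>A\<^esub>i\<in>{..<m}. f i [^]\<^bsub>A\<^esub> (2::nat)))"

definition real_field :: "('a, 'b) ring_scheme \<Rightarrow> bool" where
  "real_field K \<longleftrightarrow> field K \<and> semi_real K"

text \<open>
  An algebraic extension of K is a field L with a homomorphism h from K to L (automatically
  injective) such that L is algebraic over the image of h; it is trivial if h is onto.
  HOL cannot quantify over types, so L ranges over the fields with elements in one fixed type.
  The type \<open>'a list set\<close>, which is the type of the quotients K[X]/(p) in HOL-Algebra
  (\<open>Rupt\<close>), entails no restriction: an algebraic extension of K has cardinality at most
  that of K[X], hence at most that of \<open>'a list\<close>, and so has an isomorphic copy over K there.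
\<close>

definition real_closed_field :: "'a ring \<Rightarrow> bool" where
  "real_closed_field K \<longleftrightarrow> real_field K \<and>
     (\<forall>(L :: 'a list set ring) h.
        real_field L \<and> h \<in> ring_hom K L \<and>
        (\<forall>y\<in>carrier L. ring.algebraic L (h ` carrier K) y) \<longrightarrow> h ` carrier K = carrier L)"

text \<open>
  A polynomial maps exponent vectors \<open>nat \<Rightarrow>\<^sub>0 nat\<close> to coefficients. The n variables are those
  with indices \<open>0, \<dots>, n - 1\<close>.
\<close>

definition mpoly_ring :: "nat \<Rightarrow> ((nat \<Rightarrow>\<^sub>0 nat) \<Rightarrow>\<^sub>0 'k::comm_ring_1) ring" where
  "mpoly_ring n =
     ring_of_type_algebra \<lparr>carrier := {p. \<forall>m\<in>Poly_Mapping.keys p. Poly_Mapping.keys m \<subseteq> {..<n}}\<rparr>"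

definition mpoly_eval :: "((nat \<Rightarrow>\<^sub>0 nat) \<Rightarrow>\<^sub>0 'k::comm_ring_1) \<Rightarrow> (nat \<Rightarrow> 'k) \<Rightarrow> 'k" where
  "mpoly_eval p x =
     (\<Sum>m\<in>Poly_Mapping.keys p. Poly_Mapping.lookup p m *
        (\<Prod>i\<in>Poly_Mapping.keys m. x i ^ Poly_Mapping.lookup m i))"

text \<open>Points of K^n are functions on \<open>{..<n}\<close>, made \<open>undefined\<close> elsewhere.\<close>

definition zero_set :: "nat \<Rightarrow> ((nat \<Rightarrow>\<^sub>0 nat) \<Rightarrow>\<^sub>0 'k::comm_ring_1) set \<Rightarrow> (nat \<Rightarrow> 'k) set" where
  "zero_set n I = {x \<in> {..<n} \<rightarrow>\<^sub>E UNIV. \<forall>f\<in>I. mpoly_eval f x = 0}"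

lemma cring_mpoly_ring: "cring (mpoly_ring n :: ((nat \<Rightarrow>\<^sub>0 nat) \<Rightarrow>\<^sub>0 'k::comm_ring_1) ring)"
proof -
  let ?R = "ring_of_type_algebra :: ((nat \<Rightarrow>\<^sub>0 nat) \<Rightarrow>\<^sub>0 'k) ring"
  let ?S = "{p :: (nat \<Rightarrow>\<^sub>0 nat) \<Rightarrow>\<^sub>0 'k. \<forall>m\<in>Poly_Mapping.keys p. Poly_Mapping.keys m \<subseteq> {..<n}}"
  interpret R: cring ?R ..
  have minus: "\<ominus>\<^bsub>?R\<^esub> p = - p" for p
    by (rule R.minus_equality) (auto simp: ring_of_type_algebra_def)
  have times: "p * q \<in> ?S" if "p \<in> ?S" "q \<in> ?S" for p q
  proof (intro CollectI ballI)
    fix m assume "m \<in> Poly_Mapping.keys (p * q)"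
    then obtain a b where "m = a + b" "a \<in> Poly_Mapping.keys p" "b \<in> Poly_Mapping.keys q"
      using keys_mult[of p q] by blast
    then show "Poly_Mapping.keys m \<subseteq> {..<n}"
      using that Poly_Mapping.keys_add[of a b] by blast
  qed
  have plus: "p + q \<in> ?S" if "p \<in> ?S" "q \<in> ?S" for p q
    using that Poly_Mapping.keys_add[of p q] by blast
  have ops: "carrier ?R = UNIV" "\<one>\<^bsub>?R\<^esub> = 1" "\<And>p q. p \<otimes>\<^bsub>?R\<^esub> q = p * q" "\<And>p q. p \<oplus>\<^bsub>?R\<^esub> q = p + q"
    by (simp_all add: ring_of_type_algebra_def)
  have "1 \<in> ?S" "\<And>p. p \<in> ?S \<Longrightarrow> - p \<in> ?S"
    by simp_all
  with times plus have "subring ?S ?R"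
    by (intro R.subringI) (simp_all only: ops minus subset_UNIV)
  then have "subcring ?S ?R"
    by (rule R.subcringI')
  then show ?thesis
    using R.subcring_iff[of ?S] by (simp only: mpoly_ring_def ops subset_UNIV)
qed

end

theory Submission
  imports Defs "HOL-Computational_Algebra.Polynomial_Factorial"
begin

text \<open>
  If A is semi-real, an ideal P containing \<open>\<aa>\<close> that is maximal with \<open>-1 \<notin> \<Sigma>K[X]\<^sup>2 + P\<close>
  is a real prime ideal. It has a generic point \<open>x\<close> in the algebraic closure of \<open>K(X)\<close>, and by
  Zorn's lemma \<open>K[x]\<close> lies in a maximal real subfield R, which is real closed. It
  remains to find a K-homomorphism from \<open>K[x]\<close> to K (the Artin-Lang theorem). It is built by
  adjoining one coordinate at a time: for a subring C of R, the pattern of signs that finitely many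
  polynomials over C take on R is determined by the signs of finitely many elements of C
  (the Cohen-Hoermander argument, on a family of polynomials closed under derivatives and
  pseudo-remainders). So if a homomorphism \<open>\<phi>\<close> from C to K respects the latter signs, then
  for every \<open>z \<in> R\<close> some \<open>w \<in> K\<close> satisfies the images under \<open>\<phi>\<close> of the sign conditions on z.
  The ordered-field facts behind this only use that irreducible polynomials over a real closed field
  define no real extension; the intermediate value theorem is proved from this
  by induction on the degree.
\<close>

hide_const (open) Polynomials.degree Polynomials.lead_coeff up_ring.coeff up_ring.monom

section \<open>Subrings, polynomials over them and sums of squares\<close>

text \<open>A homomorphism to K may send nonzero elements to 0, so it is available on rings and not
  on their fraction fields. This shapes the argument: coefficients lie in a subring, division with
  remainder becomes pseudo-division, and the sign 0 has to be respected along with 1 and -1, so that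
  nonzero leading coefficients stay nonzero and degrees are kept. An induction over the coordinates
  for the bare existence of a homomorphism would not go through. The claim carried along is that for
  every finite set of elements some homomorphism respects all their signs, since each new coordinate
  is paid for with finitely many sign conditions on the ring before it. The residue field of P would
  be a type depending on P. Instead the real closed extension is a subset of one algebraically
  closed field fixed in advance, which also supplies the roots needed to see that a maximal real
  subfield is real closed. The converse direction is evaluation: a point of the zero set sends 1 + s
  to 1 plus a sum of squares of the real field K, which is not 0.\<close>

locale unital_subring =
  fixes C :: "'a::comm_ring_1 set"
  assumes one_mem: "1 \<in> C"
    and diff_mem: "a \<in> C \<Longrightarrow> b \<in> C \<Longrightarrow> a - b \<in> C"
    and mult_mem: "a \<in> C \<Longrightarrow> b \<in> C \<Longrightarrow> a * b \<in> C"
begin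

lemma zero_mem: "0 \<in> C"
  using diff_mem[OF one_mem one_mem] by simp

lemma uminus_mem: "a \<in> C \<Longrightarrow> - a \<in> C"
  using diff_mem[OF zero_mem] by simp

lemma add_mem: "a \<in> C \<Longrightarrow> b \<in> C \<Longrightarrow> a + b \<in> C"
  using diff_mem[OF _ uminus_mem] by simp

lemma power_mem: "a \<in> C \<Longrightarrow> a ^ k \<in> C"
  by (induction k) (auto intro: one_mem mult_mem)

lemma sum_mem: "(\<And>i. i \<in> I \<Longrightarrow> f i \<in> C) \<Longrightarrow> sum f I \<in> C"
  by (induction I rule: infinite_finite_induct) (auto intro: zero_mem add_mem)

lemma of_nat_mem: "of_nat k \<in> C"
  by (induction k) (auto intro: zero_mem one_mem add_mem)

lemmas closed = zero_mem one_mem diff_mem mult_mem uminus_mem add_mem power_mem of_nat_mem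

end

definition polys_over :: "'a::zero set \<Rightarrow> 'a poly set" where
  "polys_over C = {f. \<forall>i. coeff f i \<in> C}"

lemma polys_overI: "(\<And>i. coeff f i \<in> C) \<Longrightarrow> f \<in> polys_over C"
  by (simp add: polys_over_def)

lemma coeff_mem: "f \<in> polys_over C \<Longrightarrow> coeff f i \<in> C"
  by (simp add: polys_over_def)

lemma polys_over_UNIV [simp]: "polys_over UNIV = UNIV"
  by (auto simp: polys_over_def)

lemma polys_over_mono: "C \<subseteq> D \<Longrightarrow> polys_over C \<subseteq> polys_over D"
  by (auto simp: polys_over_def)

lemma pCons_mem_iff: "pCons a f \<in> polys_over C \<longleftrightarrow> a \<in> C \<and> f \<in> polys_over C"
  by (auto simp: polys_over_def coeff_pCons split: nat.splits)

text \<open>Sums of squares of any length are generated one square at a time, so that rule induction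
  replaces indexed sums. The set C of admissible square roots is a parameter and need not be a ring;
  this also covers sums of squares of polynomials of bounded degree.\<close>

inductive_set sos :: "'a::comm_ring_1 set \<Rightarrow> 'a set" for C where
  sos_zero: "0 \<in> sos C"
| sos_add_square: "a \<in> C \<Longrightarrow> s \<in> sos C \<Longrightarrow> a\<^sup>2 + s \<in> sos C"

lemma sos_mono: "s \<in> sos C \<Longrightarrow> C \<subseteq> D \<Longrightarrow> s \<in> sos D"
  by (induction s rule: sos.induct) (auto intro: sos.intros)

lemma sos_square: "a \<in> C \<Longrightarrow> a\<^sup>2 \<in> sos C"
  using sos_add_square[OF _ sos_zero] by simp

lemma sos_add: "s \<in> sos C \<Longrightarrow> t \<in> sos C \<Longrightarrow> s + t \<in> sos C"
  by (induction s rule: sos.induct) (auto intro: sos.intros simp: add.assoc)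

context unital_subring
begin

lemma unital_subring_polys_over: "unital_subring (polys_over C)"
proof
  show "1 \<in> polys_over C"
    by (rule polys_overI) (auto simp: coeff_1 intro: closed)
  show "f - g \<in> polys_over C" "f * g \<in> polys_over C"
    if "f \<in> polys_over C" "g \<in> polys_over C" for f g
    using that by (simp_all add: polys_over_def coeff_mult diff_mem mult_mem sum_mem)
qed

lemmas poly_closed = unital_subring.closed[OF unital_subring_polys_over]

lemma const_mem_iff: "[:a:] \<in> polys_over C \<longleftrightarrow> a \<in> C"
  by (simp add: pCons_mem_iff poly_closed)

lemma smult_mem: "a \<in> C \<Longrightarrow> f \<in> polys_over C \<Longrightarrow> smult a f \<in> polys_over C"
  by (simp add: polys_over_def mult_mem)

lemma monom_mem: "a \<in> C \<Longrightarrow> monom a k \<in> polys_over C"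
  by (simp add: polys_over_def zero_mem)

lemma X_minus_mem: "a \<in> C \<Longrightarrow> [:- a, 1:] \<in> polys_over C"
  by (simp add: pCons_mem_iff poly_closed closed)

lemma poly_mem: "f \<in> polys_over C \<Longrightarrow> a \<in> C \<Longrightarrow> poly f a \<in> C"
  by (induction f) (auto simp: pCons_mem_iff intro!: closed)

lemma sos_mem: "s \<in> sos C \<Longrightarrow> s \<in> C"
  by (induction s rule: sos.induct) (auto intro: closed)

lemma sos_mult_square: "s \<in> sos C \<Longrightarrow> a \<in> C \<Longrightarrow> a\<^sup>2 * s \<in> sos C"
proof (induction s rule: sos.induct)
  case (sos_add_square b s)
  then have "(a * b)\<^sup>2 + a\<^sup>2 * s \<in> sos C"
    by (intro sos.sos_add_square closed)
  then show ?case
    by (simp add: algebra_simps power_mult_distrib)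
qed (auto intro: sos.intros)

lemma sos_mult: "s \<in> sos C \<Longrightarrow> t \<in> sos C \<Longrightarrow> s * t \<in> sos C"
  by (induction s rule: sos.induct)
    (auto intro: sos.intros sos_add sos_mult_square simp: ring_distribs)

lemma poly_sos: "s \<in> sos (polys_over C) \<Longrightarrow> a \<in> C \<Longrightarrow> poly s a \<in> sos C"
  by (induction s rule: sos.induct) (auto intro: sos.intros poly_mem)

text \<open>One elimination step multiplies f by the leading coefficient of g and subtracts the
  multiple of g that cancels the top term; k counts the steps. No inverse is taken, so the result
  stays over C.\<close>

lemma pseudo_division:
  assumes g: "g \<in> polys_over C" and f: "f \<in> polys_over C"
  shows "\<exists>k q r. q \<in> polys_over C \<and> r \<in> polys_over C \<and>
           smult (lead_coeff g ^ k) f = q * g + r \<and> (r = 0 \<or> degree r < degree g)"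
  using f
\<comment> \<open>The measure puts 0 below the nonzero constants: cancelling the top term of a
  constant gives 0 but does not lower the degree.\<close>
proof (induction "if f = 0 then 0 else Suc (degree f)" arbitrary: f rule: less_induct)
  case less
  show ?case
  proof (cases "f = 0 \<or> degree f < degree g")
    case True
    then have "smult (lead_coeff g ^ 0) f = 0 * g + f" "f = 0 \<or> degree f < degree g"
      by auto
    then show ?thesis
      using less.prems poly_closed(1) by blast
  next
    case False
    define n where "n = degree f - degree g"
    define h where "h = monom (lead_coeff f) n"
    define f' where "f' = smult (lead_coeff g) f - h * g"
    have hm: "h \<in> polys_over C"
      unfolding h_def by (intro monom_mem coeff_mem less.prems)
    then have f'm: "f' \<in> polys_over C"
      unfolding f'_def by (intro poly_closed smult_mem coeff_mem g less.prems)
    have "degree (h * g) \<le> degree f"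
      using degree_mult_le[of h g] degree_monom_le[of "lead_coeff f" n] False
      unfolding h_def n_def by linarith
    then have "degree f' \<le> degree f"
      unfolding f'_def by (intro degree_diff_le) (auto intro: order_trans[OF degree_smult_le])
    moreover have "coeff (h * g) (degree f) = lead_coeff f * lead_coeff g"
    proof -
      have "coeff (h * g) (n + degree g) = lead_coeff f * lead_coeff g"
        unfolding h_def by (simp only: coeff_monom_mult) simp
      then show ?thesis
        using False by (simp add: n_def)
    qed
    then have "coeff f' (degree f) = 0"
      by (simp add: f'_def mult.commute)
    ultimately have "f' = 0 \<or> degree f' < degree f"
      by (meson eq_zero_or_degree_less)
    then have "(if f' = 0 then 0 else Suc (degree f')) < (if f = 0 then 0 else Suc (degree f))"
      using False by auto
    then obtain k q r where *: "q \<in> polys_over C" "r \<in> polys_over C"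
      "smult (lead_coeff g ^ k) f' = q * g + r" "r = 0 \<or> degree r < degree g"
      using less.hyps f'm by blast
    let ?q = "q + smult (lead_coeff g ^ k) h"
    have "smult (lead_coeff g ^ Suc k) f = smult (lead_coeff g ^ k) (f' + h * g)"
      by (simp add: f'_def mult.commute)
    also have "\<dots> = ?q * g + r"
      using *(3) by (simp add: algebra_simps smult_add_right)
    finally show ?thesis
      using * hm by (intro exI[of _ "Suc k"] exI[of _ ?q] exI[of _ r])
        (simp add: poly_closed smult_mem power_mem coeff_mem g)
  qed
qed

end

section \<open>Homomorphisms on a subring and their action on polynomials\<close>

locale subring_hom = unital_subring C for C :: "'a::comm_ring_1 set" +
  fixes \<phi> :: "'a \<Rightarrow> 'b::comm_ring_1"
  assumes hom_one: "\<phi> 1 = 1"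
    and hom_add: "a \<in> C \<Longrightarrow> b \<in> C \<Longrightarrow> \<phi> (a + b) = \<phi> a + \<phi> b"
    and hom_mult: "a \<in> C \<Longrightarrow> b \<in> C \<Longrightarrow> \<phi> (a * b) = \<phi> a * \<phi> b"
begin

lemma hom_zero: "\<phi> 0 = 0"
  using hom_add[OF zero_mem zero_mem] by simp

lemma hom_diff: "a \<in> C \<Longrightarrow> b \<in> C \<Longrightarrow> \<phi> (a - b) = \<phi> a - \<phi> b"
  using hom_add[of "a - b" b] by (simp add: diff_mem)

lemma hom_power: "a \<in> C \<Longrightarrow> \<phi> (a ^ k) = \<phi> a ^ k"
  by (induction k) (auto simp: hom_one hom_mult closed)

lemma hom_of_nat: "\<phi> (of_nat k) = of_nat k"
  by (induction k) (auto simp: hom_zero hom_one hom_add closed)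

lemma hom_sum: "(\<And>i. i \<in> I \<Longrightarrow> f i \<in> C) \<Longrightarrow> \<phi> (sum f I) = (\<Sum>i\<in>I. \<phi> (f i))"
  by (induction I rule: infinite_finite_induct) (auto simp: hom_zero hom_add sum_mem)

lemmas coeff_map = coeff_map_poly[of \<phi>, OF hom_zero]

lemma map_one: "map_poly \<phi> 1 = 1"
  by (simp add: map_poly_1 hom_one)

lemma map_const: "map_poly \<phi> [:a:] = [:\<phi> a:]"
  by (simp add: map_poly_pCons hom_zero)

lemma map_add: "f \<in> polys_over C \<Longrightarrow> g \<in> polys_over C \<Longrightarrow>
    map_poly \<phi> (f + g) = map_poly \<phi> f + map_poly \<phi> g"
  by (rule poly_eqI) (simp add: coeff_map hom_add coeff_mem)

lemma map_diff: "f \<in> polys_over C \<Longrightarrow> g \<in> polys_over C \<Longrightarrow>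
    map_poly \<phi> (f - g) = map_poly \<phi> f - map_poly \<phi> g"
  by (rule poly_eqI) (simp add: coeff_map hom_diff coeff_mem)

lemma map_mult: "f \<in> polys_over C \<Longrightarrow> g \<in> polys_over C \<Longrightarrow>
    map_poly \<phi> (f * g) = map_poly \<phi> f * map_poly \<phi> g"
  by (rule poly_eqI) (simp add: coeff_map hom_sum hom_mult coeff_mult coeff_mem mult_mem)

lemma map_smult: "a \<in> C \<Longrightarrow> f \<in> polys_over C \<Longrightarrow>
    map_poly \<phi> (smult a f) = smult (\<phi> a) (map_poly \<phi> f)"
  by (rule poly_eqI) (simp add: coeff_map hom_mult coeff_mem)

lemma hom_poly: "f \<in> polys_over C \<Longrightarrow> a \<in> C \<Longrightarrow> \<phi> (poly f a) = poly (map_poly \<phi> f) (\<phi> a)"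
  by (induction f)
    (auto simp: pCons_mem_iff hom_zero hom_add hom_mult poly_mem closed map_poly_pCons)

lemma map_degree: "\<phi> (lead_coeff f) \<noteq> 0 \<Longrightarrow> degree (map_poly \<phi> f) = degree f"
  by (intro antisym le_degree degree_le) (auto simp: coeff_map coeff_eq_0 hom_zero)

lemma unital_subring_image: "unital_subring (\<phi> ` C)"
proof
  show "1 \<in> \<phi> ` C" by (metis hom_one image_eqI one_mem)
  show "a - b \<in> \<phi> ` C" "a * b \<in> \<phi> ` C" if "a \<in> \<phi> ` C" "b \<in> \<phi> ` C" for a b
    using that by (auto simp flip: hom_diff hom_mult intro: closed)
qed

lemma map_poly_mem_image: "f \<in> polys_over C \<Longrightarrow> map_poly \<phi> f \<in> polys_over (\<phi> ` C)"
  by (auto simp: polys_over_def coeff_map)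

lemma lift_poly:
  assumes "F \<in> polys_over (\<phi> ` C)"
  obtains f where "f \<in> polys_over C" "map_poly \<phi> f = F"
proof -
  have "\<exists>f \<in> polys_over C. map_poly \<phi> f = F"
    using assms
  proof (induction F)
    case 0
    show ?case by (rule bexI[of _ 0]) (auto intro: poly_closed)
  next
    case (pCons a F)
    then obtain c f where "c \<in> C" "a = \<phi> c" "f \<in> polys_over C" "map_poly \<phi> f = F"
      by (auto simp: pCons_mem_iff)
    then show ?case
      by (intro bexI[of _ "pCons c f"]) (auto simp: pCons_mem_iff map_poly_pCons hom_zero)
  qed
  then show thesis using that by blast
qed

end

section \<open>The subring C[z]\<close>

definition adjoin :: "'a::comm_ring_1 set \<Rightarrow> 'a \<Rightarrow> 'a set" where
  "adjoin C z = (\<lambda>f. poly f z) ` polys_over C"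

context unital_subring
begin

lemma subring_hom_poly: "subring_hom (polys_over C) (\<lambda>f. poly f z)"
  by (intro subring_hom.intro subring_hom_axioms.intro unital_subring_polys_over) auto

lemma unital_subring_adjoin: "unital_subring (adjoin C z)"
  unfolding adjoin_def by (rule subring_hom.unital_subring_image[OF subring_hom_poly])

lemma subset_adjoin: "C \<subseteq> adjoin C z"
  unfolding adjoin_def by (auto intro!: image_eqI[of _ _ "[:_:]"] simp: const_mem_iff)

lemma mem_adjoin: "z \<in> adjoin C z"
  unfolding adjoin_def
  by (auto intro!: image_eqI[of _ _ "[:0, 1:]"] simp: pCons_mem_iff closed poly_closed)

lemma poly_mem_adjoin: "f \<in> polys_over C \<Longrightarrow> poly f z \<in> adjoin C z"
  by (simp add: adjoin_def)

end

text \<open>The universal property of C[z]: sending z to w is consistent as soon as w satisfies the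
  image of every relation that z satisfies over C. The value at x is computed from a chosen
  polynomial representing x, and the hypothesis, applied to a difference of two representations,
  makes it independent of the choice.\<close>

lemma (in subring_hom) extend_hom:
  assumes "\<And>f. f \<in> polys_over C \<Longrightarrow> poly f z = 0 \<Longrightarrow> poly (map_poly \<phi> f) w = 0"
  shows "\<exists>\<psi>. subring_hom (adjoin C z) \<psi> \<and>
    (\<forall>f\<in>polys_over C. \<psi> (poly f z) = poly (map_poly \<phi> f) w) \<and> (\<forall>c\<in>C. \<psi> c = \<phi> c)"
proof -
  define \<psi> where "\<psi> x = poly (map_poly \<phi> (SOME f. f \<in> polys_over C \<and> poly f z = x)) w" for x
  have \<psi>: "\<psi> (poly f z) = poly (map_poly \<phi> f) w" if f: "f \<in> polys_over C" for f
  proof -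
    define g where "g = (SOME g. g \<in> polys_over C \<and> poly g z = poly f z)"
    have g: "g \<in> polys_over C" "poly g z = poly f z"
      using someI[of "\<lambda>g. g \<in> polys_over C \<and> poly g z = poly f z" f] f unfolding g_def by auto
    have "poly (map_poly \<phi> (g - f)) w = 0"
      using f g by (intro assms) (auto intro: poly_closed)
    then show ?thesis
      using f g by (simp add: \<psi>_def map_diff flip: g_def)
  qed
  have "subring_hom (adjoin C z) \<psi>"
  proof (intro subring_hom.intro subring_hom_axioms.intro unital_subring_adjoin)
    show "\<psi> 1 = 1"
      using \<psi>[OF poly_closed(2)] by (simp add: map_one)
    fix a b assume "a \<in> adjoin C z" "b \<in> adjoin C z"
    then obtain f g where fg: "f \<in> polys_over C" "g \<in> polys_over C" "a = poly f z" "b = poly g z"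
      by (auto simp: adjoin_def)
    show "\<psi> (a + b) = \<psi> a + \<psi> b"
      using \<psi>[of "f + g"] \<psi>[of f] \<psi>[of g] fg by (simp add: map_add poly_closed)
    show "\<psi> (a * b) = \<psi> a * \<psi> b"
      using \<psi>[of "f * g"] \<psi>[of f] \<psi>[of g] fg by (simp add: map_mult poly_closed)
  qed
  moreover have "\<psi> c = \<phi> c" if "c \<in> C" for c
    using \<psi>[of "[:c:]"] that by (simp add: const_mem_iff map_const)
  ultimately show ?thesis
    using \<psi> by blast
qed

lemma pderiv_mem:
  fixes C :: "'a::idom set"
  assumes "unital_subring C" "f \<in> polys_over C"
  shows "pderiv f \<in> polys_over C"
  using assms unital_subring.of_nat_mem[OF assms(1)] unital_subring.mult_mem[OF assms(1)]
  by (simp add: polys_over_def coeff_pderiv del: of_nat_Suc)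

lemma map_pderiv:
  fixes \<phi> :: "'a::idom \<Rightarrow> 'b::idom"
  assumes "subring_hom C \<phi>" "f \<in> polys_over C"
  shows "map_poly \<phi> (pderiv f) = pderiv (map_poly \<phi> f)"
proof -
  interpret subring_hom C \<phi> by fact
  show ?thesis
    using assms(2) of_nat_mem hom_of_nat
    by (intro poly_eqI) (simp add: coeff_map hom_mult coeff_mem coeff_pderiv del: of_nat_Suc)
qed

section \<open>Real closed subfields and their ordering\<close>

locale field_subset = unital_subring R for R :: "'w::field set" +
  assumes inverse_mem: "a \<in> R \<Longrightarrow> inverse a \<in> R"
begin

lemma divide_mem: "a \<in> R \<Longrightarrow> b \<in> R \<Longrightarrow> a / b \<in> R"
  by (simp add: divide_inverse mult_mem inverse_mem)

lemma division_with_remainder: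
  assumes g: "g \<in> polys_over R" "g \<noteq> 0" and f: "f \<in> polys_over R"
  obtains q r where "q \<in> polys_over R" "r \<in> polys_over R" "f = q * g + r"
    "r = 0 \<or> degree r < degree g"
proof -
  obtain k q r where *: "q \<in> polys_over R" "r \<in> polys_over R"
    "smult (lead_coeff g ^ k) f = q * g + r" "r = 0 \<or> degree r < degree g"
    using pseudo_division[OF g(1) f] by blast
  define c where "c = inverse (lead_coeff g ^ k)"
  have c: "c \<in> R" "c * lead_coeff g ^ k = 1"
    using g by (simp_all add: c_def inverse_mem power_mem coeff_mem)
  have "f = smult c (smult (lead_coeff g ^ k) f)"
    using c(2) by simp
  also have "\<dots> = smult c q * g + smult c r"
    unfolding *(3) by (simp add: smult_add_right)
  finally show thesis
    using that[of "smult c q" "smult c r"] * c smult_mem by simp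
qed

lemma root_factor:
  assumes "f \<in> polys_over R" "c \<in> R" "poly f c = 0"
  obtains g where "g \<in> polys_over R" "f = [:- c, 1:] * g"
proof -
  obtain q r where qr: "q \<in> polys_over R" "r \<in> polys_over R" "f = q * [:- c, 1:] + r"
    "r = 0 \<or> degree r < degree [:- c, 1:]"
    using division_with_remainder[OF X_minus_mem[OF assms(2)] _ assms(1)] by auto
  then obtain d where "r = [:d:]"
    by (metis degree_eq_zeroE degree_pCons_eq_if less_one one_neq_zero pCons_eq_0_iff One_nat_def degree_0)
  then have "r = 0"
    using assms(3) qr(3) by simp
  then show thesis
    using that[of q] qr by (simp add: mult.commute)
qed

text \<open>Replacing each squared polynomial by its remainder modulo f changes the sum only by a
  multiple of f.\<close>

lemma sos_reduce:
  assumes f: "f \<in> polys_over R" "degree f > 0" and s: "s \<in> sos (polys_over R)"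
  shows "\<exists>t \<in> sos {g \<in> polys_over R. degree g < degree f}. \<exists>h \<in> polys_over R. s = t + f * h"
  using s
proof (induction s rule: sos.induct)
  case sos_zero
  show ?case
    using poly_closed(1) by (intro bexI[OF _ sos.sos_zero] bexI[of _ 0]) auto
next
  case (sos_add_square a s)
  then obtain t h where t: "t \<in> sos {g \<in> polys_over R. degree g < degree f}"
    "h \<in> polys_over R" "s = t + f * h"
    by blast
  have "f \<noteq> 0" using f by auto
  then obtain q r where qr: "q \<in> polys_over R" "r \<in> polys_over R" "a = q * f + r"
    "r = 0 \<or> degree r < degree f"
    using division_with_remainder[OF f(1) _ sos_add_square(1)] by metis
  have "r\<^sup>2 + t \<in> sos {g \<in> polys_over R. degree g < degree f}"
    using qr f t by (intro sos.sos_add_square) auto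
  moreover have "q * q * f + (q * r + (q * r + h)) \<in> polys_over R"
    using qr t f by (intro poly_closed)
  moreover have "a\<^sup>2 + s = r\<^sup>2 + t + f * (q * q * f + (q * r + (q * r + h)))"
    unfolding qr(3) t(3) by (simp add: algebra_simps power2_eq_square)
  ultimately show ?case by blast
qed

lemma degree_sos:
  assumes "t \<in> sos {g \<in> polys_over R. degree g < d}"
  shows "degree t \<le> 2 * (d - 1)"
  using assms
proof (induction t rule: sos.induct)
  case (sos_add_square a s)
  have "degree (a\<^sup>2) \<le> 2 * (d - 1)"
    using sos_add_square(1) degree_power_le[of a 2] by auto
  then show ?case
    using sos_add_square by (intro degree_add_le) auto
qed auto

end

text \<open>With no order in the structure, the sign is read off from the squares of R. Every
  nonzero element that is not such a square gets -1, also outside R; for elements of a real closed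
  subfield this is the sign of the unique order. Integer values make multiplicativity an
  equation.\<close>

definition sgn_on :: "'w::field set \<Rightarrow> 'w \<Rightarrow> int" where
  "sgn_on R a = (if a = 0 then 0 else if \<exists>b\<in>R. a = b\<^sup>2 then 1 else -1)"

lemma sgn_on_0 [simp]: "sgn_on R 0 = 0"
  by (simp add: sgn_on_def)

lemma sgn_on_eq_0_iff [simp]: "sgn_on R a = 0 \<longleftrightarrow> a = 0"
  by (simp add: sgn_on_def)

lemma sgn_on_eq_1_iff: "sgn_on R a = 1 \<longleftrightarrow> a \<noteq> 0 \<and> (\<exists>b\<in>R. a = b\<^sup>2)"
  by (auto simp: sgn_on_def)

lemma sgn_on_cases:
  obtains "a = 0" "sgn_on R a = 0" | "a \<noteq> 0" "sgn_on R a = 1" | "a \<noteq> 0" "sgn_on R a = -1"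
  by (cases "a = 0"; cases "\<exists>b\<in>R. a = b\<^sup>2") (auto simp: sgn_on_def)

text \<open>
  The second axiom says that \<open>R[X]/(f)\<close> is not real when f is irreducible and not linear. No order is
  part of the structure: the positive elements are the nonzero squares.
\<close>

locale real_closed_subfield = field_subset R for R :: "'w::field set" +
  assumes real: "s \<in> sos R \<Longrightarrow> 1 + s \<noteq> 0"
    and irreducible_dvd: "f \<in> polys_over R \<Longrightarrow> 2 \<le> degree f \<Longrightarrow>
      (\<And>g h. g \<in> polys_over R \<Longrightarrow> h \<in> polys_over R \<Longrightarrow> f = g * h \<Longrightarrow> degree g = 0 \<or> degree h = 0) \<Longrightarrow>
      \<exists>s \<in> sos (polys_over R). \<exists>h \<in> polys_over R. 1 + s = f * h"
begin

text \<open>Once the squares are reduced modulo f, the degree of 1 + s is at most 2 (degree f - 1),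
  so the cofactor h has degree at most degree f - 2. This drop in degree drives the intermediate
  value theorem. Evaluation at 0 shows that 1 + s is not the zero polynomial, since R is
  real.\<close>

lemma irreducible_dvd_reduced:
  assumes "f \<in> polys_over R" "2 \<le> degree f"
    "\<And>g h. g \<in> polys_over R \<Longrightarrow> h \<in> polys_over R \<Longrightarrow> f = g * h \<Longrightarrow> degree g = 0 \<or> degree h = 0"
  obtains s h where "s \<in> sos {g \<in> polys_over R. degree g < degree f}" "h \<in> polys_over R"
    "1 + s = f * h" "h \<noteq> 0" "Suc (degree h) < degree f"
proof -
  obtain s h where s: "s \<in> sos (polys_over R)" "h \<in> polys_over R" "1 + s = f * h"
    using irreducible_dvd[OF assms] by blast
  obtain t h' where t: "t \<in> sos {g \<in> polys_over R. degree g < degree f}" "h' \<in> polys_over R"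
    "s = t + f * h'"
    using sos_reduce[OF assms(1) _ s(1)] assms(2) by force
  have eq: "1 + t = f * (h - h')"
    using s(3) t(3) by (simp add: algebra_simps)
  have "t \<in> sos (polys_over R)"
    by (rule sos_mono[OF t(1)]) auto
  then have "poly (1 + t) 0 \<noteq> 0"
    using poly_sos[of t 0] real closed(1) by simp
  then have nz: "h - h' \<noteq> 0" "f \<noteq> 0"
    using eq by auto
  have "degree (1 + t) \<le> 2 * (degree f - 1)"
    using degree_sos[OF t(1)] by (intro degree_add_le) auto
  then have "degree f + degree (h - h') \<le> 2 * (degree f - 1)"
    using nz unfolding eq by (simp add: degree_mult_eq)
  then have "Suc (degree (h - h')) < degree f"
    using assms(2) by linarith
  then show thesis
    using that[OF t(1) poly_closed(3)[OF s(2) t(2)] eq nz(1)] by blast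
qed

text \<open>If a is not a square, X^2 - a is irreducible, and the reduced identity reads 1 + s = c
  (X^2 - a) with a constant c. Here s is a sum of squares of polynomials u + v X, so the
  coefficients of 1 and X^2 give -a c = 1 + (sum of the u^2) and c = (sum of the v^2). Hence -a =
  (-a c) c / c^2 is a sum of squares.\<close>

lemma square_or_minus_sos:
  assumes a: "a \<in> R"
  shows "(\<exists>b\<in>R. a = b\<^sup>2) \<or> - a \<in> sos R"
  unfolding disj_imp
proof
  assume nsq: "\<not> (\<exists>b\<in>R. a = b\<^sup>2)"
  let ?f = "[:- a, 0, 1:]"
  have f: "?f \<in> polys_over R"
    using a by (simp add: pCons_mem_iff closed poly_closed)
  have root: "degree g \<noteq> 1" if gh: "g \<in> polys_over R" "?f = g * h" for g h
  proof
    assume "degree g = 1"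
    then obtain u v where g: "g = [:u, v:]" "v \<noteq> 0"
      by (rule degree1_coeffs)
    then have uv: "- u / v \<in> R"
      using gh(1) by (auto simp: pCons_mem_iff intro!: divide_mem closed)
    have "poly ?f (- u / v) = 0"
      unfolding gh(2) using g by simp
    then have "a = (- u / v)\<^sup>2"
      by (simp add: power2_eq_square)
    then show False
      using nsq uv by blast
  qed
  have irr: "degree g = 0 \<or> degree h = 0"
    if "g \<in> polys_over R" "h \<in> polys_over R" "?f = g * h" for g h
  proof -
    have "g \<noteq> 0" "h \<noteq> 0" using that(3) by auto
    then have "degree g + degree h = degree ?f"
      unfolding that(3) by (rule degree_mult_eq[symmetric])
    then have "degree g + degree h = 2"
      by simp
    with root[OF that(1,3)] show ?thesis by linarith
  qed
  have d: "2 \<le> degree ?f" by simp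
  obtain s h where s: "s \<in> sos {g \<in> polys_over R. degree g < degree ?f}" "h \<in> polys_over R"
    "1 + s = ?f * h" "h \<noteq> 0" "Suc (degree h) < degree ?f"
    by (rule irreducible_dvd_reduced[OF f d irr])
  have "coeff t 0 \<in> sos R \<and> coeff t 2 \<in> sos R"
    if "t \<in> sos {g \<in> polys_over R. degree g < 2}" for t
    using that
  proof (induction t rule: sos.induct)
    case (sos_add_square g t)
    define u v where "u = coeff g 0" and "v = coeff g 1"
    have "g = [:u, v:]"
      using sos_add_square(1) unfolding u_def v_def
      by (intro poly_eqI) (auto simp: coeff_pCons coeff_eq_0 split: nat.split)
    then have "g\<^sup>2 = [:u\<^sup>2, 2 * u * v, v\<^sup>2:]"
      by (simp add: power2_eq_square)
    moreover have "u \<in> R" "v \<in> R"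
      using sos_add_square(1) by (simp_all add: u_def v_def coeff_mem)
    ultimately show ?case
      using sos_add_square.IH by (simp add: sos.sos_add_square coeff_pCons split: nat.split)
  qed (auto intro: sos.intros)
  then have sm: "coeff s 0 \<in> sos R" "coeff s 2 \<in> sos R"
    using s(1) by (auto simp: numeral_2_eq_2)
  obtain c where c: "h = [:c:]"
    using s(5) by (auto elim: degree_eq_zeroE)
  have c0: "c \<noteq> 0" using s(4) c by simp
  have "coeff (1 + s) 0 = - a * c" "coeff (1 + s) 2 = c"
    unfolding s(3) c by (simp_all add: numeral_2_eq_2)
  then have "1 + coeff s 0 = - a * c" "coeff s 2 = c"
    by auto
  moreover have "(1 / c)\<^sup>2 * ((1 + coeff s 0) * coeff s 2) \<in> sos R"
    using sm calculation sos_square[OF closed(2)] sos_mem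
    by (intro sos_mult_square sos_mult sos_add divide_mem closed) auto
  moreover have "(1 / c)\<^sup>2 * ((- a * c) * c) = - a"
    using c0 by (simp add: power2_eq_square)
  ultimately show "- a \<in> sos R" by metis
qed

text \<open>Otherwise -s would be a sum of squares as well, and so would -1 = (-s) s / s^2.\<close>

lemma sos_is_square:
  assumes s: "s \<in> sos R"
  shows "\<exists>b\<in>R. s = b\<^sup>2"
proof (rule ccontr)
  assume neg: "\<not> ?thesis"
  then have "s \<noteq> 0" using zero_mem by auto
  have "- s \<in> sos R"
    using square_or_minus_sos[OF sos_mem[OF s]] neg by blast
  then have "(1 / s)\<^sup>2 * ((- s) * s) \<in> sos R"
    using s by (intro sos_mult_square sos_mult divide_mem closed sos_mem)
  moreover have "(1 / s)\<^sup>2 * ((- s) * s) = - 1"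
    using \<open>s \<noteq> 0\<close> by (simp add: power2_eq_square)
  ultimately show False
    using real[of "- 1"] by simp
qed

lemma square_or_minus_square:
  "a \<in> R \<Longrightarrow> (\<exists>b\<in>R. a = b\<^sup>2) \<or> (\<exists>b\<in>R. - a = b\<^sup>2)"
  using square_or_minus_sos sos_is_square by blast

lemma sum_squares_eq_0:
  assumes "a \<in> R" "b \<in> R" "a\<^sup>2 + b\<^sup>2 = 0"
  shows "a = 0"
proof (rule ccontr)
  assume "a \<noteq> 0"
  then have "1 + (b / a)\<^sup>2 = 0"
    using assms(3) by (simp add: field_simps power2_eq_square)
  then show False
    using real[of "(b / a)\<^sup>2"] sos_square[of "b / a"] divide_mem assms by auto
qed

section \<open>The order whose positive elements are the nonzero squares\<close>

abbreviation sg :: "'w \<Rightarrow> int" where "sg \<equiv> sgn_on R"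

lemma sg_minus:
  assumes "a \<in> R"
  shows "sg (- a) = - sg a"
proof -
  have "\<not> ((\<exists>b\<in>R. a = b\<^sup>2) \<and> (\<exists>b\<in>R. - a = b\<^sup>2))" if "a \<noteq> 0"
    using that sum_squares_eq_0 by (metis add.right_inverse zero_power2)
  then show ?thesis
    using square_or_minus_square[OF assms] by (auto simp: sgn_on_def)
qed

lemma sg_diff_swap: "a \<in> R \<Longrightarrow> b \<in> R \<Longrightarrow> sg (b - a) = - sg (a - b)"
  using sg_minus[of "a - b"] by (simp add: closed)

lemma sg_square: "b \<in> R \<Longrightarrow> b \<noteq> 0 \<Longrightarrow> sg (b\<^sup>2) = 1"
  by (auto simp: sgn_on_def)

lemma sg_mult_pos: "sg a = 1 \<Longrightarrow> sg b = 1 \<Longrightarrow> sg (a * b) = 1"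
  by (auto simp: sgn_on_eq_1_iff simp flip: power_mult_distrib intro: mult_mem)

lemma sg_mult:
  assumes "a \<in> R" "b \<in> R"
  shows "sg (a * b) = sg a * sg b"
proof -
  have "sg (a * b) = sg a * sg b \<or> a = 0 \<or> b = 0"
    using sg_mult_pos[of a b] sg_mult_pos[of "- a" b] sg_mult_pos[of a "- b"] sg_mult_pos[of "- a" "- b"]
      sg_minus[of "a * b"] sg_minus[of a] sg_minus[of b] assms
    by (cases rule: sgn_on_cases[of a R]; cases rule: sgn_on_cases[of b R]) (auto simp: closed)
  then show ?thesis by auto
qed

lemma sg_add:
  assumes "sg a = 1" "sg b = 1 \<or> b = 0"
  shows "sg (a + b) = 1"
proof (cases "b = 0")
  case False
  then obtain c d where cd: "c \<in> R" "d \<in> R" "a = c\<^sup>2" "b = d\<^sup>2" "a \<noteq> 0"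
    using assms by (auto simp: sgn_on_eq_1_iff)
  then have "a + b \<in> sos R"
    by (auto intro: sos_add sos_square)
  then show ?thesis
    using sos_is_square sum_squares_eq_0[OF cd(1,2)] cd by (auto simp: sgn_on_eq_1_iff)
qed (use assms in auto)

lemma sg_one: "sg 1 = 1"
  using sg_square[OF one_mem] by simp

lemma sg_one_plus_sos: "s \<in> sos R \<Longrightarrow> sg (1 + s) = 1"
  using sg_add[OF sg_one, of s] sos_is_square[of s] by (cases "s = 0") (auto simp: sgn_on_eq_1_iff)

text \<open>The inequality a < b is always written \<open>sg (b - a) = 1\<close>; in this form
  transitivity is the statement that positive elements are closed under addition.\<close>

lemma sg_trans: "sg (b - a) = 1 \<Longrightarrow> sg (c - b) = 1 \<Longrightarrow> sg (c - a) = 1"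
  using sg_add[of "b - a" "c - b"] by simp

lemma sg_power: "a \<in> R \<Longrightarrow> sg (a ^ k) = sg a ^ k"
  by (induction k) (auto simp: sg_one sg_mult closed)

lemma sg_of_nat: "k > 0 \<Longrightarrow> sg (of_nat k) = 1"
proof (induction k)
  case (Suc k)
  then show ?case
    using sg_add[OF sg_one, of "of_nat k"] sg_one by (cases "k = 0") auto
qed auto

lemma of_nat_neq_0: "k > 0 \<Longrightarrow> (of_nat k :: 'w) \<noteq> 0"
  using sg_of_nat[of k] by auto

text \<open>If f has a root c in R, the sign change comes from the cofactor of X - c, or from X - c
  itself, and then c lies between a and b. If f factors otherwise, one of the factors changes sign.
  The remaining f is irreducible of degree at least 2, and there the claim holds because no sign
  change can occur: f h = 1 + s is positive on all of R, so h changes sign with f, but by induction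
  h would have a root, where f h is 0.\<close>

theorem intermediate_value:
  assumes "f \<in> polys_over R" "a \<in> R" "b \<in> R" "sg (b - a) = 1" "sg (poly f a) * sg (poly f b) = -1"
  shows "\<exists>c\<in>R. sg (c - a) = 1 \<and> sg (b - c) = 1 \<and> poly f c = 0"
  using assms
proof (induction "degree f" arbitrary: f rule: less_induct)
  case less
  have nz: "f \<noteq> 0" "poly f a \<noteq> 0" "poly f b \<noteq> 0"
    using less.prems(5) by auto
  have split: ?case if gh: "g \<in> polys_over R" "h \<in> polys_over R" "f = g * h"
    "degree g < degree f" "degree h < degree f" for g h
  proof -
    have "sg (poly f a) * sg (poly f b) = (sg (poly g a) * sg (poly g b)) * (sg (poly h a) * sg (poly h b))"
      using gh less.prems by (simp add: sg_mult poly_mem mult_ac)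
    then have "sg (poly g a) * sg (poly g b) = -1 \<or> sg (poly h a) * sg (poly h b) = -1"
      using less.prems(5) gh nz
      by (cases rule: sgn_on_cases[of "poly g a" R]; cases rule: sgn_on_cases[of "poly g b" R]) auto
    then show ?thesis
      using less.hyps[of g] less.hyps[of h] gh less.prems by auto
  qed
  show ?case
  proof (cases "\<exists>c\<in>R. poly f c = 0")
    case True
    then obtain c g where c: "c \<in> R" "g \<in> polys_over R" "f = [:- c, 1:] * g"
      using root_factor[OF less.prems(1)] by metis
    then have cab: "c \<noteq> a" "c \<noteq> b" "g \<noteq> 0"
      using nz by auto
    have deg: "degree f = Suc (degree g)"
      using cab unfolding c(3) by (subst degree_mult_eq) auto
    have eq: "sg (a - c) * sg (b - c) * (sg (poly g a) * sg (poly g b)) = -1"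
    proof -
      have "poly f a = (a - c) * poly g a" "poly f b = (b - c) * poly g b"
        unfolding c(3) by (simp_all add: algebra_simps)
      then show ?thesis
        using less.prems(2,3,5) c by (simp add: sg_mult poly_mem closed mult_ac)
    qed
    show ?thesis
    proof (cases "sg (poly g a) * sg (poly g b) = -1")
      case True
      obtain d where d: "d \<in> R" "sg (d - a) = 1" "sg (b - d) = 1" "poly g d = 0"
        using less.hyps[of g] deg c True less.prems by auto
      then have "poly f d = 0"
        unfolding c(3) by simp
      with d show ?thesis by blast
    next
      case False
      then have "sg (a - c) * sg (b - c) = -1"
        using eq by (cases rule: sgn_on_cases[of "poly g a" R]; cases rule: sgn_on_cases[of "poly g b" R]) auto
      moreover have "\<not> (sg (a - c) = 1 \<and> sg (b - c) = -1)"
        using sg_trans[of a c b] less.prems(4) by auto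
      ultimately have "sg (c - a) = 1 \<and> sg (b - c) = 1"
        using sg_diff_swap[of a c] c(1) less.prems(2)
        by (cases rule: sgn_on_cases[of "a - c" R]; cases rule: sgn_on_cases[of "b - c" R]) auto
      moreover have "poly f c = 0"
        unfolding c(3) by simp
      ultimately show ?thesis
        using c(1) by blast
    qed
  next
    case False
    have "degree f \<noteq> 0"
    proof
      assume "degree f = 0"
      then have "poly f a = poly f b"
        by (metis degree_eq_zeroE poly_pCons poly_0 mult_zero_right)
      then show False
        using less.prems(5) by (cases rule: sgn_on_cases[of "poly f b" R]) auto
    qed
    moreover have "degree f \<noteq> 1"
    proof
      assume "degree f = 1"
      then obtain u v where f: "f = [:u, v:]" "v \<noteq> 0"
        by (rule degree1_coeffs)
      then have "- u / v \<in> R" "poly f (- u / v) = 0"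
        using less.prems(1) by (auto simp: pCons_mem_iff intro!: divide_mem closed)
      then show False using False by blast
    qed
    ultimately have deg: "2 \<le> degree f" by linarith
    show ?thesis
    proof (cases "\<exists>g h. g \<in> polys_over R \<and> h \<in> polys_over R \<and> f = g * h \<and> degree g \<noteq> 0 \<and> degree h \<noteq> 0")
      case True
      then obtain g h where gh: "g \<in> polys_over R" "h \<in> polys_over R" "f = g * h" "degree g \<noteq> 0" "degree h \<noteq> 0"
        by blast
      then have "degree f = degree g + degree h"
        using nz by (auto intro: degree_mult_eq)
      then show ?thesis
        using split[OF gh(1-3)] gh by auto
    next
      case irr: False
      then have irr': "degree g = 0 \<or> degree h = 0"
        if "g \<in> polys_over R" "h \<in> polys_over R" "f = g * h" for g h
        using that by blast
      obtain s h where s: "s \<in> sos {g \<in> polys_over R. degree g < degree f}" "h \<in> polys_over R"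
        "1 + s = f * h" "h \<noteq> 0" "Suc (degree h) < degree f"
        by (rule irreducible_dvd_reduced[OF less.prems(1) deg irr'])
      have "s \<in> sos (polys_over R)"
        by (rule sos_mono[OF s(1)]) auto
      \<comment> \<open>Evaluating s at a point of R gives a sum of squares in R, so f h is positive
        there; f and h have the same nonzero sign everywhere.\<close>
      have pos: "sg (poly f x) * sg (poly h x) = 1" if x: "x \<in> R" for x
      proof -
        have "1 + poly s x = poly f x * poly h x"
          by (metis s(3) poly_add poly_1 poly_mult)
        then show ?thesis
          using sg_one_plus_sos[OF poly_sos[OF \<open>s \<in> sos (polys_over R)\<close> x]]
            sg_mult[OF poly_mem[OF less.prems(1) x] poly_mem[OF s(2) x]] by simp
      qed
      have "sg (poly h a) * sg (poly h b) = -1"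
        using pos[of a] pos[of b] less.prems(2,3,5)
        by (cases rule: sgn_on_cases[of "poly f a" R]; cases rule: sgn_on_cases[of "poly f b" R]) auto
      then obtain c where "c \<in> R" "poly h c = 0"
        using less.hyps[of h] s(2,5) less.prems by auto
      with pos[of c] show ?thesis by simp
    qed
  qed
qed

end

section \<open>Rolle's theorem and root separation\<close>

context real_closed_subfield
begin

lemma trichotomy:
  assumes "a \<in> R" "b \<in> R"
  shows "a = b \<or> sg (b - a) = 1 \<or> sg (a - b) = 1"
  using sg_diff_swap[OF assms] by (cases rule: sgn_on_cases[of "b - a" R]) auto

lemma two_neq_0: "(2 :: 'w) \<noteq> 0"
  using of_nat_neq_0[of 2] by simp

lemma between_exists:
  assumes "a \<in> R" "b \<in> R" "sg (b - a) = 1"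
  shows "\<exists>c\<in>R. sg (c - a) = 1 \<and> sg (b - c) = 1"
proof -
  define c where "c = (a + b) / 2"
  have half: "1 / 2 \<in> R" "sg (1 / 2) = 1"
  proof -
    show *: "1 / 2 \<in> R"
      using of_nat_mem[of 2] by (intro divide_mem closed) simp
    have "sg (2 * (1 / 2)) = sg 2 * sg (1 / 2)"
      using * of_nat_mem[of 2] by (intro sg_mult) simp_all
    then show "sg (1 / 2) = 1"
      using sg_of_nat[of 2] sg_one two_neq_0 by simp
  qed
  have "c - a = (b - a) * (1 / 2)" "b - c = (b - a) * (1 / 2)"
    using two_neq_0 by (simp_all add: c_def field_simps)
  moreover have "c \<in> R"
    using assms half(1) mult_mem[of "a + b" "1 / 2"] by (simp add: c_def closed)
  ultimately show ?thesis
    using assms(3) half(2) by (metis sg_mult_pos)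
qed

lemma exists_maximum:
  "finite A \<Longrightarrow> A \<noteq> {} \<Longrightarrow> A \<subseteq> R \<Longrightarrow> \<exists>m\<in>A. \<forall>z\<in>A. z \<noteq> m \<longrightarrow> sg (m - z) = 1"
proof (induction A rule: finite_ne_induct)
  case (insert a A)
  then obtain m where m: "m \<in> A" "\<forall>z\<in>A. z \<noteq> m \<longrightarrow> sg (m - z) = 1"
    by auto
  then consider "a = m" | "sg (m - a) = 1" | "sg (a - m) = 1"
    using trichotomy[of a m] insert.prems by auto
  then show ?case
  proof cases
    case 3
    then have "\<forall>z\<in>insert a A. z \<noteq> a \<longrightarrow> sg (a - z) = 1"
      using m(2) sg_trans[where b = m] by (metis insert_iff)
    then show ?thesis by blast
  qed (use m in auto)
qed auto

lemma exists_minimum: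
  assumes "finite A" "A \<noteq> {}" "A \<subseteq> R"
  shows "\<exists>m\<in>A. \<forall>z\<in>A. z \<noteq> m \<longrightarrow> sg (z - m) = 1"
proof -
  have "uminus ` A \<subseteq> R"
    using assms(3) by (auto intro: closed)
  then obtain m where "m \<in> A" "\<forall>z\<in>A. - z \<noteq> - m \<longrightarrow> sg (- m - - z) = 1"
    using exists_maximum[of "uminus ` A"] assms by auto
  then show ?thesis by (metis minus_diff_minus minus_diff_eq neg_equal_iff_equal)
qed

lemma upper_bound:
  assumes "finite A" "A \<subseteq> R"
  shows "\<exists>M\<in>R. \<forall>z\<in>A. sg (M - z) = 1"
proof (cases "A = {}")
  case False
  then obtain m where m: "m \<in> A" "\<forall>z\<in>A. z \<noteq> m \<longrightarrow> sg (m - z) = 1"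
    using exists_maximum assms by blast
  have 1: "sg (m + 1 - m) = 1"
    using sg_one by simp
  have "sg (m + 1 - z) = 1" if "z \<in> A" for z
    using m(2) that 1 sg_trans[OF _ 1] by (cases "z = m") auto
  then show ?thesis
    using m(1) assms by (intro bexI[of _ "m + 1"]) (auto intro: closed)
qed (use zero_mem in auto)

lemma same_sign:
  assumes "f \<in> polys_over R" "a \<in> R" "b \<in> R" "sg (b - a) = 1" "poly f a \<noteq> 0" "poly f b \<noteq> 0"
    "\<And>c. c \<in> R \<Longrightarrow> sg (c - a) = 1 \<Longrightarrow> sg (b - c) = 1 \<Longrightarrow> poly f c \<noteq> 0"
  shows "sg (poly f a) = sg (poly f b)"
  using intermediate_value[OF assms(1-4)] assms(5-7)
  by (cases rule: sgn_on_cases[of "poly f a" R]; cases rule: sgn_on_cases[of "poly f b" R]) auto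

lemma root_factor_power:
  assumes "f \<in> polys_over R" "f \<noteq> 0" "a \<in> R"
  obtains m q where "q \<in> polys_over R" "f = [:- a, 1:] ^ m * q" "poly q a \<noteq> 0"
proof -
  have "\<exists>m q. q \<in> polys_over R \<and> f = [:- a, 1:] ^ m * q \<and> poly q a \<noteq> 0"
    using assms(1,2)
  proof (induction "degree f" arbitrary: f rule: less_induct)
    case less
    show ?case
    proof (cases "poly f a = 0")
      case True
      then obtain g where g: "g \<in> polys_over R" "f = [:- a, 1:] * g"
        using root_factor[OF less.prems(1) assms(3)] by metis
      then have "g \<noteq> 0" using less.prems by auto
      then have "degree f = Suc (degree g)"
        unfolding g(2) by (subst degree_mult_eq) auto
      then obtain m q where "q \<in> polys_over R" "g = [:- a, 1:] ^ m * q" "poly q a \<noteq> 0"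
        using less.hyps[of g] g \<open>g \<noteq> 0\<close> by auto
      then show ?thesis
        using g(2) by (intro exI[of _ "Suc m"] exI[of _ q]) (simp only: power_Suc mult.assoc simp_thms)
    next
      case False
      then show ?thesis
        using less.prems by (intro exI[of _ 0] exI[of _ f]) auto
    qed
  qed
  then show thesis using that by blast
qed

text \<open>Induction on the number of roots strictly between a and b: such a root can take the
  place of b. With no root in between, f = (X - a)^m (X - b)^k g where g keeps its sign on the
  closed interval, and the intermediate value theorem applies to what is left of the derivative
  after the factors X - a and X - b are taken out.\<close>

lemma rolle:
  assumes "f \<in> polys_over R" "f \<noteq> 0" "a \<in> R" "b \<in> R" "sg (b - a) = 1" "poly f a = 0" "poly f b = 0"
  shows "\<exists>c\<in>R. sg (c - a) = 1 \<and> sg (b - c) = 1 \<and> poly (pderiv f) c = 0"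
  using assms(4,5,7)
proof (induction "card {c\<in>R. sg (c - a) = 1 \<and> sg (b - c) = 1 \<and> poly f c = 0}" arbitrary: b rule: less_induct)
  case less
  have fin: "finite {c\<in>R. P c \<and> Q c \<and> poly f c = 0}" for P Q
    by (rule finite_subset[OF _ poly_roots_finite[OF assms(2)]]) auto
  show ?case
  proof (cases "\<exists>d\<in>R. sg (d - a) = 1 \<and> sg (b - d) = 1 \<and> poly f d = 0")
    case True
    then obtain d where d: "d \<in> R" "sg (d - a) = 1" "sg (b - d) = 1" "poly f d = 0"
      by blast
    have "{c\<in>R. sg (c - a) = 1 \<and> sg (d - c) = 1 \<and> poly f c = 0}
        \<subset> {c\<in>R. sg (c - a) = 1 \<and> sg (b - c) = 1 \<and> poly f c = 0}" (is "?A \<subset> ?B")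
    proof
      show "?A \<subseteq> ?B" using d sg_trans by blast
      have "d \<in> ?B" "d \<notin> ?A" using d by auto
      then show "?A \<noteq> ?B" by blast
    qed
    then obtain c where "c \<in> R" "sg (c - a) = 1" "sg (d - c) = 1" "poly (pderiv f) c = 0"
      using less.hyps[OF psubset_card_mono[OF fin] d(1,2,4)] by blast
    then show ?thesis
      using sg_trans[OF _ d(3)] by blast
  next
    case False
    obtain m q where q: "q \<in> polys_over R" "f = [:- a, 1:] ^ m * q" "poly q a \<noteq> 0"
      using root_factor_power assms by blast
    have "q \<noteq> 0" using q(3) by auto
    then obtain k g where g: "g \<in> polys_over R" "q = [:- b, 1:] ^ k * g" "poly g b \<noteq> 0"
      using root_factor_power less.prems(1) q(1) by blast
    have ab: "a \<noteq> b" using less.prems by auto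
    have ga: "poly g a \<noteq> 0" using q(3) g(2) by auto
    have "poly f a = 0 ^ m * poly q a"
      unfolding q(2) by simp
    then have "m \<noteq> 0"
      using q(3) assms(6) by (cases m) auto
    then obtain m' where m': "m = Suc m'" using not0_implies_Suc by blast
    have "poly f b = (b - a) ^ m * (0 ^ k * poly g b)"
      unfolding q(2) g(2) by (simp add: algebra_simps)
    then have "k \<noteq> 0"
      using less.prems(3) ab g(3) by (cases k) auto
    then obtain k' where k': "k = Suc k'" using not0_implies_Suc by blast
    \<comment> \<open>H is the derivative of f divided by (X - a)^(m - 1) (X - b)^(k - 1). At a and
      at b a single term survives, m (a - b) g(a) and k (b - a) g(b); these have opposite signs,
      because positive integers are positive in R.\<close>
    define H where "H = ([:of_nat m:] * [:- b, 1:] + [:of_nat k:] * [:- a, 1:]) * g + [:- a, 1:] * [:- b, 1:] * pderiv g"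
    have H: "H \<in> polys_over R"
      unfolding H_def using g(1) assms(3) less.prems(1)
      by (intro poly_closed X_minus_mem pderiv_mem[OF unital_subring_axioms])
        (simp_all add: const_mem_iff closed)
    have dX: "pderiv ([:- c, 1:] ^ Suc j) = [:of_nat (Suc j):] * [:- c, 1:] ^ j" for c :: 'w and j
      by (simp add: pderiv_power_Suc pderiv_pCons del: power_Suc of_nat_Suc)
    have "pderiv f = [:- a, 1:] ^ m' * [:- b, 1:] ^ k' * H"
      unfolding q(2) g(2) m' k' pderiv_mult dX H_def
      by (simp only: power_Suc ring_distribs mult_ac add_ac)
    moreover have "sg (poly g a) = sg (poly g b)"
    proof (rule same_sign[OF g(1) assms(3) less.prems(1,2) ga g(3)])
      show "poly g c \<noteq> 0" if "c \<in> R" "sg (c - a) = 1" "sg (b - c) = 1" for c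
        using False that unfolding q(2) g(2) by auto
    qed
    moreover have "poly H a = of_nat m * (a - b) * poly g a" "poly H b = of_nat k * (b - a) * poly g b"
      by (simp_all add: H_def algebra_simps)
    then have "sg (poly H a) * sg (poly H b) = (sg (a - b) * sg (poly g a)) * (sg (b - a) * sg (poly g b))"
      using sg_of_nat[of m] sg_of_nat[of k] \<open>m \<noteq> 0\<close> \<open>k \<noteq> 0\<close> assms(3) less.prems(1) g(1)
      by (simp add: sg_mult closed poly_mem)
    ultimately have "sg (poly H a) * sg (poly H b) = -1"
      using sg_diff_swap[OF less.prems(1) assms(3)] less.prems(2) g(3)
      by (cases rule: sgn_on_cases[of "poly g b" R]) auto
    then obtain c where "c \<in> R" "sg (c - a) = 1" "sg (b - c) = 1" "poly H c = 0"
      using intermediate_value[OF H assms(3) less.prems(1,2)] by blast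
    with \<open>pderiv f = _\<close> show ?thesis by auto
  qed
qed

text \<open>Horner's scheme: for f = a + X g with g nonconstant, g exceeds 1 from some point on, and
  f(x) - B = x (g(x) - 1) + (x - (B - a)) is a sum of two positive terms once x also exceeds 0 and B
  - a.\<close>

lemma eventually_greater:
  assumes "f \<in> polys_over R" "degree f > 0" "sg (lead_coeff f) = 1" "B \<in> R"
  shows "\<exists>M\<in>R. \<forall>x\<in>R. sg (x - M) = 1 \<longrightarrow> sg (poly f x - B) = 1"
  using assms
proof (induction f arbitrary: B)
  case (pCons a g)
  have g: "g \<noteq> 0" "g \<in> polys_over R" "sg (lead_coeff g) = 1" "a \<in> R"
    using pCons.prems by (auto simp: pCons_mem_iff split: if_splits)
  show ?case
  proof (cases "degree g = 0")
    case True
    then obtain c where c: "g = [:c:]" by (auto elim: degree_eq_zeroE)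
    then have c': "c \<in> R" "sg c = 1" "c \<noteq> 0"
      using g by (auto simp: const_mem_iff)
    have "sg (poly (pCons a g) x - B) = 1" if "sg (x - (B - a) / c) = 1" for x
    proof -
      have "poly (pCons a g) x - B = c * (x - (B - a) / c)"
        using c' by (simp add: c field_simps)
      then show ?thesis using sg_mult_pos[OF c'(2) that] by simp
    qed
    moreover have "(B - a) / c \<in> R"
      using pCons.prems(4) g c' by (intro divide_mem closed)
    ultimately show ?thesis by blast
  next
    case False
    then obtain M1 where M1: "M1 \<in> R" "\<forall>x\<in>R. sg (x - M1) = 1 \<longrightarrow> sg (poly g x - 1) = 1"
      using pCons.IH[of 1] g one_mem by auto
    obtain M where M: "M \<in> R" "sg (M - M1) = 1" "sg (M - 0) = 1" "sg (M - (B - a)) = 1"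
      using upper_bound[of "{M1, 0, B - a}"] M1(1) g(4) pCons.prems(4) by (auto simp: closed)
    have "sg (poly (pCons a g) x - B) = 1" if x: "x \<in> R" "sg (x - M) = 1" for x
    proof -
      have "sg (x * (poly g x - 1)) = 1" "sg (x - (B - a)) = 1"
        using sg_trans[OF M(2) x(2)] sg_trans[OF M(3) x(2)] sg_trans[OF M(4) x(2)] M1(2) x(1)
        by (auto intro: sg_mult_pos)
      then have "sg (x * (poly g x - 1) + (x - (B - a))) = 1"
        by (intro sg_add) auto
      then show ?thesis by (simp add: algebra_simps)
    qed
    with M(1) show ?thesis by blast
  qed
qed auto

lemma eventually_sg:
  assumes "f \<in> polys_over R" "f \<noteq> 0"
  shows "\<exists>M\<in>R. \<forall>x\<in>R. sg (x - M) = 1 \<longrightarrow> sg (poly f x) = sg (lead_coeff f)"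
proof (cases "degree f = 0")
  case True
  then show ?thesis
    using zero_mem by (auto elim!: degree_eq_zeroE)
next
  case False
  consider "sg (lead_coeff f) = 1" | "sg (lead_coeff f) = -1"
    using assms(2) by (cases rule: sgn_on_cases[of "lead_coeff f" R]) auto
  then show ?thesis
  proof cases
    case 1
    then show ?thesis
      using eventually_greater[OF assms(1) _ _ zero_mem] False by auto
  next
    case 2
    then have "sg (lead_coeff (- f)) = 1"
      using sg_minus[OF coeff_mem[OF assms(1)]] by simp
    then obtain M where "M \<in> R" "\<forall>x\<in>R. sg (x - M) = 1 \<longrightarrow> sg (poly (- f) x - 0) = 1"
      using eventually_greater[of "- f" 0] False assms(1) by (auto simp: closed poly_closed)
    moreover have "sg (poly f x) = -1" if "x \<in> R" "sg (poly (- f) x - 0) = 1" for x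
      using that sg_minus[OF poly_mem[OF assms(1) that(1)]] by simp
    ultimately show ?thesis
      using 2 by metis
  qed
qed

lemma pcompose_mem:
  "f \<in> polys_over R \<Longrightarrow> g \<in> polys_over R \<Longrightarrow> pcompose f g \<in> polys_over R"
  by (induction f) (auto simp: pcompose_pCons pCons_mem_iff const_mem_iff intro!: poly_closed)

lemma eventually_sg_minus:
  assumes "f \<in> polys_over R" "f \<noteq> 0"
  shows "\<exists>M\<in>R. \<forall>x\<in>R. sg (x - M) = 1 \<longrightarrow> sg (poly f (- x)) = (-1) ^ degree f * sg (lead_coeff f)"
proof -
  define g where "g = pcompose f [:0, -1:]"
  have lc: "lead_coeff g = lead_coeff f * (-1) ^ degree f"
    unfolding g_def by (subst lead_coeff_comp) auto
  have "g \<in> polys_over R"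
    unfolding g_def using assms(1) by (intro pcompose_mem) (auto simp: pCons_mem_iff closed poly_closed)
  moreover have "g \<noteq> 0"
    using lc assms(2) by auto
  ultimately obtain M where "M \<in> R" "\<forall>x\<in>R. sg (x - M) = 1 \<longrightarrow> sg (poly g x) = sg (lead_coeff g)"
    using eventually_sg by blast
  moreover have "sg (lead_coeff g) = (-1) ^ degree f * sg (lead_coeff f)"
    unfolding lc using assms(1) sg_minus[OF one_mem]
    by (simp add: sg_mult sg_power sg_one closed coeff_mem)
  moreover have "poly g x = poly f (- x)" for x
    by (simp add: g_def poly_pcompose)
  ultimately show ?thesis by auto
qed

text \<open>A second root of f on the closed interval from l to u would give a critical point
  inside, by Rolle's theorem. The cofactor g of X - r satisfies g(r) = f'(r), which is nonzero, so g
  has no root on the interval and keeps its sign, while X - r changes sign.\<close>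

lemma crossing:
  assumes f: "f \<in> polys_over R" and R: "l \<in> R" "r \<in> R" "u \<in> R"
    and ord: "sg (r - l) = 1" "sg (u - r) = 1" and root: "poly f r = 0"
    and d: "\<And>c. c \<in> R \<Longrightarrow> sg (c - l) = 1 \<Longrightarrow> sg (u - c) = 1 \<Longrightarrow> poly (pderiv f) c \<noteq> 0"
  shows "sg (poly f l) * sg (poly f u) = -1"
proof -
  obtain g where g: "g \<in> polys_over R" "f = [:- r, 1:] * g"
    using root_factor[OF f R(2) root] by metis
  have nz: "f \<noteq> 0"
    using d[OF R(2) ord] by auto
  have "poly (pderiv f) r = poly g r"
    by (simp only: g(2) pderiv_mult poly_add poly_mult) (simp add: pderiv_pCons)
  then have gr: "poly g r \<noteq> 0"
    using d[OF R(2) ord] by simp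
  have left: "poly f x \<noteq> 0" if x: "x \<in> R" "sg (r - x) = 1" "x = l \<or> sg (x - l) = 1" for x
  proof
    assume "poly f x = 0"
    then obtain c where c: "c \<in> R" "sg (c - x) = 1" "sg (r - c) = 1" "poly (pderiv f) c = 0"
      using rolle[OF f nz x(1) R(2) x(2)] root by blast
    then have "sg (c - l) = 1" "sg (u - c) = 1"
      using x(3) sg_trans[of x l c] sg_trans[OF c(3) ord(2)] by auto
    with d[OF c(1)] c(4) show False by blast
  qed
  have right: "poly f x \<noteq> 0" if x: "x \<in> R" "sg (x - r) = 1" "x = u \<or> sg (u - x) = 1" for x
  proof
    assume "poly f x = 0"
    then obtain c where c: "c \<in> R" "sg (c - r) = 1" "sg (x - c) = 1" "poly (pderiv f) c = 0"
      using rolle[OF f nz R(2) x(1,2)] root by blast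
    then have "sg (c - l) = 1" "sg (u - c) = 1"
      using x(3) sg_trans[of x c u] sg_trans[OF ord(1) c(2)] by auto
    with d[OF c(1)] c(4) show False by blast
  qed
  have "sg (poly g l) = sg (poly g u)"
  proof (rule same_sign[OF g(1) R(1,3) sg_trans[OF ord]])
    show "poly g l \<noteq> 0" "poly g u \<noteq> 0"
      using left[of l] right[of u] R ord unfolding g(2) by auto
    show "poly g c \<noteq> 0" if "c \<in> R" "sg (c - l) = 1" "sg (u - c) = 1" for c
      using trichotomy[of r c] R left[of c] right[of c] that gr unfolding g(2) by auto
  qed
  moreover have "poly g u \<noteq> 0"
    using right[of u] R ord unfolding g(2) by auto
  moreover have "poly f l = (l - r) * poly g l" "poly f u = (u - r) * poly g u"
    unfolding g(2) by (simp_all add: algebra_simps)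
  ultimately show ?thesis
    using ord sg_diff_swap[OF R(2,1)] R g(1)
    by (cases rule: sgn_on_cases[of "poly g u" R]) (auto simp: sg_mult closed poly_mem)
qed

text \<open>This lemma and \<open>sg_gap_right\<close> determine the sign of f at a point x that is
  not a root and lies in a gap from l to u without critical points. With no root in [l, x), the sign
  is that at l. With a root there, Rolle's theorem excludes roots in (x, u], and the sign is that at
  u. Which case applies is all that has to be known about x.\<close>

lemma sg_gap_left:
  assumes "f \<in> polys_over R" "l \<in> R" "x \<in> R" "sg (x - l) = 1" "poly f x \<noteq> 0"
    and "\<And>r. r \<in> R \<Longrightarrow> r = l \<or> sg (r - l) = 1 \<Longrightarrow> sg (x - r) = 1 \<Longrightarrow> poly f r \<noteq> 0"
  shows "sg (poly f x) = sg (poly f l)"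
  using same_sign[of f l x] assms by simp

lemma sg_gap_right:
  assumes f: "f \<in> polys_over R" and R: "l \<in> R" "x \<in> R" "u \<in> R"
    and ord: "sg (x - l) = 1" "sg (u - x) = 1" and nz: "poly f x \<noteq> 0"
    and r: "r \<in> R" "r = l \<or> sg (r - l) = 1" "sg (x - r) = 1" "poly f r = 0"
    and d: "\<And>c. c \<in> R \<Longrightarrow> sg (c - l) = 1 \<Longrightarrow> sg (u - c) = 1 \<Longrightarrow> poly (pderiv f) c \<noteq> 0"
  shows "sg (poly f x) = sg (poly f u)"
proof -
  have *: "poly f y \<noteq> 0" if y: "y \<in> R" "sg (y - x) = 1" "y = u \<or> sg (u - y) = 1" for y
  proof
    assume "poly f y = 0"
    then obtain c where c: "c \<in> R" "sg (c - r) = 1" "sg (y - c) = 1" "poly (pderiv f) c = 0"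
      using rolle[OF f _ r(1) y(1) sg_trans[OF r(3) y(2)]] r(4) nz by force
    then have "sg (c - l) = 1" "sg (u - c) = 1"
      using r(2) y(3) sg_trans[of r l c] sg_trans[of y c u] by auto
    with d[OF c(1)] c(4) show False by blast
  qed
  show ?thesis
    using same_sign[OF f R(2,3) ord(2) nz] * R ord by blast
qed

end

section \<open>Sign tables\<close>

context real_closed_subfield
begin

text \<open>The points M and -M stand in for the infinite ends of the line.\<close>

lemma sentinel:
  assumes "finite A" "A \<subseteq> R" "f \<in> polys_over R" "f \<noteq> 0"
  shows "\<exists>M\<in>R. (\<forall>a\<in>A. sg (M - a) = 1 \<and> sg (- M - a) = -1) \<and> sg (- M - M) = -1 \<and>
    sg (poly f M) = sg (lead_coeff f) \<and> sg (poly f (- M)) = (-1) ^ degree f * sg (lead_coeff f)"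
proof -
  obtain M1 where M1: "M1 \<in> R" "\<forall>x\<in>R. sg (x - M1) = 1 \<longrightarrow> sg (poly f x) = sg (lead_coeff f)"
    using eventually_sg assms by blast
  obtain M2 where M2: "M2 \<in> R"
    "\<forall>x\<in>R. sg (x - M2) = 1 \<longrightarrow> sg (poly f (- x)) = (-1) ^ degree f * sg (lead_coeff f)"
    using eventually_sg_minus assms by blast
  have "uminus ` A \<subseteq> R"
    using assms(2) by (auto simp: uminus_mem)
  then have "finite ({0, M1, M2} \<union> A \<union> uminus ` A)" "{0, M1, M2} \<union> A \<union> uminus ` A \<subseteq> R"
    using assms(1,2) M1(1) M2(1) zero_mem by auto
  then obtain M where M: "M \<in> R" "\<forall>z\<in>{0, M1, M2} \<union> A \<union> uminus ` A. sg (M - z) = 1"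
    using upper_bound[of "{0, M1, M2} \<union> A \<union> uminus ` A"] by auto
  have neg: "sg (- M - a) = -1" if "a \<in> A \<or> a = M" for a
  proof -
    have "a \<in> R"
      using that M(1) assms(2) by auto
    moreover have "sg (M - - a) = 1"
    proof (cases "a \<in> A")
      case True
      then have "- a \<in> uminus ` A" by (rule imageI)
      then show ?thesis using M(2) by blast
    next
      case False
      then show ?thesis using that sg_add[of M M] M(2) by simp
    qed
    ultimately have "a \<in> R" "sg (M - - a) = 1" .
    then show ?thesis
      using sg_minus[of "M - - a"] M(1) by (simp add: closed)
  qed
  have "sg (M - M1) = 1" "sg (M - M2) = 1"
    using M(2) by auto
  then have "sg (poly f M) = sg (lead_coeff f)" "sg (poly f (- M)) = (-1) ^ degree f * sg (lead_coeff f)"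
    using M1(2) M2(2) M(1) by auto
  then show ?thesis
    using M neg[of M] neg by (intro bexI[of _ M] conjI ballI) blast+
qed

text \<open>The neighbours of x in D. The points N and M guarantee one on each side; the last clause
  expresses that D has no point strictly between l and u.\<close>

lemma adjacent:
  assumes "finite D" "D \<subseteq> R" "x \<in> R" "x \<notin> D"
    and N: "N \<in> D" "sg (x - N) = 1" and M: "M \<in> D" "sg (M - x) = 1"
  shows "\<exists>l\<in>D. \<exists>u\<in>D. sg (x - l) = 1 \<and> sg (u - x) = 1 \<and>
    (\<forall>a\<in>D. (a = l \<or> sg (l - a) = 1) \<or> (a = u \<or> sg (a - u) = 1))"
proof -
  obtain l where l: "l \<in> {a\<in>D. sg (x - a) = 1}"
    "\<forall>z\<in>{a\<in>D. sg (x - a) = 1}. z \<noteq> l \<longrightarrow> sg (l - z) = 1"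
    using exists_maximum[of "{a\<in>D. sg (x - a) = 1}"] assms by auto
  obtain u where u: "u \<in> {a\<in>D. sg (a - x) = 1}"
    "\<forall>z\<in>{a\<in>D. sg (a - x) = 1}. z \<noteq> u \<longrightarrow> sg (z - u) = 1"
    using exists_minimum[of "{a\<in>D. sg (a - x) = 1}"] assms by auto
  have "(a = l \<or> sg (l - a) = 1) \<or> (a = u \<or> sg (a - u) = 1)" if "a \<in> D" for a
    using trichotomy[of a x] that assms l(2) u(2) by auto
  then show ?thesis
    using l u by blast
qed

end

text \<open>
  A set T of pairs lists corresponding points of R and S. It cuts both lines into cells, and
  \<open>same_position\<close> says that two points lie in corresponding cells. A sign table for f and g says that
  all roots are listed and that f and g have the same sign on corresponding cells.
\<close>

definition order_matching :: "'a::field set \<Rightarrow> 'b::field set \<Rightarrow> ('a \<times> 'b) set \<Rightarrow> bool" where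
  "order_matching R S T \<longleftrightarrow> finite T \<and> T \<subseteq> R \<times> S \<and>
     (\<forall>a a' b b'. (a, a') \<in> T \<longrightarrow> (b, b') \<in> T \<longrightarrow> sgn_on R (b - a) = sgn_on S (b' - a'))"

definition same_position ::
    "'a::field set \<Rightarrow> 'b::field set \<Rightarrow> ('a \<times> 'b) set \<Rightarrow> 'a \<Rightarrow> 'b \<Rightarrow> bool" where
  "same_position R S T x y \<longleftrightarrow> (\<forall>a a'. (a, a') \<in> T \<longrightarrow> sgn_on R (x - a) = sgn_on S (y - a'))"

definition sign_table ::
    "'a::field set \<Rightarrow> 'b::field set \<Rightarrow> ('a \<times> 'b) set \<Rightarrow> 'a poly \<Rightarrow> 'b poly \<Rightarrow> bool" where
  "sign_table R S T f g \<longleftrightarrow> f = 0 \<and> g = 0 \<or>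
     (\<forall>x\<in>R. poly f x = 0 \<longrightarrow> x \<in> Domain T) \<and> (\<forall>y\<in>S. poly g y = 0 \<longrightarrow> y \<in> Range T) \<and>
     (\<forall>x\<in>R. \<forall>y\<in>S. same_position R S T x y \<longrightarrow> sgn_on R (poly f x) = sgn_on S (poly g y))"

lemma same_positionD: "same_position R S T x y \<Longrightarrow> (a, a') \<in> T \<Longrightarrow> sgn_on R (x - a) = sgn_on S (y - a')"
  by (simp add: same_position_def)

lemma same_position_mono: "same_position R S T' x y \<Longrightarrow> T \<subseteq> T' \<Longrightarrow> same_position R S T x y"
  by (auto simp: same_position_def)

lemma sign_table_mono: "sign_table R S T f g \<Longrightarrow> T \<subseteq> T' \<Longrightarrow> sign_table R S T' f g"
  unfolding sign_table_def using same_position_mono by (blast intro: Domain_mono Range_mono)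

lemma order_matching_subset: "order_matching R S T' \<Longrightarrow> T \<subseteq> T' \<Longrightarrow> order_matching R S T"
  unfolding order_matching_def by (meson finite_subset subset_iff)

lemma order_matchingD:
  "order_matching R S T \<Longrightarrow> (a, a') \<in> T \<Longrightarrow> (b, b') \<in> T \<Longrightarrow> sgn_on R (b - a) = sgn_on S (b' - a')"
  unfolding order_matching_def by blast

lemma order_matching_mem: "order_matching R S T \<Longrightarrow> (a, a') \<in> T \<Longrightarrow> a \<in> R \<and> a' \<in> S"
  unfolding order_matching_def by blast

lemma order_matching_same_position:
  "order_matching R S T \<Longrightarrow> (a, a') \<in> T \<Longrightarrow> same_position R S T a a'"
  by (auto simp: same_position_def dest: order_matchingD)

lemma order_matching_converse: "order_matching R S T \<Longrightarrow> order_matching S R (T\<inverse>)"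
  by (auto simp: order_matching_def)

lemma same_position_converse: "same_position R S T x y \<longleftrightarrow> same_position S R (T\<inverse>) y x"
  by (auto simp: same_position_def)

section \<open>Matched points on two real closed lines\<close>

locale real_closed_pair = R: real_closed_subfield R + S: real_closed_subfield S
  for R :: "'a::field set" and S :: "'b::field set"
begin

lemma real_closed_pair_swap: "real_closed_pair S R"
  by unfold_locales

lemma order_matching_insert:
  assumes T: "order_matching R S T" and "x \<in> R" "y \<in> S" "same_position R S T x y"
  shows "order_matching R S (insert (x, y) T)"
proof -
  have "sgn_on R (a - x) = sgn_on S (a' - y)" if "(a, a') \<in> T" for a a'
    using R.sg_diff_swap[of x a] S.sg_diff_swap[of y a'] same_positionD[OF assms(4) that]
      order_matching_mem[OF T that] assms by simp
  then show ?thesis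
    using assms unfolding order_matching_def by (auto dest: same_positionD)
qed

text \<open>Far out, a polynomial has a sign determined by its degree and the sign of its leading
  coefficient, so f and g agree at new matched end points beyond everything of interest. Unbounded
  cells need no separate treatment afterwards.\<close>

lemma add_sentinels:
  assumes T: "order_matching R S T"
    and fg: "f \<in> polys_over R" "f \<noteq> 0" "g \<in> polys_over S" "g \<noteq> 0" "degree f = degree g"
      "sgn_on R (lead_coeff f) = sgn_on S (lead_coeff g)"
    and A: "finite A" "A \<subseteq> R" and B: "finite B" "B \<subseteq> S"
  obtains N N' M M' where "order_matching R S (insert (N, N') (insert (M, M') T))"
    "\<And>x. x \<in> A \<Longrightarrow> sgn_on R (x - N) = 1 \<and> sgn_on R (M - x) = 1"
    "\<And>y. y \<in> B \<Longrightarrow> sgn_on S (y - N') = 1 \<and> sgn_on S (M' - y) = 1"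
    "sgn_on R (poly f N) = sgn_on S (poly g N')" "sgn_on R (poly f M) = sgn_on S (poly g M')"
proof -
  have fin: "finite (Domain T)" "Domain T \<subseteq> R" "finite (Range T)" "Range T \<subseteq> S"
    using T by (auto simp: order_matching_def finite_Domain finite_Range)
  obtain M where M: "M \<in> R" "\<forall>a\<in>A \<union> Domain T. R.sg (M - a) = 1 \<and> R.sg (- M - a) = -1"
    "R.sg (- M - M) = -1" "R.sg (poly f M) = R.sg (lead_coeff f)"
    "R.sg (poly f (- M)) = (-1) ^ degree f * R.sg (lead_coeff f)"
    using R.sentinel[of "A \<union> Domain T" f] A fin fg by auto
  obtain M' where M': "M' \<in> S" "\<forall>a\<in>B \<union> Range T. S.sg (M' - a) = 1 \<and> S.sg (- M' - a) = -1"
    "S.sg (- M' - M') = -1" "S.sg (poly g M') = S.sg (lead_coeff g)"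
    "S.sg (poly g (- M')) = (-1) ^ degree g * S.sg (lead_coeff g)"
    using S.sentinel[of "B \<union> Range T" g] B fin fg by auto
  have MT: "R.sg (M - a) = 1 \<and> R.sg (- M - a) = -1 \<and> S.sg (M' - a') = 1 \<and> S.sg (- M' - a') = -1"
    if "(a, a') \<in> T" for a a'
    using M(2) M'(2) that by blast
  then have "same_position R S T M M'"
    by (simp add: same_position_def)
  then have 1: "order_matching R S (insert (M, M') T)"
    using order_matching_insert T M(1) M'(1) by blast
  have "same_position R S (insert (M, M') T) (- M) (- M')"
    using MT M(3) M'(3) by (auto simp: same_position_def)
  then have "order_matching R S (insert (- M, - M') (insert (M, M') T))"
    by (rule order_matching_insert[OF 1 R.uminus_mem[OF M(1)] S.uminus_mem[OF M'(1)]])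
  moreover have "R.sg (x - - M) = 1" if "x \<in> A" for x
    using M(1,2) R.sg_diff_swap[of "- M" x] that A by (auto simp: R.closed)
  moreover have "S.sg (y - - M') = 1" if "y \<in> B" for y
    using M'(1,2) S.sg_diff_swap[of "- M'" y] that B by (auto simp: S.closed)
  ultimately show thesis
    using that[of "- M" "- M'" M M'] M M' fg(5,6) by auto
qed

text \<open>Every listed point is at most l or at least u, so comparing it with x amounts to
  comparing it with l or u, and that comparison is the same for the partners.\<close>

lemma same_position_between:
  assumes T: "order_matching R S T" and mem: "(l, l') \<in> T" "(u, u') \<in> T" "x \<in> R" "y \<in> S"
    and x: "R.sg (x - l) = 1" "R.sg (u - x) = 1" and y: "S.sg (y - l') = 1" "S.sg (u' - y) = 1"
    and adj: "\<forall>a\<in>Domain T. (a = l \<or> R.sg (l - a) = 1) \<or> (a = u \<or> R.sg (a - u) = 1)"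
  shows "same_position R S T x y"
  unfolding same_position_def
proof (intro allI impI)
  fix a a' assume a: "(a, a') \<in> T"
  note aRS = order_matching_mem[OF T a]
  consider "a = l \<or> R.sg (l - a) = 1" | "a = u \<or> R.sg (a - u) = 1"
    using adj a by blast
  then show "R.sg (x - a) = S.sg (y - a')"
  proof cases
    case 1
    then have "R.sg (x - a) = 1"
      using x(1) R.sg_trans by blast
    moreover have "a' = l' \<or> S.sg (l' - a') = 1"
      using 1 order_matchingD[OF T a mem(1)] by auto
    then have "S.sg (y - a') = 1"
      using y(1) S.sg_trans by blast
    ultimately show ?thesis by simp
  next
    case 2
    then have "R.sg (a - x) = 1"
      using x(2) R.sg_trans by blast
    moreover have "a' = u' \<or> S.sg (a' - u') = 1"
      using 2 order_matchingD[OF T mem(2) a] by auto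
    then have "S.sg (a' - y) = 1"
      using y(2) S.sg_trans by blast
    ultimately show ?thesis
      using R.sg_diff_swap[of a x] S.sg_diff_swap[of a' y] aRS mem by simp
  qed
qed

text \<open>A listed point has a partner. Any other point lies between two neighbours, and a point
  between their partners exists because the order of S is dense.\<close>

lemma exists_same_position:
  assumes T: "order_matching R S T" and x: "x \<in> R"
  shows "\<exists>y\<in>S. same_position R S T x y"
proof (cases "x \<in> Domain T")
  case True
  then show ?thesis
    using order_matching_same_position[OF T] order_matching_mem[OF T] by blast
next
  case False
  obtain N N' M M' where T1: "order_matching R S (insert (N, N') (insert (M, M') T))"
      (is "order_matching R S ?T1")
    and NM: "R.sg (x - N) = 1" "R.sg (M - x) = 1"
    \<comment> \<open>Only the order matters here, so the constant 1 is put in for both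
      polynomials.\<close>
    by (rule add_sentinels[OF T, of 1 1 "{x}" "{}"])
      (use x R.sg_one S.sg_one R.poly_closed S.poly_closed in auto)
  have fin: "finite (Domain ?T1)" "Domain ?T1 \<subseteq> R"
    using T1 unfolding order_matching_def by (blast intro: finite_Domain)+
  have "x \<notin> Domain ?T1"
    using False NM by auto
  then obtain l u where lu: "l \<in> Domain ?T1" "u \<in> Domain ?T1" "R.sg (x - l) = 1" "R.sg (u - x) = 1"
    "\<forall>a\<in>Domain ?T1. (a = l \<or> R.sg (l - a) = 1) \<or> (a = u \<or> R.sg (a - u) = 1)"
    using R.adjacent[OF fin x _ _ NM(1) _ NM(2)] by auto
  then obtain l' u' where lu': "(l, l') \<in> ?T1" "(u, u') \<in> ?T1"
    by blast
  have "S.sg (u' - l') = 1"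
    using order_matchingD[OF T1 lu'] R.sg_trans[OF lu(3,4)] by simp
  then obtain y where "y \<in> S" "S.sg (y - l') = 1" "S.sg (u' - y) = 1"
    using S.between_exists order_matching_mem[OF T1 lu'(1)] order_matching_mem[OF T1 lu'(2)] by blast
  then show ?thesis
    using same_position_mono[OF same_position_between[OF T1 lu' x _ lu(3,4) _ _ lu(5)], of y T] by blast
qed

end

text \<open>The setting of one step of the Cohen-Hoermander induction: all critical points are
  listed, and f and g agree in degree, in the sign of the leading coefficient and in sign at the
  listed points. The aim is that listing the roots as well yields a sign table. The setting is
  symmetric, so each fact about R also holds for S through \<open>swap\<close>.\<close>

locale polynomial_step = real_closed_pair R S
  for R :: "'a::field set" and S :: "'b::field set" +
  fixes T f g
  assumes T: "order_matching R S T"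
    and f: "f \<in> polys_over R" and g: "g \<in> polys_over S"
    and degree: "degree f = degree g" "degree f > 0"
    and lead: "sgn_on R (lead_coeff f) = sgn_on S (lead_coeff g)"
    and sign: "(a, a') \<in> T \<Longrightarrow> sgn_on R (poly f a) = sgn_on S (poly g a')"
    and critical: "c \<in> R \<Longrightarrow> poly (pderiv f) c = 0 \<Longrightarrow> c \<in> Domain T"
    and critical': "c' \<in> S \<Longrightarrow> poly (pderiv g) c' = 0 \<Longrightarrow> c' \<in> Range T"
begin

lemma nonzero: "f \<noteq> 0" "g \<noteq> 0"
  using degree by auto

lemma swap: "polynomial_step S R (T\<inverse>) g f"
  using T f g degree lead sign critical critical'
  by (intro polynomial_step.intro real_closed_pair_swap polynomial_step_axioms.intro)
    (auto intro: order_matching_converse)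

text \<open>An unlisted root r lies between neighbours l and u with no critical point of f in
  between, so f has opposite signs at l and u. Then g has opposite signs at the partners and hence a
  root between them.\<close>

lemma match_root:
  assumes r: "r \<in> R" "poly f r = 0"
  shows "\<exists>r'\<in>S. poly g r' = 0 \<and> same_position R S T r r'"
proof (cases "r \<in> Domain T")
  case True
  then obtain r' where r': "(r, r') \<in> T" by blast
  then have "poly g r' = 0"
    using sign[OF r'] r(2) by simp
  then show ?thesis
    using order_matching_same_position[OF T r'] order_matching_mem[OF T r'] by blast
next
  case False
  obtain N N' M M' where T1: "order_matching R S (insert (N, N') (insert (M, M') T))"
      (is "order_matching R S ?T1")
    and NM: "R.sg (r - N) = 1" "R.sg (M - r) = 1"
    and sNM: "R.sg (poly f N) = S.sg (poly g N')" "R.sg (poly f M) = S.sg (poly g M')"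
    by (rule add_sentinels[OF T f nonzero(1) g nonzero(2) degree(1) lead, of "{r}" "{}"]) (use r in auto)
  have fin: "finite (Domain ?T1)" "Domain ?T1 \<subseteq> R"
    using T1 unfolding order_matching_def by (blast intro: finite_Domain)+
  have "r \<notin> Domain ?T1"
    using False NM by auto
  then obtain l u where lu: "l \<in> Domain ?T1" "u \<in> Domain ?T1" "R.sg (r - l) = 1" "R.sg (u - r) = 1"
    "\<forall>a\<in>Domain ?T1. (a = l \<or> R.sg (l - a) = 1) \<or> (a = u \<or> R.sg (a - u) = 1)"
    using R.adjacent[OF fin r(1) _ _ NM(1) _ NM(2)] by auto
  then obtain l' u' where lu': "(l, l') \<in> ?T1" "(u, u') \<in> ?T1"
    by blast
  note luR = order_matching_mem[OF T1 lu'(1)] order_matching_mem[OF T1 lu'(2)]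
  have "poly (pderiv f) c \<noteq> 0" if c: "c \<in> R" "R.sg (c - l) = 1" "R.sg (u - c) = 1" for c
  proof
    assume "poly (pderiv f) c = 0"
    then have "c \<in> Domain ?T1"
      using critical[OF c(1)] by auto
    then show False
      using lu(5) c R.sg_diff_swap[of c l] R.sg_diff_swap[of c u] luR by force
  qed
  then have "R.sg (poly f l) * R.sg (poly f u) = -1"
    using R.crossing[OF f _ r(1) _ lu(3,4) r(2)] luR by blast
  moreover have "R.sg (poly f a) = S.sg (poly g a')" if "(a, a') \<in> ?T1" for a a'
    using that sNM sign by auto
  ultimately have "S.sg (poly g l') * S.sg (poly g u') = -1"
    using lu' by simp
  moreover have "S.sg (u' - l') = 1"
    using order_matchingD[OF T1 lu'] R.sg_trans[OF lu(3,4)] by simp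
  ultimately obtain r' where r': "r' \<in> S" "S.sg (r' - l') = 1" "S.sg (u' - r') = 1" "poly g r' = 0"
    using S.intermediate_value[OF g] luR by blast
  then show ?thesis
    using same_position_mono[OF same_position_between[OF T1 lu' r(1) r'(1) lu(3,4) r'(2,3) lu(5)], of T]
    by blast
qed

text \<open>Rolle's theorem puts a critical point c between the two roots. It is listed, and its
  partner separates r' from q' because these occupy the same cells as r and q.\<close>

lemma root_order:
  assumes r: "r \<in> R" "poly f r = 0" "same_position R S T r r'" "r' \<in> S"
    and q: "q \<in> R" "poly f q = 0" "same_position R S T q q'" "q' \<in> S"
    and less: "R.sg (q - r) = 1"
  shows "S.sg (q' - r') = 1"
proof -
  obtain c where c: "c \<in> R" "R.sg (c - r) = 1" "R.sg (q - c) = 1" "poly (pderiv f) c = 0"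
    using R.rolle[OF f nonzero(1) r(1) q(1) less r(2) q(2)] by blast
  then obtain c' where c': "(c, c') \<in> T"
    using critical by blast
  have "S.sg (q' - c') = 1" "S.sg (r' - c') = -1"
    using same_positionD[OF r(3) c'] same_positionD[OF q(3) c'] c R.sg_diff_swap[OF c(1) r(1)] by simp_all
  then show ?thesis
    using S.sg_diff_swap[of r' c'] S.sg_trans[of c' r' q'] r(4) order_matching_mem[OF T c'] by simp
qed

text \<open>Pairing roots by cells involves no choice: \<open>match_root\<close> provides a partner
  for every root on either line, and \<open>root_order\<close> shows that it is unique.\<close>

definition "roots_matching = {(r, r'). r \<in> R \<and> r' \<in> S \<and> poly f r = 0 \<and> poly g r' = 0 \<and> same_position R S T r r'}"

lemma order_matching_roots: "order_matching R S (T \<union> roots_matching)"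
proof -
  interpret C: polynomial_step S R "T\<inverse>" g f by (rule swap)
  have "roots_matching \<subseteq> {r. poly f r = 0} \<times> {r. poly g r = 0}"
    by (auto simp: roots_matching_def)
  then have fin: "finite roots_matching"
    by (rule finite_subset) (intro finite_cartesian_product poly_roots_finite nonzero)
  have roots: "R.sg (q - r) = S.sg (q' - r')"
    if rm: "(r, r') \<in> roots_matching" "(q, q') \<in> roots_matching" for r r' q q'
  proof -
    have mem: "r \<in> R" "r' \<in> S" "q \<in> R" "q' \<in> S"
      using rm by (auto simp: roots_matching_def)
    have r: "poly f r = 0" "poly g r' = 0" "same_position R S T r r'" "same_position S R (T\<inverse>) r' r"
      and q: "poly f q = 0" "poly g q' = 0" "same_position R S T q q'" "same_position S R (T\<inverse>) q' q"
      using rm by (simp_all add: roots_matching_def same_position_converse[of S R])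
    \<comment> \<open>Strict inequalities have to transfer both ways, so that equal roots on one
      line correspond to equal roots on the other; the copy C gives the direction from S to
      R.\<close>
    have 1: "R.sg (q - r) = 1 \<longleftrightarrow> S.sg (q' - r') = 1"
      using root_order[OF mem(1) r(1,3) mem(2,3) q(1,3) mem(4)]
        C.root_order[OF mem(2) r(2,4) mem(1,4) q(2,4) mem(3)] by blast
    have 2: "R.sg (r - q) = 1 \<longleftrightarrow> S.sg (r' - q') = 1"
      using root_order[OF mem(3) q(1,3) mem(4,1) r(1,3) mem(2)]
        C.root_order[OF mem(4) q(2,4) mem(3,2) r(2,4) mem(1)] by blast
    show ?thesis
      using 1 2 R.trichotomy[OF mem(1,3)] S.trichotomy[OF mem(2,4)]
        R.sg_diff_swap[OF mem(1,3)] S.sg_diff_swap[OF mem(2,4)]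
      by auto
  qed
  have mixed: "R.sg (r - a) = S.sg (r' - a')" "R.sg (a - r) = S.sg (a' - r')"
    if rm: "(r, r') \<in> roots_matching" and a: "(a, a') \<in> T" for r r' a a'
  proof -
    have mem: "r \<in> R" "r' \<in> S" "a \<in> R" "a' \<in> S"
      using rm order_matching_mem[OF T a] by (auto simp: roots_matching_def)
    show "R.sg (r - a) = S.sg (r' - a')"
      using rm same_positionD[OF _ a] by (auto simp: roots_matching_def)
    then show "R.sg (a - r) = S.sg (a' - r')"
      using R.sg_diff_swap[OF mem(1,3)] S.sg_diff_swap[OF mem(2,4)] by simp
  qed
  have "T \<union> roots_matching \<subseteq> R \<times> S"
    using T by (auto simp: order_matching_def roots_matching_def)
  then show ?thesis
    unfolding order_matching_def[of R S "T \<union> roots_matching"]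
    using fin T roots mixed order_matchingD[OF T] by (auto simp: order_matching_def)
qed

text \<open>For unlisted x and y in the same position, x lies in a gap from l to u free of critical
  points of f, and y in the partner gap, free of critical points of g. Matched roots show that f has
  a root in [l, x) exactly if g has one in [l', y). Depending on this, both signs are those at the
  right ends or both are those at the left ends, and at the ends they agree.\<close>

lemma sign_table_roots: "sign_table R S (T \<union> roots_matching) f g"
proof -
  interpret C: polynomial_step S R "T\<inverse>" g f by (rule swap)
  let ?T2 = "T \<union> roots_matching"
  have dom: "\<exists>r'. (r, r') \<in> roots_matching" if "r \<in> R" "poly f r = 0" for r
    using match_root[OF that] that by (auto simp: roots_matching_def)
  have ran: "\<exists>r. (r, r') \<in> roots_matching" if "r' \<in> S" "poly g r' = 0" for r'
    using C.match_root[OF that] that by (auto simp: roots_matching_def same_position_converse[of R S])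
  have "R.sg (poly f x) = S.sg (poly g y)"
    if x: "x \<in> R" and y: "y \<in> S" and xy: "same_position R S ?T2 x y" for x y
  proof (cases "x \<in> Domain ?T2 \<or> y \<in> Range ?T2")
    case True
    \<comment> \<open>Sign 0 records equality, so if one of x and y is listed, the other is its
      partner.\<close>
    have "a = x \<longleftrightarrow> a' = y" if "(a, a') \<in> ?T2" for a a'
      using same_positionD[OF xy that]
      by (metis eq_iff_diff_eq_0 sgn_on_eq_0_iff)
    then have "(x, y) \<in> ?T2"
      using True by auto
    then show ?thesis
      using sign by (auto simp: roots_matching_def)
  next
    case False
    then have nz: "poly f x \<noteq> 0" "poly g y \<noteq> 0"
      using dom[OF x] ran[OF y] by auto
    obtain N N' M M' where T3: "order_matching R S (insert (N, N') (insert (M, M') ?T2))"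
        (is "order_matching R S ?T3")
      and NM: "R.sg (x - N) = 1" "R.sg (M - x) = 1" "S.sg (y - N') = 1" "S.sg (M' - y) = 1"
      and sNM: "R.sg (poly f N) = S.sg (poly g N')" "R.sg (poly f M) = S.sg (poly g M')"
      by (rule add_sentinels[OF order_matching_roots f nonzero(1) g nonzero(2) degree(1) lead, of "{x}" "{y}"])
        (use x y in auto)
    \<comment> \<open>The neighbours of x are taken in \<open>?T1\<close>, which does not include
      \<open>roots_matching\<close>, so that the gap may contain a root of f. The larger
      \<open>?T3\<close> compares such roots with l and x on both lines.\<close>
    let ?T1 = "insert (N, N') (insert (M, M') T)"
    have sub: "?T1 \<subseteq> ?T3" by blast
    note T1 = order_matching_subset[OF T3 sub]
    have xy3: "same_position R S ?T3 x y"
    proof -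
      have "(M, M') \<in> ?T3" by simp
      then have "R.sg (x - M) = S.sg (y - M')"
        using NM x y R.sg_diff_swap[of M x] S.sg_diff_swap[of M' y]
          order_matching_mem[OF T3 \<open>(M, M') \<in> ?T3\<close>] by simp
      then show ?thesis
        using NM xy by (auto simp: same_position_def)
    qed
    have fin: "finite (Domain ?T1)" "Domain ?T1 \<subseteq> R"
      using T1 unfolding order_matching_def by (blast intro: finite_Domain)+
    have "x \<notin> Domain ?T1"
      using False NM by auto
    then obtain l u where lu: "l \<in> Domain ?T1" "u \<in> Domain ?T1" "R.sg (x - l) = 1" "R.sg (u - x) = 1"
      "\<forall>a\<in>Domain ?T1. (a = l \<or> R.sg (l - a) = 1) \<or> (a = u \<or> R.sg (a - u) = 1)"
      using R.adjacent[OF fin x _ _ NM(1) _ NM(2)] by auto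
    then obtain l' u' where lu': "(l, l') \<in> ?T1" "(u, u') \<in> ?T1"
      by blast
    note luR = order_matching_mem[OF T1 lu'(1)] order_matching_mem[OF T1 lu'(2)]
    have lu3: "(l, l') \<in> ?T3" "(u, u') \<in> ?T3"
      using lu' sub by blast+
    have ly: "S.sg (y - l') = 1" "S.sg (u' - y) = 1"
      using same_positionD[OF xy3 lu3(1)] same_positionD[OF xy3 lu3(2)] lu(3,4)
        R.sg_diff_swap[of x u] S.sg_diff_swap[of y u'] x y luR by simp_all
    have between: False if c: "(c, c') \<in> T" "R.sg (c - l) = 1" "R.sg (u - c) = 1" for c c'
    proof -
      have "c \<in> Domain ?T1" "c \<in> R"
        using c order_matching_mem[OF T c(1)] by auto
      then show False
        using lu(5) c R.sg_diff_swap[of c l] R.sg_diff_swap[of c u] luR by force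
    qed
    have df: "poly (pderiv f) c \<noteq> 0" if "c \<in> R" "R.sg (c - l) = 1" "R.sg (u - c) = 1" for c
      using critical[OF that(1)] between that by blast
    have dg: "poly (pderiv g) c' \<noteq> 0" if c': "c' \<in> S" "S.sg (c' - l') = 1" "S.sg (u' - c') = 1" for c'
    proof
      assume "poly (pderiv g) c' = 0"
      then obtain c where c: "(c, c') \<in> T"
        using critical'[OF c'(1)] by blast
      then have "(c, c') \<in> ?T1" by blast
      then show False
        using between[OF c] order_matchingD[OF T1 lu'(1)] order_matchingD[OF T1 _ lu'(2)] c'(2,3) by simp
    qed
    have slu: "R.sg (poly f l) = S.sg (poly g l')" "R.sg (poly f u) = S.sg (poly g u')"
      using lu' sNM sign by auto
    have rm: "(r = l \<or> R.sg (r - l) = 1) \<and> R.sg (x - r) = 1 \<longleftrightarrow>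
        (r' = l' \<or> S.sg (r' - l') = 1) \<and> S.sg (y - r') = 1"
      if "(r, r') \<in> roots_matching" for r r'
    proof -
      have r3: "(r, r') \<in> ?T3" using that by blast
      have "r = l \<longleftrightarrow> r' = l'"
        using order_matchingD[OF T3 lu3(1) r3] by (metis eq_iff_diff_eq_0 sgn_on_eq_0_iff)
      then show ?thesis
        using order_matchingD[OF T3 lu3(1) r3] same_positionD[OF xy3 r3] by simp
    qed
    show ?thesis
    proof (cases "\<exists>r\<in>R. (r = l \<or> R.sg (r - l) = 1) \<and> R.sg (x - r) = 1 \<and> poly f r = 0")
      case True
      then obtain r where r: "r \<in> R" "r = l \<or> R.sg (r - l) = 1" "R.sg (x - r) = 1" "poly f r = 0"
        by blast
      then obtain r' where r': "(r, r') \<in> roots_matching"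
        using dom by blast
      then have "r' \<in> S" "r' = l' \<or> S.sg (r' - l') = 1" "S.sg (y - r') = 1" "poly g r' = 0"
        using rm[OF r'] r by (auto simp: roots_matching_def)
      then have "S.sg (poly g y) = S.sg (poly g u')"
        using S.sg_gap_right[OF g _ y _ ly nz(2) _ _ _ _ dg] luR by blast
      moreover have "R.sg (poly f x) = R.sg (poly f u)"
        using R.sg_gap_right[OF f _ x _ lu(3,4) nz(1) r df] luR by blast
      ultimately show ?thesis using slu by simp
    next
      case none: False
      then have "R.sg (poly f x) = R.sg (poly f l)"
        using R.sg_gap_left[OF f _ x lu(3) nz(1)] luR by blast
      moreover have "S.sg (poly g y) = S.sg (poly g l')"
      proof (rule S.sg_gap_left[OF g _ y ly(1) nz(2)])
        show "poly g r' \<noteq> 0" if r': "r' \<in> S" "r' = l' \<or> S.sg (r' - l') = 1" "S.sg (y - r') = 1" for r'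
        proof
          assume "poly g r' = 0"
          then obtain r where r: "(r, r') \<in> roots_matching"
            using ran r' by blast
          then show False
            using rm[OF r] r' none by (auto simp: roots_matching_def)
        qed
      qed (use luR in blast)
      ultimately show ?thesis using slu by simp
    qed
  qed
  then show ?thesis
    unfolding sign_table_def using dom ran by blast
qed

end

section \<open>Transfer of sign conditions\<close>

definition is_pseudo_remainder :: "'a::idom set \<Rightarrow> 'a poly \<Rightarrow> 'a poly \<Rightarrow> 'a poly \<Rightarrow> bool" where
  "is_pseudo_remainder C f g r \<longleftrightarrow> (\<exists>k. \<exists>q\<in>polys_over C.
     smult (lead_coeff g ^ k) f = q * g + r \<and> (r = 0 \<or> degree r < degree g))"

lemma degree_pderiv_le: "degree (pderiv f) \<le> degree f - 1"
  by (rule degree_le) (auto simp: coeff_pderiv coeff_eq_0)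

text \<open>Two closure properties feed the induction on sign tables. Derivatives supply the
  critical points. Pseudo-remainders supply signs: at a root a of g, the identity reduces to
  \<open>lead_coeff g ^ k * poly f a = poly r a\<close>, where r again belongs to the
  family.\<close>

definition remainder_closed :: "'a::idom set \<Rightarrow> 'a poly set \<Rightarrow> bool" where
  "remainder_closed C F \<longleftrightarrow> finite F \<and> F \<subseteq> polys_over C \<and> (\<forall>f\<in>F. pderiv f \<in> F) \<and>
     (\<forall>f\<in>F. \<forall>g\<in>F. g \<noteq> 0 \<longrightarrow> degree g \<le> degree f \<longrightarrow> (\<exists>r\<in>F. is_pseudo_remainder C f g r))"

text \<open>The degrees are treated from the top down. At level e0, derivatives of members of degree
  e0 and remainders by divisors of degree e0 are added. What is new has degree less than e0, so the
  levels from e0 upwards stay closed, and after N levels all are.\<close>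

lemma exists_remainder_closed:
  fixes C :: "'a::idom set"
  assumes C: "unital_subring C" and F: "finite F" "F \<subseteq> polys_over C"
  obtains G where "F \<subseteq> G" "remainder_closed C G"
proof -
  interpret unital_subring C by fact
  \<comment> \<open>One remainder is fixed for each pair, so that only finitely many polynomials are
    added at each level.\<close>
  define rm where "rm f g = (SOME r. r \<in> polys_over C \<and> is_pseudo_remainder C f g r)" for f g
  have rm: "rm f g \<in> polys_over C" "is_pseudo_remainder C f g (rm f g)"
    if "f \<in> polys_over C" "g \<in> polys_over C" for f g
    using someI_ex[of "\<lambda>r. r \<in> polys_over C \<and> is_pseudo_remainder C f g r"]
      pseudo_division[OF that(2,1)]
    unfolding rm_def is_pseudo_remainder_def by blast+
  have rm_degree: "rm f g = 0 \<or> degree (rm f g) < degree g"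
    if "f \<in> polys_over C" "g \<in> polys_over C" for f g
    using rm(2)[OF that] unfolding is_pseudo_remainder_def by blast
  define closed_at where "closed_at e G \<longleftrightarrow> (\<forall>f\<in>G. degree f = e \<longrightarrow> pderiv f \<in> G) \<and>
    (\<forall>f\<in>G. \<forall>g\<in>G. g \<noteq> 0 \<longrightarrow> degree g = e \<longrightarrow> e \<le> degree f \<longrightarrow> rm f g \<in> G)" for e and G :: "'a poly set"
  \<comment> \<open>Inserting 0 keeps \<open>Max\<close> away from the empty set and puts into the
    family the polynomial to which derivatives of constants and vanishing remainders belong.\<close>
  define N where "N = Suc (Max (degree ` insert 0 F))"
  have "\<exists>G. insert 0 F \<subseteq> G \<and> finite G \<and> G \<subseteq> polys_over C \<and> (\<forall>f\<in>G. degree f < N) \<and>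
      (\<forall>e. N - j \<le> e \<longrightarrow> closed_at e G)" for j
  proof (induction j)
    case 0
    have "\<forall>f\<in>insert 0 F. degree f < N"
      using F(1) unfolding N_def less_Suc_eq_le by (intro ballI Max_ge) auto
    moreover from this have "\<forall>e\<ge>N. closed_at e (insert 0 F)"
      unfolding closed_at_def by (intro allI impI conjI ballI) (metis leD)+
    ultimately show ?case
      using F poly_closed(1) by (intro exI[of _ "insert 0 F"]) auto
  next
    case (Suc j)
    then obtain G where G: "insert 0 F \<subseteq> G" "finite G" "G \<subseteq> polys_over C"
      "\<forall>f\<in>G. degree f < N" "\<And>e. N - j \<le> e \<Longrightarrow> closed_at e G"
      by blast
    show ?case
    proof (cases "j < N")
      case False
      then have "N - Suc j = N - j" by simp
      then show ?thesis using G by auto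
    next
      case True
      define e0 where "e0 = N - Suc j"
      define P where "P = {p \<in> G \<times> G. snd p \<noteq> 0 \<and> degree (snd p) = e0 \<and> e0 \<le> degree (fst p)}"
      define H where "H = pderiv ` {f\<in>G. degree f = e0} \<union> (\<lambda>p. rm (fst p) (snd p)) ` P"
      have low: "h \<in> G \<or> degree h < e0" if "h \<in> H" for h
      proof -
        have "0 \<in> G" using G(1) by auto
        from that consider f where "f \<in> G" "degree f = e0" "h = pderiv f"
          | f g where "f \<in> G" "g \<in> G" "degree g = e0" "h = rm f g"
          unfolding H_def P_def by auto
        then show ?thesis
        proof cases
          case 1
          then have "e0 = 0 \<Longrightarrow> h = 0"
            by (metis degree_eq_zeroE pderiv_singleton)
          then show ?thesis
            using 1 degree_pderiv_le[of f] \<open>0 \<in> G\<close> by (cases "e0 = 0") auto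
        next
          case 2
          then have "f \<in> polys_over C" "g \<in> polys_over C"
            using G(3) by blast+
          then show ?thesis
            using rm_degree[of f g] 2 \<open>0 \<in> G\<close> by auto
        qed
      qed
      have "H \<subseteq> polys_over C"
        using G(3) pderiv_mem[OF C] rm(1) unfolding H_def P_def by (auto simp: subset_iff)
      moreover have "finite H"
        using G(2) unfolding H_def P_def by auto
      moreover have "\<forall>f\<in>G \<union> H. degree f < N"
        using G(4) low True unfolding e0_def by fastforce
      moreover have "closed_at e (G \<union> H)" if e: "e0 \<le> e" for e
      proof -
        have old: "f \<in> G" if "f \<in> G \<union> H" "e \<le> degree f" for f
          using low[of f] that e by auto
        show ?thesis
        proof (cases "e = e0")
          case True
          have "pderiv f \<in> H" if "f \<in> G" "degree f = e" for f
            using that True by (auto simp: H_def)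
          moreover have "rm f g \<in> H" if "f \<in> G" "g \<in> G" "g \<noteq> 0" "degree g = e" "e \<le> degree f" for f g
            using that True unfolding H_def P_def by (intro UnI2 image_eqI[of _ _ "(f, g)"]) auto
          ultimately show ?thesis
            using old unfolding closed_at_def by (intro conjI ballI impI UnI2) (metis order_refl)+
        next
          case False
          then have "closed_at e G"
            using G(5)[of e] e \<open>j < N\<close> unfolding e0_def by simp
          then show ?thesis
            using old unfolding closed_at_def by blast
        qed
      qed
      ultimately show ?thesis
        using G(1-3) unfolding e0_def by (intro exI[of _ "G \<union> H"]) auto
    qed
  qed
  from this[of N] obtain G where G: "insert 0 F \<subseteq> G" "finite G" "G \<subseteq> polys_over C" "\<And>e. closed_at e G"
    by auto
  have "pderiv f \<in> G" if "f \<in> G" for f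
    using G(4)[of "degree f"] that unfolding closed_at_def by blast
  moreover have "\<exists>r\<in>G. is_pseudo_remainder C f g r"
    if "f \<in> G" "g \<in> G" "g \<noteq> 0" "degree g \<le> degree f" for f g
    using G(4)[of "degree g"] that rm(2)[of f g] G(3) unfolding closed_at_def by blast
  ultimately have "remainder_closed C G"
    using G(2,3) unfolding remainder_closed_def by blast
  then show thesis
    using that[of G] G(1) by auto
qed

lemma sign_tableD:
  "sign_table R S T f g \<Longrightarrow> x \<in> R \<Longrightarrow> y \<in> S \<Longrightarrow> same_position R S T x y \<Longrightarrow>
    sgn_on R (poly f x) = sgn_on S (poly g y)"
  unfolding sign_table_def by auto

context real_closed_pair
begin

text \<open>Induction over subfamilies G that contain, with a member, everything in F of smaller
  degree. A member f of maximal degree is removed; the table for the others lists the critical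
  points of f, since its derivative is among them, and \<open>polynomial_step\<close> then adds the
  roots of f. That \<phi> respects the signs of leading coefficients means in particular that it
  preserves degrees.\<close>

lemma exists_sign_table:
  assumes C: "C \<subseteq> R" and \<phi>: "subring_hom C \<phi>" "\<phi> ` C \<subseteq> S" and F: "remainder_closed C F"
    and lead: "\<And>f. f \<in> F \<Longrightarrow> S.sg (\<phi> (lead_coeff f)) = R.sg (lead_coeff f)"
  obtains T where "order_matching R S T" "\<And>f. f \<in> F \<Longrightarrow> sign_table R S T f (map_poly \<phi> f)"
proof -
  interpret subring_hom C \<phi> by fact
  have FR: "f \<in> polys_over C" "f \<in> polys_over R" "map_poly \<phi> f \<in> polys_over S" if "f \<in> F" for f
  proof -
    show *: "f \<in> polys_over C"
      using that F unfolding remainder_closed_def by blast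
    then show "f \<in> polys_over R"
      using polys_over_mono[OF C] by blast
    show "map_poly \<phi> f \<in> polys_over S"
      using map_poly_mem_image[OF *] polys_over_mono[OF \<phi>(2)] by blast
  qed
  have deg: "degree (map_poly \<phi> f) = degree f" "lead_coeff (map_poly \<phi> f) = \<phi> (lead_coeff f)"
    "f \<noteq> 0 \<Longrightarrow> \<phi> (lead_coeff f) \<noteq> 0" if "f \<in> F" for f
  proof -
    show "degree (map_poly \<phi> f) = degree f"
    proof (cases "f = 0")
      case False
      then have "R.sg (lead_coeff f) \<noteq> 0" by simp
      then show ?thesis
        using lead[OF that] by (intro map_degree) (metis sgn_on_0)
    qed simp
    then show "lead_coeff (map_poly \<phi> f) = \<phi> (lead_coeff f)"
      by (simp add: coeff_map)
    show "\<phi> (lead_coeff f) \<noteq> 0" if "f \<noteq> 0"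
      using lead[OF \<open>f \<in> F\<close>] that by (metis leading_coeff_0_iff sgn_on_eq_0_iff)
  qed
  have "\<exists>T. order_matching R S T \<and> (\<forall>f\<in>G. sign_table R S T f (map_poly \<phi> f)) \<and>
      (\<forall>a a'. (a, a') \<in> T \<longrightarrow> (\<exists>g\<in>G. g \<noteq> 0 \<and> poly g a = 0))"
    if "G \<subseteq> F" "\<And>f g. f \<in> G \<Longrightarrow> g \<in> F \<Longrightarrow> degree g < degree f \<Longrightarrow> g \<in> G" for G
    using that
  proof (induction "card G" arbitrary: G)
    case 0
    have "finite G"
      using "0.prems"(1) F finite_subset unfolding remainder_closed_def by blast
    then have "G = {}" using 0 by simp
    then show ?case
      by (intro exI[of _ "{}"]) (auto simp: order_matching_def)
  next
    case (Suc m)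
    have "finite G" "G \<noteq> {}"
      using Suc.prems(1) F finite_subset Suc.hyps(2) unfolding remainder_closed_def by force+
    then have "Max (degree ` G) \<in> degree ` G"
      by (intro Max_in) auto
    then obtain f where f: "f \<in> G" "degree f = Max (degree ` G)"
      by auto
    have f_max: "degree g \<le> degree f" if "g \<in> G" for g
      unfolding f(2) using \<open>finite G\<close> that by (intro Max_ge) auto
    define G' where "G' = G - {f}"
    have "m = card G'"
      using Suc.hyps(2) f(1) \<open>finite G\<close> by (simp add: G'_def)
    moreover have "G' \<subseteq> F"
      using Suc.prems(1) by (auto simp: G'_def)
    moreover have "h \<in> G'" if "g \<in> G'" "h \<in> F" "degree h < degree g" for g h
      using that Suc.prems(2)[of g h] f_max[of g] by (auto simp: G'_def)
    ultimately obtain T where T: "order_matching R S T" "\<And>g. g \<in> G' \<Longrightarrow> sign_table R S T g (map_poly \<phi> g)"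
      "\<And>a a'. (a, a') \<in> T \<Longrightarrow> \<exists>g\<in>G'. g \<noteq> 0 \<and> poly g a = 0"
      using Suc.hyps(1)[of G'] by blast
    have fF: "f \<in> F" using f(1) Suc.prems(1) by blast
    have G: "g \<in> G'" if "g \<in> F" "degree g < degree f" for g
      using Suc.prems(2)[OF f(1) that] that by (auto simp: G'_def)
    show ?case
    proof (cases "degree f = 0")
      case True
      then obtain c where c: "f = [:c:]" by (auto elim: degree_eq_zeroE)
      have "sign_table R S T f (map_poly \<phi> f)"
        using lead[OF fF] deg(3)[OF fF] hom_zero unfolding c by (auto simp: sign_table_def map_const)
      moreover have "\<exists>g\<in>G. g \<noteq> 0 \<and> poly g a = 0" if "(a, a') \<in> T" for a a'
        using T(3)[OF that] by (auto simp: G'_def)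
      ultimately show ?thesis
        using T(1,2) unfolding G'_def by blast
    next
      case False
      then have "f \<noteq> 0" by auto
      have df: "pderiv f \<in> F" "degree (pderiv f) < degree f"
        using F fF False degree_pderiv_le[of f] unfolding remainder_closed_def by auto
      have "coeff (pderiv f) (degree f - 1) = of_nat (degree f) * lead_coeff f"
        using False by (simp add: coeff_pderiv)
      then have "pderiv f \<noteq> 0"
        using R.of_nat_neq_0[of "degree f"] False \<open>f \<noteq> 0\<close>
        by (metis coeff_0 gr0I leading_coeff_0_iff mult_eq_0_iff)
      then have tab: "\<forall>x\<in>R. poly (pderiv f) x = 0 \<longrightarrow> x \<in> Domain T"
        "\<forall>y\<in>S. poly (pderiv (map_poly \<phi> f)) y = 0 \<longrightarrow> y \<in> Range T"
        using T(2)[OF G[OF df]] map_pderiv[OF \<phi>(1) FR(1)[OF fF]] unfolding sign_table_def by auto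
      note matching = T and fG = f(1)
      interpret polynomial_step R S T f "map_poly \<phi> f"
      proof (unfold_locales)
        fix a a' assume a: "(a, a') \<in> T"
        note aRS = order_matching_mem[OF T(1) a]
        note pos = order_matching_same_position[OF T(1) a]
        obtain g where g: "g \<in> G'" "g \<noteq> 0" "poly g a = 0"
          using T(3)[OF a] by blast
        then have gF: "g \<in> F" and "degree g \<le> degree f"
          using Suc.prems(1) f_max by (auto simp: G'_def)
        then obtain r where r: "r \<in> F" "is_pseudo_remainder C f g r"
          using F fF g(2) unfolding remainder_closed_def by blast
        then obtain k q where kq: "q \<in> polys_over C" "smult (lead_coeff g ^ k) f = q * g + r"
          "r = 0 \<or> degree r < degree g"
          unfolding is_pseudo_remainder_def by blast
        \<comment> \<open>A zero remainder has degree 0, which is less than the positive degree of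
          f, so it belongs to G' too.\<close>
        have "r \<in> G'"
          using kq(3) \<open>degree g \<le> degree f\<close> False by (intro G[OF r(1)]) auto
        then have sr: "R.sg (poly r a) = S.sg (poly (map_poly \<phi> r) a')"
          using sign_tableD[OF T(2) _ _ pos] aRS by blast
        have "S.sg (poly (map_poly \<phi> g) a') = 0"
          using sign_tableD[OF T(2)[OF g(1)] _ _ pos] aRS g(3) by simp
        then have g': "poly (map_poly \<phi> g) a' = 0" by simp
        have c: "lead_coeff g \<in> C"
          using coeff_mem FR(1)[OF gF] by blast
        have "lead_coeff g ^ k * poly f a = poly r a"
          using arg_cong[OF kq(2), of "\<lambda>p. poly p a"] g(3) by simp
        then have 1: "R.sg (lead_coeff g) ^ k * R.sg (poly f a) = R.sg (poly r a)"
          using c C aRS FR(2)[OF fF] R.sg_mult[of "lead_coeff g ^ k" "poly f a"]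
          by (simp add: R.sg_power R.power_mem R.poly_mem subsetD)
        have "smult (\<phi> (lead_coeff g) ^ k) (map_poly \<phi> f) = map_poly \<phi> q * map_poly \<phi> g + map_poly \<phi> r"
          using arg_cong[OF kq(2), of "map_poly \<phi>"] c kq(1) FR(1)[OF fF] FR(1)[OF gF] FR(1)[OF r(1)]
          by (simp add: map_smult map_add map_mult hom_power power_mem poly_closed)
        then have "\<phi> (lead_coeff g) ^ k * poly (map_poly \<phi> f) a' = poly (map_poly \<phi> r) a'"
          using g' by (metis poly_add poly_mult poly_smult mult_zero_right add_0)
        then have 2: "S.sg (\<phi> (lead_coeff g)) ^ k * S.sg (poly (map_poly \<phi> f) a') = S.sg (poly (map_poly \<phi> r) a')"
          using c \<phi>(2) aRS FR(3)[OF fF] S.sg_mult[of "\<phi> (lead_coeff g) ^ k" "poly (map_poly \<phi> f) a'"]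
          by (simp add: S.sg_power S.power_mem S.poly_mem image_subset_iff)
        show "R.sg (poly f a) = S.sg (poly (map_poly \<phi> f) a')"
        proof -
          \<comment> \<open>The same nonzero factor occurs on both lines, because \<phi> respects
            the sign of this leading coefficient. It cancels whatever the parity of k.\<close>
          have "R.sg (lead_coeff g) ^ k \<noteq> 0"
            using g(2) by simp
          moreover have "R.sg (lead_coeff g) ^ k * R.sg (poly f a)
              = R.sg (lead_coeff g) ^ k * S.sg (poly (map_poly \<phi> f) a')"
            using 1 2 sr lead[OF gF] by simp
          ultimately show ?thesis by (metis mult_cancel_left)
        qed
      qed (use T(1) FR[OF fF] deg[OF fF] False lead[OF fF] tab in auto)
      have "\<exists>g\<in>G. g \<noteq> 0 \<and> poly g a = 0" if "(a, a') \<in> T \<union> roots_matching" for a a'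
      proof (cases "(a, a') \<in> T")
        case True
        then show ?thesis
          using matching(3) unfolding G'_def by blast
      next
        case False
        then show ?thesis
          using that fG \<open>f \<noteq> 0\<close> by (auto simp: roots_matching_def intro!: bexI[of _ f])
      qed
      moreover have "sign_table R S (T \<union> roots_matching) g (map_poly \<phi> g)" if "g \<in> G" for g
        using that matching(2)[of g] sign_table_roots sign_table_mono[of R S T g "map_poly \<phi> g" "T \<union> roots_matching"]
        by (cases "g = f") (auto simp: G'_def)
      ultimately show ?thesis
        using order_matching_roots by blast
    qed
  qed
  from this[of F] show thesis
    using that by blast
qed

text \<open>D consists of the leading coefficients of a remainder-closed family around F. A
  homomorphism that respects their signs yields a sign table, and w is any point in the cell that
  corresponds to the cell of z. The table varies with \<phi>, but D is chosen before \<phi>; this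
  order of quantifiers makes the induction over the coordinates possible.\<close>

theorem sign_transfer:
  assumes C: "unital_subring C" "C \<subseteq> R" and z: "z \<in> R" and F: "finite F" "F \<subseteq> polys_over C"
  obtains D where "finite D" "D \<subseteq> C"
    "\<forall>\<phi>. subring_hom C \<phi> \<longrightarrow> \<phi> ` C \<subseteq> S \<longrightarrow> (\<forall>d\<in>D. S.sg (\<phi> d) = R.sg d) \<longrightarrow>
      (\<exists>w\<in>S. \<forall>f\<in>F. S.sg (poly (map_poly \<phi> f) w) = R.sg (poly f z))"
proof -
  obtain G where G: "F \<subseteq> G" "remainder_closed C G"
    using exists_remainder_closed[OF C(1) F] .
  show thesis
  proof (rule that[of "lead_coeff ` G"])
    show "finite (lead_coeff ` G)" "lead_coeff ` G \<subseteq> C"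
      using G(2) unfolding remainder_closed_def by (auto intro: coeff_mem)
    have "\<exists>w\<in>S. \<forall>f\<in>F. S.sg (poly (map_poly \<phi> f) w) = R.sg (poly f z)"
      if \<phi>: "subring_hom C \<phi>" "\<phi> ` C \<subseteq> S" "\<forall>d\<in>lead_coeff ` G. S.sg (\<phi> d) = R.sg d" for \<phi>
    proof -
      obtain T where T: "order_matching R S T" "\<And>f. f \<in> G \<Longrightarrow> sign_table R S T f (map_poly \<phi> f)"
        by (rule exists_sign_table[OF C(2) \<phi>(1,2) G(2)]) (use \<phi>(3) in auto)
      obtain w where "w \<in> S" "same_position R S T z w"
        using exists_same_position[OF T(1) z] by blast
      then show ?thesis
        using sign_tableD[OF T(2) z] G(1) by (metis subsetD)
    qed
    then show "\<forall>\<phi>. subring_hom C \<phi> \<longrightarrow> \<phi> ` C \<subseteq> S \<longrightarrow> (\<forall>d\<in>lead_coeff ` G. S.sg (\<phi> d) = R.sg d) \<longrightarrow>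
        (\<exists>w\<in>S. \<forall>f\<in>F. S.sg (poly (map_poly \<phi> f) w) = R.sg (poly f z))"
      by blast
  qed
qed

end

section \<open>Extending homomorphisms that respect signs\<close>

text \<open>
  M is empty if z is transcendental over C, and otherwise consists of one polynomial of
  minimal degree.
\<close>

lemma (in unital_subring) algebraic_relations:
  fixes z :: 'a
  obtains M where "finite M" "M \<subseteq> polys_over C" "\<And>m. m \<in> M \<Longrightarrow> m \<noteq> 0 \<and> poly m z = 0"
    "\<And>f. f \<in> polys_over C \<Longrightarrow> poly f z = 0 \<Longrightarrow>
      f = 0 \<or> (\<exists>m\<in>M. \<exists>k. \<exists>q\<in>polys_over C. smult (lead_coeff m ^ k) f = q * m)"
proof (cases "\<exists>m\<in>polys_over C. m \<noteq> 0 \<and> poly m z = 0")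
  case True
  then obtain m where m: "m \<in> polys_over C" "m \<noteq> 0" "poly m z = 0"
    "\<And>f. f \<in> polys_over C \<Longrightarrow> f \<noteq> 0 \<Longrightarrow> poly f z = 0 \<Longrightarrow> degree m \<le> degree f"
    using ex_has_least_nat[of "\<lambda>f. f \<in> polys_over C \<and> f \<noteq> 0 \<and> poly f z = 0" _ degree] by blast
  have "\<exists>k. \<exists>q\<in>polys_over C. smult (lead_coeff m ^ k) f = q * m" if f: "f \<in> polys_over C" "poly f z = 0" for f
  proof -
    obtain k q r where *: "q \<in> polys_over C" "r \<in> polys_over C"
      "smult (lead_coeff m ^ k) f = q * m + r" "r = 0 \<or> degree r < degree m"
      using pseudo_division[OF m(1) f(1)] by blast
    have "poly r z = 0"
      using arg_cong[OF *(3), of "\<lambda>p. poly p z"] f(2) m(3) by simp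
    then have "r = 0"
      using *(4) m(4)[OF *(2)] by fastforce
    then show ?thesis
      using * by auto
  qed
  then show thesis
    using that[of "{m}"] m by blast
next
  case False
  then show thesis
    using that[of "{}"] by blast
qed

context real_closed_pair
begin

text \<open>The induction step of the Artin-Lang theorem. Signs prescribed on C[z] become sign
  conditions on polynomials at z and then, by transfer, finitely many signs on C. The defining
  relation m of z is among these polynomials, so its image vanishes at w. The set B with the values
  \<phi>0 carries the prescribed map on the base field through the induction.\<close>

lemma specialize_adjoin:
  assumes C: "unital_subring C" "C \<subseteq> R" and z: "z \<in> R" and D: "finite D" "D \<subseteq> adjoin C z"
    and IH: "\<And>D. finite D \<Longrightarrow> D \<subseteq> C \<Longrightarrow>
      \<exists>\<phi>. subring_hom C \<phi> \<and> \<phi> ` C \<subseteq> S \<and> (\<forall>b\<in>B. \<phi> b = \<phi>0 b) \<and> (\<forall>d\<in>D. S.sg (\<phi> d) = R.sg d)"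
    and B: "B \<subseteq> C"
  shows "\<exists>\<phi>. subring_hom (adjoin C z) \<phi> \<and> \<phi> ` adjoin C z \<subseteq> S \<and> (\<forall>b\<in>B. \<phi> b = \<phi>0 b) \<and>
    (\<forall>d\<in>D. S.sg (\<phi> d) = R.sg d)"
proof -
  interpret C: unital_subring C by fact
  define p where "p d = (SOME f. f \<in> polys_over C \<and> d = poly f z)" for d
  have "\<exists>f. f \<in> polys_over C \<and> d = poly f z" if "d \<in> D" for d
    using that D(2) by (auto simp: adjoin_def)
  from someI_ex[OF this] have p: "\<And>d. d \<in> D \<Longrightarrow> p d \<in> polys_over C" "\<And>d. d \<in> D \<Longrightarrow> d = poly (p d) z"
    unfolding p_def by blast+
  obtain M where M: "finite M" "M \<subseteq> polys_over C" "\<And>m. m \<in> M \<Longrightarrow> m \<noteq> 0 \<and> poly m z = 0"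
    "\<And>f. f \<in> polys_over C \<Longrightarrow> poly f z = 0 \<Longrightarrow>
      f = 0 \<or> (\<exists>m\<in>M. \<exists>k. \<exists>q\<in>polys_over C. smult (lead_coeff m ^ k) f = q * m)"
    by (rule C.algebraic_relations[of z]) blast
  have F: "finite (M \<union> p ` D)" "M \<union> p ` D \<subseteq> polys_over C"
    using M D p by auto
  obtain D0 where D0: "finite D0" "D0 \<subseteq> C"
    "\<forall>\<phi>. subring_hom C \<phi> \<longrightarrow> \<phi> ` C \<subseteq> S \<longrightarrow> (\<forall>d\<in>D0. S.sg (\<phi> d) = R.sg d) \<longrightarrow>
      (\<exists>w\<in>S. \<forall>f\<in>M \<union> p ` D. S.sg (poly (map_poly \<phi> f) w) = R.sg (poly f z))"
    by (rule sign_transfer[OF C z F])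
  \<comment> \<open>The leading coefficient of the relation must stay nonzero under \<phi>: a
    relation f of z only satisfies \<open>smult (lead_coeff m ^ k) f = q * m\<close>, and the power
    has to be cancelled after applying \<phi>.\<close>
  have "lead_coeff ` M \<subseteq> C"
    using M(2) coeff_mem by blast
  then have "finite (D0 \<union> lead_coeff ` M)" "D0 \<union> lead_coeff ` M \<subseteq> C"
    using D0(1,2) M(1) by simp_all
  from IH[OF this] obtain \<phi> where \<phi>: "subring_hom C \<phi>" "\<phi> ` C \<subseteq> S" "\<forall>b\<in>B. \<phi> b = \<phi>0 b"
    "\<And>d. d \<in> D0 \<union> lead_coeff ` M \<Longrightarrow> S.sg (\<phi> d) = R.sg d"
    by blast
  interpret subring_hom C \<phi> by fact
  obtain w where w: "w \<in> S" "\<And>f. f \<in> M \<union> p ` D \<Longrightarrow> S.sg (poly (map_poly \<phi> f) w) = R.sg (poly f z)"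
  proof -
    have "\<forall>d\<in>D0. S.sg (\<phi> d) = R.sg d"
      using \<phi>(4) by blast
    then show thesis
      using D0(3)[rule_format, OF \<phi>(1,2)] that by blast
  qed
  have kernel: "poly (map_poly \<phi> f) w = 0" if f: "f \<in> polys_over C" "poly f z = 0" for f
  proof -
    consider "f = 0" | m k q where "m \<in> M" "q \<in> polys_over C" "smult (lead_coeff m ^ k) f = q * m"
      using M(4)[OF f] by blast
    then show ?thesis
    proof cases
      case (2 m k q)
      have m: "m \<in> polys_over C" "lead_coeff m \<in> C"
        using 2 M(2) coeff_mem by blast+
      have "S.sg (\<phi> (lead_coeff m)) \<noteq> 0"
        using \<phi>(4)[of "lead_coeff m"] M(3)[OF 2(1)] 2(1) by simp
      then have lc: "\<phi> (lead_coeff m) \<noteq> 0"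
        by (metis sgn_on_0)
      have "S.sg (poly (map_poly \<phi> m) w) = 0"
        using w(2)[of m] M(3)[OF 2(1)] 2(1) by simp
      then have "poly (map_poly \<phi> m) w = 0" by simp
      moreover have "smult (\<phi> (lead_coeff m) ^ k) (map_poly \<phi> f) = map_poly \<phi> q * map_poly \<phi> m"
        using arg_cong[OF 2(3), of "map_poly \<phi>"] m f(1) 2(2)
        by (simp add: map_smult map_mult hom_power C.power_mem)
      ultimately have "\<phi> (lead_coeff m) ^ k * poly (map_poly \<phi> f) w = 0"
        by (metis poly_mult poly_smult mult_zero_right)
      then show ?thesis using lc by simp
    qed auto
  qed
  obtain \<psi> where \<psi>: "subring_hom (adjoin C z) \<psi>"
    "\<And>f. f \<in> polys_over C \<Longrightarrow> \<psi> (poly f z) = poly (map_poly \<phi> f) w"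
    "\<And>c. c \<in> C \<Longrightarrow> \<psi> c = \<phi> c"
    using extend_hom[of z w] kernel by blast
  have "map_poly \<phi> f \<in> polys_over S" if "f \<in> polys_over C" for f
    using map_poly_mem_image[OF that] polys_over_mono[OF \<phi>(2)] by blast
  then have "\<psi> ` adjoin C z \<subseteq> S"
    using \<psi>(2) w(1) S.poly_mem by (auto simp: adjoin_def)
  moreover have "S.sg (\<psi> d) = R.sg d" if "d \<in> D" for d
    using w(2)[of "p d"] \<psi>(2)[OF p(1)[OF that]] p(2)[OF that] that by simp
  moreover have "\<forall>b\<in>B. \<psi> b = \<phi>0 b"
    using \<phi>(3) \<psi>(3) B by auto
  ultimately show ?thesis
    using \<psi>(1) by blast
qed

end

section \<open>Multivariate polynomials\<close>

text \<open>Arbitrary sets of variables, not only initial segments, are allowed because the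
  variables that are independent modulo a prime ideal can be any subset.\<close>

definition mpolys :: "nat set \<Rightarrow> ((nat \<Rightarrow>\<^sub>0 nat) \<Rightarrow>\<^sub>0 'k::comm_ring_1) set" where
  "mpolys V = {p. \<forall>m\<in>Poly_Mapping.keys p. Poly_Mapping.keys m \<subseteq> V}"

definition mconst :: "'k \<Rightarrow> (nat \<Rightarrow>\<^sub>0 nat) \<Rightarrow>\<^sub>0 'k::comm_ring_1" where
  "mconst c = Poly_Mapping.single 0 c"

definition mvar :: "nat \<Rightarrow> (nat \<Rightarrow>\<^sub>0 nat) \<Rightarrow>\<^sub>0 'k::comm_ring_1" where
  "mvar i = Poly_Mapping.single (Poly_Mapping.single i 1) 1"

lemma mconst_simps [simp]: "mconst 0 = 0" "mconst 1 = 1"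
  "mconst (a + b) = mconst a + mconst b" "mconst (a * b) = mconst a * mconst b"
  by (simp_all add: mconst_def single_add mult_single)

lemma mconst_eq_0_iff [simp]: "mconst c = 0 \<longleftrightarrow> c = 0"
  by (metis lookup_single_eq lookup_zero mconst_def single_zero)

lemma unital_subring_mpolys: "unital_subring (mpolys V :: ((nat \<Rightarrow>\<^sub>0 nat) \<Rightarrow>\<^sub>0 'k::comm_ring_1) set)"
proof
  fix p q :: "(nat \<Rightarrow>\<^sub>0 nat) \<Rightarrow>\<^sub>0 'k" assume pq: "p \<in> mpolys V" "q \<in> mpolys V"
  have "Poly_Mapping.keys (p - q) \<subseteq> Poly_Mapping.keys p \<union> Poly_Mapping.keys q"
    by (auto simp: in_keys_iff lookup_minus)
  then show "p - q \<in> mpolys V"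
    using pq by (auto simp: mpolys_def)
  show "p * q \<in> mpolys V"
    unfolding mpolys_def
  proof (intro CollectI ballI)
    fix m assume "m \<in> Poly_Mapping.keys (p * q)"
    then obtain a b where "m = a + b" "a \<in> Poly_Mapping.keys p" "b \<in> Poly_Mapping.keys q"
      using keys_mult[of p q] by blast
    then show "Poly_Mapping.keys m \<subseteq> V"
      using pq Poly_Mapping.keys_add[of a b] unfolding mpolys_def by blast
  qed
qed (simp add: mpolys_def)

lemma mconst_mem: "mconst c \<in> mpolys V"
  by (auto simp: mpolys_def mconst_def)

lemma mvar_mem: "i \<in> V \<Longrightarrow> mvar i \<in> mpolys V"
  by (auto simp: mpolys_def mvar_def)

lemma mpolys_mono: "U \<subseteq> V \<Longrightarrow> mpolys U \<subseteq> mpolys V"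
  by (auto simp: mpolys_def)

lemma mpolys_empty: "mpolys {} = (range mconst :: ((nat \<Rightarrow>\<^sub>0 nat) \<Rightarrow>\<^sub>0 'k::comm_ring_1) set)"
proof
  show "mpolys {} \<subseteq> (range mconst :: ((nat \<Rightarrow>\<^sub>0 nat) \<Rightarrow>\<^sub>0 'k) set)"
  proof
    fix p :: "(nat \<Rightarrow>\<^sub>0 nat) \<Rightarrow>\<^sub>0 'k" assume "p \<in> mpolys {}"
    then have keys: "Poly_Mapping.keys p \<subseteq> {0}"
      by (auto simp: mpolys_def)
    have "p = mconst (Poly_Mapping.lookup p 0)"
    proof (rule poly_mapping_eqI)
      show "Poly_Mapping.lookup p k = Poly_Mapping.lookup (mconst (Poly_Mapping.lookup p 0)) k" for k
        using keys by (cases "k = 0") (auto simp: mconst_def lookup_single in_keys_iff when_def)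
    qed
    then show "p \<in> range mconst" by blast
  qed
qed (auto intro: mconst_mem)

lemma sum_monomials: "p = (\<Sum>m\<in>Poly_Mapping.keys p. Poly_Mapping.single m (Poly_Mapping.lookup p m))"
proof (rule poly_mapping_eqI)
  fix k
  have "(\<Sum>m\<in>Poly_Mapping.keys p. Poly_Mapping.lookup p m when m = k)
      = (\<Sum>m\<in>Poly_Mapping.keys p. if m = k then Poly_Mapping.lookup p k else 0)"
    by (intro sum.cong) (auto simp: when_def)
  then show "Poly_Mapping.lookup p k =
      Poly_Mapping.lookup (\<Sum>m\<in>Poly_Mapping.keys p. Poly_Mapping.single m (Poly_Mapping.lookup p m)) k"
    by (simp add: lookup_sum lookup_single sum.delta in_keys_iff)
qed

lemma mvar_power: "mvar i ^ e = Poly_Mapping.single (Poly_Mapping.single i e) 1"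
proof (induction e)
  case (Suc e)
  then show ?case
    by (simp add: mvar_def mult_single single_add[symmetric])
qed simp

lemma single_split_variable:
  "Poly_Mapping.single m c = Poly_Mapping.single (m - Poly_Mapping.single i (Poly_Mapping.lookup m i)) c *
     mvar i ^ Poly_Mapping.lookup m i"
proof -
  have "m = m - Poly_Mapping.single i (Poly_Mapping.lookup m i) + Poly_Mapping.single i (Poly_Mapping.lookup m i)"
    by (rule poly_mapping_eqI) (auto simp: lookup_add lookup_minus lookup_single when_def)
  then show ?thesis
    by (simp add: mvar_power mult_single)
qed

lemma keys_remove_variable:
  "Poly_Mapping.keys (m - Poly_Mapping.single i (Poly_Mapping.lookup m i)) = Poly_Mapping.keys m - {i}"
  for m :: "nat \<Rightarrow>\<^sub>0 nat"
  by (auto simp: in_keys_iff lookup_minus lookup_single when_def split: if_splits)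

text \<open>Each monomial is a monomial in the other variables times a power of the variable i, and
  polynomials are sums of monomials.\<close>

lemma mpolys_insert: "mpolys (insert i V) \<subseteq> adjoin (mpolys V) (mvar i)"
proof
  fix p :: "(nat \<Rightarrow>\<^sub>0 nat) \<Rightarrow>\<^sub>0 'k::comm_ring_1" assume p: "p \<in> mpolys (insert i V)"
  interpret C: unital_subring "mpolys V :: ((nat \<Rightarrow>\<^sub>0 nat) \<Rightarrow>\<^sub>0 'k) set"
    by (rule unital_subring_mpolys)
  interpret A: unital_subring "adjoin (mpolys V) (mvar i) :: ((nat \<Rightarrow>\<^sub>0 nat) \<Rightarrow>\<^sub>0 'k) set"
    by (rule C.unital_subring_adjoin)
  have "Poly_Mapping.single m c \<in> adjoin (mpolys V) (mvar i)"
    if "m \<in> Poly_Mapping.keys p" for m and c :: 'k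
  proof -
    have "Poly_Mapping.single (m - Poly_Mapping.single i (Poly_Mapping.lookup m i)) c \<in> mpolys V"
      using p that keys_remove_variable[of m i] unfolding mpolys_def by auto
    then show ?thesis
      unfolding single_split_variable[of m c i]
      using C.subset_adjoin C.mem_adjoin by (intro A.mult_mem A.power_mem) blast+
  qed
  then show "p \<in> adjoin (mpolys V) (mvar i)"
    by (subst sum_monomials) (rule A.sum_mem)
qed

section \<open>Evaluation at a point\<close>

lemma mpoly_eval_sum: 
  assumes "finite A" "Poly_Mapping.keys p \<subseteq> A"
  shows "mpoly_eval p x = (\<Sum>m\<in>A. Poly_Mapping.lookup p m *
        (\<Prod>i\<in>Poly_Mapping.keys m. x i ^ Poly_Mapping.lookup m i))"
  unfolding mpoly_eval_def using assms by (intro sum.mono_neutral_left) (auto simp: in_keys_iff)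

lemma mpoly_eval_add: "mpoly_eval (p + q) x = mpoly_eval p x + mpoly_eval q x"
proof -
  let ?A = "Poly_Mapping.keys p \<union> Poly_Mapping.keys q"
  have "finite ?A" "Poly_Mapping.keys p \<subseteq> ?A" "Poly_Mapping.keys q \<subseteq> ?A" "Poly_Mapping.keys (p + q) \<subseteq> ?A"
    using Poly_Mapping.keys_add[of p q] by auto
  then show ?thesis
    by (simp add: mpoly_eval_sum[of ?A] lookup_add ring_distribs sum.distrib)
qed

lemma mpoly_eval_single:
  "mpoly_eval (Poly_Mapping.single m c) x = c * (\<Prod>i\<in>Poly_Mapping.keys m. x i ^ Poly_Mapping.lookup m i)"
  by (subst mpoly_eval_sum[of "{m}"]) auto

lemma mpoly_eval_zero: "mpoly_eval 0 x = 0"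
  by (simp add: mpoly_eval_def)

lemma mpoly_eval_sum_polys: "mpoly_eval (sum f A) x = (\<Sum>a\<in>A. mpoly_eval (f a) x)"
  by (induction A rule: infinite_finite_induct) (auto simp: mpoly_eval_add mpoly_eval_zero)

lemma monomial_eval_add:
  fixes x :: "nat \<Rightarrow> 'k::comm_ring_1" and a b :: "nat \<Rightarrow>\<^sub>0 nat"
  shows "(\<Prod>i\<in>Poly_Mapping.keys (a + b). x i ^ Poly_Mapping.lookup (a + b) i) =
    (\<Prod>i\<in>Poly_Mapping.keys a. x i ^ Poly_Mapping.lookup a i) * (\<Prod>i\<in>Poly_Mapping.keys b. x i ^ Poly_Mapping.lookup b i)"
proof -
  let ?A = "Poly_Mapping.keys a \<union> Poly_Mapping.keys b"
  have *: "(\<Prod>i\<in>Poly_Mapping.keys m. x i ^ Poly_Mapping.lookup m i) = (\<Prod>i\<in>?A. x i ^ Poly_Mapping.lookup m i)"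
    if "Poly_Mapping.keys m \<subseteq> ?A" for m
    using that by (intro prod.mono_neutral_left) (auto simp: in_keys_iff)
  show ?thesis
    using *[of a] *[of b] *[of "a + b"] Poly_Mapping.keys_add[of a b]
    by (simp add: lookup_add power_add prod.distrib)
qed

lemma mpoly_eval_mult: "mpoly_eval (p * q) x = mpoly_eval p x * mpoly_eval q x"
proof -
  let ?s = "\<lambda>p m. Poly_Mapping.single m (Poly_Mapping.lookup p m)"
  have 1: "mpoly_eval (?s p a * ?s q b) x = mpoly_eval (?s p a) x * mpoly_eval (?s q b) x" for a b
    by (simp add: mult_single mpoly_eval_single monomial_eval_add mult_ac)
  have "mpoly_eval ((\<Sum>a\<in>Poly_Mapping.keys p. ?s p a) * (\<Sum>b\<in>Poly_Mapping.keys q. ?s q b)) x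
      = mpoly_eval (\<Sum>a\<in>Poly_Mapping.keys p. ?s p a) x * mpoly_eval (\<Sum>b\<in>Poly_Mapping.keys q. ?s q b) x"
    by (simp only: sum_product mpoly_eval_sum_polys 1)
  then show ?thesis
    by (simp only: sum_monomials[symmetric])
qed

lemma mpoly_eval_one: "mpoly_eval 1 x = 1"
  using mpoly_eval_single[of 0 1 x] by simp

text \<open>This turns a K-homomorphism to K into a point, whose coordinates are the images of the
  variables. Monomials are treated by induction on the number of variables that occur.\<close>

lemma hom_eq_mpoly_eval:
  fixes \<theta> :: "((nat \<Rightarrow>\<^sub>0 nat) \<Rightarrow>\<^sub>0 'k::comm_ring_1) \<Rightarrow> 'k"
  assumes \<theta>: "subring_hom (mpolys V) \<theta>" "\<And>c. \<theta> (mconst c) = c" and p: "p \<in> mpolys V"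
  shows "\<theta> p = mpoly_eval p (\<lambda>i. \<theta> (mvar i))"
proof -
  interpret subring_hom "mpolys V" \<theta> by fact
  have mono: "\<theta> (Poly_Mapping.single m c) = mpoly_eval (Poly_Mapping.single m c) (\<lambda>i. \<theta> (mvar i))"
    if "Poly_Mapping.keys m \<subseteq> V" for m c
    using that
  proof (induction "card (Poly_Mapping.keys m)" arbitrary: m)
    case 0
    then have "m = 0" by simp
    then show ?case
      using \<theta>(2)[of c] by (simp add: mpoly_eval_single mconst_def)
  next
    case (Suc n)
    then obtain i where i: "i \<in> Poly_Mapping.keys m"
      by (metis card.empty equals0I nat.distinct(1))
    define m' where "m' = m - Poly_Mapping.single i (Poly_Mapping.lookup m i)"
    have keys: "Poly_Mapping.keys m' = Poly_Mapping.keys m - {i}"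
      unfolding m'_def by (rule keys_remove_variable)
    then have IH: "\<theta> (Poly_Mapping.single m' c) = mpoly_eval (Poly_Mapping.single m' c) (\<lambda>i. \<theta> (mvar i))"
      using Suc i by (intro Suc.hyps(1)) auto
    have mem: "Poly_Mapping.single m' c \<in> mpolys V" "(mvar i :: (nat \<Rightarrow>\<^sub>0 nat) \<Rightarrow>\<^sub>0 'k) \<in> mpolys V"
      using keys Suc.prems i by (auto simp: mpolys_def mvar_def)
    have "mpoly_eval (mvar i ^ e) (\<lambda>i. \<theta> (mvar i)) = \<theta> (mvar i) ^ e" for e
      by (cases "e = 0") (auto simp: mvar_power mpoly_eval_single mpoly_eval_one)
    then show ?case
      unfolding single_split_variable[of m c i] m'_def[symmetric] mpoly_eval_mult
      using mem IH by (simp add: hom_mult hom_power power_mem)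
  qed
  have "Poly_Mapping.single m (Poly_Mapping.lookup p m) \<in> mpolys V" if "m \<in> Poly_Mapping.keys p" for m
    using that p by (auto simp: mpolys_def)
  then have "\<theta> p = (\<Sum>m\<in>Poly_Mapping.keys p. \<theta> (Poly_Mapping.single m (Poly_Mapping.lookup p m)))"
    by (subst sum_monomials) (rule hom_sum)
  also have "\<dots> = (\<Sum>m\<in>Poly_Mapping.keys p.
      mpoly_eval (Poly_Mapping.single m (Poly_Mapping.lookup p m)) (\<lambda>i. \<theta> (mvar i)))"
    using p by (intro sum.cong mono) (auto simp: mpolys_def)
  also have "\<dots> = mpoly_eval p (\<lambda>i. \<theta> (mvar i))"
    by (simp only: mpoly_eval_sum_polys[symmetric] sum_monomials[symmetric])
  finally show ?thesis .
qed

section \<open>Real prime ideals and generic points\<close>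

locale subring_ideal = unital_subring D for D :: "'a::comm_ring_1 set" +
  fixes I :: "'a set"
  assumes ideal_subset: "I \<subseteq> D"
    and ideal_zero: "0 \<in> I"
    and ideal_diff: "a \<in> I \<Longrightarrow> b \<in> I \<Longrightarrow> a - b \<in> I"
    and ideal_mult: "a \<in> I \<Longrightarrow> c \<in> D \<Longrightarrow> c * a \<in> I"
begin

lemma ideal_uminus: "a \<in> I \<Longrightarrow> - a \<in> I"
  using ideal_diff[OF ideal_zero] by simp

lemma ideal_add: "a \<in> I \<Longrightarrow> b \<in> I \<Longrightarrow> a + b \<in> I"
  using ideal_diff[OF _ ideal_uminus] by simp

lemma poly_mem_ideal: "f \<in> polys_over I \<Longrightarrow> z \<in> D \<Longrightarrow> poly f z \<in> I"
  by (induction f) (auto simp: pCons_mem_iff intro: ideal_zero ideal_add ideal_mult)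

lemma subring_ideal_adjoin:
  assumes b: "b \<in> D"
  shows "subring_ideal D {u + c * b | u c. u \<in> I \<and> c \<in> D}"
proof (intro subring_ideal.intro unital_subring_axioms subring_ideal_axioms.intro)
  show "{u + c * b | u c. u \<in> I \<and> c \<in> D} \<subseteq> D"
    using ideal_subset b by (auto intro!: add_mem mult_mem)
  show "0 \<in> {u + c * b | u c. u \<in> I \<and> c \<in> D}"
    using ideal_zero zero_mem by (intro CollectI exI[of _ 0]) auto
  fix x assume "x \<in> {u + c * b | u c. u \<in> I \<and> c \<in> D}"
  then obtain u c where x: "x = u + c * b" "u \<in> I" "c \<in> D" by blast
  show "d * x \<in> {u + c * b | u c. u \<in> I \<and> c \<in> D}" if "d \<in> D" for d
  proof -
    have "d * x = d * u + (d * c) * b"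
      by (simp add: x(1) algebra_simps)
    then show ?thesis
      using x(2,3) that ideal_mult mult_mem by blast
  qed
  fix y assume "y \<in> {u + c * b | u c. u \<in> I \<and> c \<in> D}"
  then obtain v e where y: "y = v + e * b" "v \<in> I" "e \<in> D" by blast
  show "x - y \<in> {u + c * b | u c. u \<in> I \<and> c \<in> D}"
  proof -
    have "x - y = (u - v) + (c - e) * b"
      by (simp add: x(1) y(1) algebra_simps)
    then show ?thesis
      using x(2,3) y(2,3) ideal_diff diff_mem by blast
  qed
qed

end

locale subring_prime_ideal = subring_ideal D P for D :: "'a::comm_ring_1 set" and P +
  assumes one_notin: "1 \<notin> P"
    and prime: "a \<in> D \<Longrightarrow> b \<in> D \<Longrightarrow> a * b \<in> P \<Longrightarrow> a \<in> P \<or> b \<in> P"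

text \<open>P is maximal among the ideals that contain I but no 1 + s. An element outside P
  therefore has a multiple congruent to some 1 + s modulo P. For a product in P of two such
  elements, the product of the two congruences puts (1 + s)(1 + t), again of the form 1 plus a sum
  of squares, into P.\<close>

lemma (in subring_ideal) exists_real_prime:
  assumes proper: "\<And>s. s \<in> sos D \<Longrightarrow> 1 + s \<notin> I"
  obtains P where "I \<subseteq> P" "subring_prime_ideal D P"
    "\<And>b s. b \<in> D \<Longrightarrow> s \<in> sos D \<Longrightarrow> b\<^sup>2 + s \<in> P \<Longrightarrow> b \<in> P"
proof -
  define \<A> where "\<A> = {P. I \<subseteq> P \<and> subring_ideal D P \<and> (\<forall>s\<in>sos D. 1 + s \<notin> P)}"
  have "\<exists>P\<in>\<A>. \<forall>J\<in>\<A>. P \<subseteq> J \<longrightarrow> J = P"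
  proof (rule subset_Zorn_nonempty)
    show "\<A> \<noteq> {}"
      using proper subring_ideal_axioms unfolding \<A>_def by blast
    fix \<C> assume ne: "\<C> \<noteq> {}" and chain: "subset.chain \<A> \<C>"
    have sub: "J \<in> \<C> \<Longrightarrow> J \<in> \<A>" for J
      using chain unfolding subset.chain_def by blast
    have ide: "subring_ideal D J" if "J \<in> \<C>" for J
      using sub[OF that] unfolding \<A>_def by blast
    have "subring_ideal D (\<Union>\<C>)"
    proof (intro subring_ideal.intro unital_subring_axioms subring_ideal_axioms.intro)
      show "\<Union>\<C> \<subseteq> D"
        using subring_ideal.ideal_subset[OF ide] by (rule Union_least)
      obtain J where "J \<in> \<C>"
        using ne by blast
      then show "0 \<in> \<Union>\<C>"
        using subring_ideal.ideal_zero[OF ide] by blast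
      show "c * a \<in> \<Union>\<C>" if "a \<in> \<Union>\<C>" "c \<in> D" for a c
        using that subring_ideal.ideal_mult[OF ide] by blast
      fix a b assume "a \<in> \<Union>\<C>" "b \<in> \<Union>\<C>"
      then obtain J L where JL: "J \<in> \<C>" "L \<in> \<C>" "a \<in> J" "b \<in> L" by blast
      then have "J \<subseteq> L \<or> L \<subseteq> J"
        using chain unfolding subset.chain_def by blast
      then obtain Z where "Z \<in> \<C>" "a \<in> Z" "b \<in> Z"
        using JL by blast
      then show "a - b \<in> \<Union>\<C>"
        using subring_ideal.ideal_diff[OF ide] by blast
    qed
    then show "\<Union>\<C> \<in> \<A>"
      using ne sub unfolding \<A>_def by blast
  qed
  then obtain P where PA: "P \<in> \<A>" and max: "\<And>J. J \<in> \<A> \<Longrightarrow> P \<subseteq> J \<Longrightarrow> J = P"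
    by blast
  then have P: "I \<subseteq> P" "subring_ideal D P" "\<And>s. s \<in> sos D \<Longrightarrow> 1 + s \<notin> P"
    unfolding \<A>_def by blast+
  interpret P: subring_ideal D P by fact
  \<comment> \<open>By maximality the ideal generated by P and b contains some 1 + s.\<close>
  have key: "\<exists>s\<in>sos D. \<exists>u\<in>P. \<exists>c\<in>D. 1 + s = u + c * b" if b: "b \<in> D" "b \<notin> P" for b
  proof (rule ccontr)
    assume no: "\<not> ?thesis"
    let ?J = "{u + c * b | u c. u \<in> P \<and> c \<in> D}"
    have "P \<subseteq> ?J"
    proof
      fix u assume "u \<in> P"
      then have "u = u + 0 * b" "u \<in> P" "0 \<in> D" using zero_mem by auto
      then show "u \<in> ?J" by blast
    qed
    moreover have "b \<in> ?J"
    proof -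
      have "b = 0 + 1 * b" "0 \<in> P" "1 \<in> D" using P.ideal_zero one_mem by auto
      then show ?thesis by blast
    qed
    moreover have "\<forall>s\<in>sos D. 1 + s \<notin> ?J"
      using no by blast
    then have "?J \<in> \<A>"
      using P.subring_ideal_adjoin[OF b(1)] P(1) \<open>P \<subseteq> ?J\<close> unfolding \<A>_def by blast
    ultimately show False
      using max b(2) by blast
  qed
  have "a \<in> P \<or> b \<in> P" if ab: "a \<in> D" "b \<in> D" "a * b \<in> P" for a b
  proof (rule ccontr)
    assume "\<not> ?thesis"
    then obtain s u c t v d where s: "s \<in> sos D" "u \<in> P" "c \<in> D" "1 + s = u + c * a"
      and t: "t \<in> sos D" "v \<in> P" "d \<in> D" "1 + t = v + d * b"
      using key ab by meson
    have "1 + (s + t + s * t) = (1 + s) * (1 + t)"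
      by (simp add: algebra_simps)
    also have "\<dots> = (v + d * b) * u + ((c * a) * v + (c * d) * (a * b))"
      unfolding s t by (simp add: algebra_simps)
    also have "\<dots> \<in> P"
    proof (intro P.ideal_add)
      have "v \<in> D"
        using t(2) P.ideal_subset by blast
      then show "(v + d * b) * u \<in> P"
        by (intro P.ideal_mult[OF s(2)] closed t ab)
      show "c * a * v \<in> P" "c * d * (a * b) \<in> P"
        by (intro P.ideal_mult[OF t(2)] P.ideal_mult[OF ab(3)] closed s t ab)+
    qed
    finally show False
      using P(3) s(1) t(1) by (meson sos_add sos_mult)
  qed
  moreover have "1 \<notin> P"
    using P(3)[OF sos_zero] by simp
  ultimately have "subring_prime_ideal D P"
    by (intro subring_prime_ideal.intro P(2) subring_prime_ideal_axioms.intro)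
  moreover have "b \<in> P" if b: "b \<in> D" "s \<in> sos D" "b\<^sup>2 + s \<in> P" for b s
  proof (rule ccontr)
    assume "b \<notin> P"
    then obtain t u c where t: "t \<in> sos D" "u \<in> P" "c \<in> D" "1 + t = u + c * b"
      using key b(1) by meson
    \<comment> \<open>From 1 + t = c b modulo P it follows that (1 + t)^2 + c^2 s = c^2 (b^2 + s) =
      0 modulo P; the left side is 1 plus a sum of squares.\<close>
    have "1 + (t + t + t * t + c\<^sup>2 * s) = (1 + t)\<^sup>2 + c\<^sup>2 * s"
      by (simp add: algebra_simps power2_eq_square)
    also have "\<dots> = (u + (c * b + c * b)) * u + c\<^sup>2 * (b\<^sup>2 + s)"
      unfolding t by (simp add: algebra_simps power2_eq_square)
    also have "\<dots> \<in> P"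
    proof (intro P.ideal_add)
      have "u \<in> D"
        using t(2) P.ideal_subset by blast
      then show "(u + (c * b + c * b)) * u \<in> P"
        by (intro P.ideal_mult[OF t(2)] closed t b)
      show "c\<^sup>2 * (b\<^sup>2 + s) \<in> P"
        by (intro P.ideal_mult[OF b(3)] closed t)
    qed
    finally show False
      using P(3) t b by (meson sos_add sos_mult sos_mult_square)
  qed
  ultimately show thesis
    using that P(1) by blast
qed

text \<open>A nonzero prime ideal Q of E[Y] without nonzero constants is the vanishing ideal of a
  root w of a member m of least degree. A polynomial n over E of least degree that vanishes at w
  divides m up to a constant; the cofactor has smaller degree than m and is not in Q, so n is in Q
  by primality. Up to constants, n then divides everything that vanishes at w, and m divides
  everything in Q.\<close>

lemma generic_root:
  fixes E :: "'w::alg_closed_field set"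
  assumes E: "unital_subring E" and Q: "subring_ideal (polys_over E) Q"
    and prime: "\<And>f g. f \<in> polys_over E \<Longrightarrow> g \<in> polys_over E \<Longrightarrow> f * g \<in> Q \<Longrightarrow> f \<in> Q \<or> g \<in> Q"
    and const: "\<And>c. [:c:] \<in> Q \<Longrightarrow> c = 0" and ne: "Q \<noteq> {0}"
  shows "\<exists>w. \<forall>f\<in>polys_over E. poly f w = 0 \<longleftrightarrow> f \<in> Q"
proof -
  interpret unital_subring E by fact
  interpret Q: subring_ideal "polys_over E" Q by fact
  have division: "\<exists>c q r. c \<in> E \<and> c \<noteq> 0 \<and> q \<in> polys_over E \<and> r \<in> polys_over E \<and>
      [:c:] * f = q * g + r \<and> (r = 0 \<or> degree r < degree g)"
    if f: "f \<in> polys_over E" and g: "g \<in> polys_over E" "g \<noteq> 0" for f g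
  proof -
    obtain k q r where *: "q \<in> polys_over E" "r \<in> polys_over E"
      "smult (lead_coeff g ^ k) f = q * g + r" "r = 0 \<or> degree r < degree g"
      using pseudo_division[OF g(1) f] by blast
    then show ?thesis
      using g coeff_mem[OF g(1)]
      by (intro exI[of _ "lead_coeff g ^ k"] exI[of _ q] exI[of _ r]) (auto simp: power_mem)
  qed
  obtain m0 where "m0 \<in> Q" "m0 \<noteq> 0"
    using ne Q.ideal_zero by blast
  then obtain m where m: "m \<in> Q" "m \<noteq> 0" "\<And>f. f \<in> Q \<Longrightarrow> f \<noteq> 0 \<Longrightarrow> degree m \<le> degree f"
    using ex_has_least_nat[of "\<lambda>f. f \<in> Q \<and> f \<noteq> 0" m0 degree] by blast
  have mE: "m \<in> polys_over E" using m(1) Q.ideal_subset by blast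
  have "degree m \<noteq> 0"
  proof
    assume "degree m = 0"
    then obtain c where "m = [:c:]" by (rule degree_eq_zeroE)
    then show False using m(1,2) const by auto
  qed
  then obtain w where w: "poly m w = 0"
    using alg_closed_imp_poly_has_root[of m] by auto
  then obtain n where n: "n \<in> polys_over E" "n \<noteq> 0" "poly n w = 0"
    "\<And>f. f \<in> polys_over E \<Longrightarrow> f \<noteq> 0 \<Longrightarrow> poly f w = 0 \<Longrightarrow> degree n \<le> degree f"
    using ex_has_least_nat[of "\<lambda>f. f \<in> polys_over E \<and> f \<noteq> 0 \<and> poly f w = 0" m degree] m(2) mE by blast
  have n_dvd: "\<exists>c q. c \<in> E \<and> c \<noteq> 0 \<and> q \<in> polys_over E \<and> [:c:] * f = q * n"
    if f: "f \<in> polys_over E" "poly f w = 0" for f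
  proof -
    obtain c q r where *: "c \<in> E" "c \<noteq> 0" "q \<in> polys_over E" "r \<in> polys_over E"
      "[:c:] * f = q * n + r" "r = 0 \<or> degree r < degree n"
      using division[OF f(1) n(1,2)] by blast
    have "poly ([:c:] * f) w = poly (q * n + r) w"
      using *(5) by (rule arg_cong)
    then have "poly r w = 0"
      using f(2) n(3) by simp
    then have "r = 0"
      using *(6) n(4)[OF *(4)] by fastforce
    then show ?thesis using * by auto
  qed
  have "degree n \<noteq> 0"
  proof
    assume "degree n = 0"
    then obtain c where "n = [:c:]" by (rule degree_eq_zeroE)
    then show False using n(2,3) by auto
  qed
  have "n \<in> Q"
  proof -
    obtain c q where cq: "c \<in> E" "c \<noteq> 0" "q \<in> polys_over E" "[:c:] * m = q * n"
      using n_dvd[OF mE w] by blast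
    then have "q * n \<in> Q"
      using Q.ideal_mult[OF m(1), of "[:c:]"] by (simp only: const_mem_iff)
    moreover have "q \<notin> Q"
    proof
      assume "q \<in> Q"
      have "q \<noteq> 0" using cq m(2) by auto
      then have "degree m = degree q + degree n"
        using cq(2) n(2) arg_cong[OF cq(4), of degree] by (simp add: degree_mult_eq)
      then show False
        using m(3)[OF \<open>q \<in> Q\<close> \<open>q \<noteq> 0\<close>] \<open>degree n \<noteq> 0\<close> by simp
    qed
    ultimately show ?thesis
      using prime[OF cq(3) n(1)] by blast
  qed
  have "f \<in> Q" if f: "f \<in> polys_over E" "poly f w = 0" for f
  proof -
    obtain c q where cq: "c \<in> E" "c \<noteq> 0" "q \<in> polys_over E" "[:c:] * f = q * n"
      using n_dvd[OF f] by blast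
    then have "[:c:] * f \<in> Q"
      using Q.ideal_mult[OF \<open>n \<in> Q\<close> cq(3)] by simp
    then show ?thesis
      using prime[of "[:c:]" f] f(1) cq(1,2) const by (auto simp: const_mem_iff)
  qed
  moreover have "poly f w = 0" if f: "f \<in> Q" for f
  proof -
    have fE: "f \<in> polys_over E" using f Q.ideal_subset by blast
    obtain c q r where *: "c \<in> E" "c \<noteq> 0" "q \<in> polys_over E" "r \<in> polys_over E"
      "[:c:] * f = q * m + r" "r = 0 \<or> degree r < degree m"
      using division[OF fE mE m(2)] by blast
    have "r = [:c:] * f - q * m"
      using *(5) by simp
    then have "r \<in> Q"
      using *(1,3) f m(1) by (simp only: Q.ideal_diff Q.ideal_mult const_mem_iff)
    then have "r = 0"
      using m(3)[of r] *(6) by fastforce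
    have "poly ([:c:] * f) w = poly (q * m + r) w"
      using *(5) by (rule arg_cong)
    then show ?thesis
      using w \<open>r = 0\<close> *(2) by simp
  qed
  ultimately show ?thesis by blast
qed

lemma subring_hom_subset: "subring_hom C \<phi> \<Longrightarrow> unital_subring B \<Longrightarrow> B \<subseteq> C \<Longrightarrow> subring_hom B \<phi>"
  unfolding subring_hom_def subring_hom_axioms_def by blast

context subring_prime_ideal
begin

text \<open>The polynomials over C whose value at z lies in P are carried by \<psi> to an ideal Q
  over the image of C, and Q is prime because P is. The polynomial g says that z is algebraic modulo
  P over C, which makes Q nonzero. A generic root of Q is the image of z for which the kernel of the
  extension is P again.\<close>

lemma extend_generic_hom:
  fixes \<psi> :: "'a \<Rightarrow> 'w::alg_closed_field"
  assumes \<psi>: "subring_hom C \<psi>" and C: "C \<subseteq> D" and kernel: "\<And>c. c \<in> C \<Longrightarrow> \<psi> c = 0 \<longleftrightarrow> c \<in> P"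
    and z: "z \<in> D" and g: "g \<in> polys_over C" "coeff g i \<notin> P" "poly g z \<in> P"
  shows "\<exists>\<psi>' :: 'a \<Rightarrow> 'w. subring_hom (adjoin C z) \<psi>' \<and> (\<forall>a\<in>adjoin C z. \<psi>' a = 0 \<longleftrightarrow> a \<in> P)"
proof -
  interpret C: subring_hom C \<psi> by fact
  define Q where "Q = map_poly \<psi> ` {f \<in> polys_over C. poly f z \<in> P}"
  have inD: "poly f z \<in> D" if "f \<in> polys_over C" for f
    using that polys_over_mono[OF C] z poly_mem by blast
  \<comment> \<open>Polynomials with the same image differ by one with coefficients in P, and its
    value at z lies in P. Membership in Q can therefore be tested on any preimage.\<close>
  have Q_iff: "map_poly \<psi> f \<in> Q \<longleftrightarrow> poly f z \<in> P" if f: "f \<in> polys_over C" for f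
  proof
    assume "map_poly \<psi> f \<in> Q"
    then obtain h where h: "h \<in> polys_over C" "poly h z \<in> P" "map_poly \<psi> f = map_poly \<psi> h"
      unfolding Q_def by blast
    have "\<psi> (coeff (f - h) j) = 0" for j
      using arg_cong[OF h(3), of "\<lambda>p. coeff p j"] f h(1)
      by (simp add: C.coeff_map C.hom_diff coeff_mem)
    moreover have "coeff (f - h) j \<in> C" for j
      using C.poly_closed(3)[OF f h(1)] by (rule coeff_mem)
    ultimately have "f - h \<in> polys_over P"
      using kernel by (intro polys_overI) blast
    then have "poly (f - h) z + poly h z \<in> P"
      by (intro ideal_add poly_mem_ideal z h(2))
    then show "poly f z \<in> P" by simp
  next
    assume "poly f z \<in> P"
    then show "map_poly \<psi> f \<in> Q"
      using f unfolding Q_def by blast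
  qed
  let ?E = "\<psi> ` C"
  have E: "unital_subring ?E"
    by (rule C.unital_subring_image)
  interpret E: unital_subring ?E by fact
  have Qsub: "Q \<subseteq> polys_over ?E"
    unfolding Q_def using C.map_poly_mem_image by blast
  have Q: "subring_ideal (polys_over ?E) Q"
  proof (intro subring_ideal.intro subring_ideal_axioms.intro E.unital_subring_polys_over Qsub)
    show "0 \<in> Q"
      using Q_iff[OF C.poly_closed(1)] ideal_zero by simp
    fix a assume a: "a \<in> Q"
    then obtain f where f: "f \<in> polys_over C" "a = map_poly \<psi> f" "poly f z \<in> P"
      unfolding Q_def by blast
    show "c * a \<in> Q" if c: "c \<in> polys_over ?E" for c
    proof -
      obtain h where h: "h \<in> polys_over C" "map_poly \<psi> h = c"
        using C.lift_poly[OF c] .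
      then have "c * a = map_poly \<psi> (h * f)"
        using f by (simp add: C.map_mult)
      then show ?thesis
        using Q_iff[of "h * f"] h f ideal_mult[OF f(3) inD[OF h(1)]] by (simp add: C.poly_closed)
    qed
    fix b assume b: "b \<in> Q"
    then obtain h where h: "h \<in> polys_over C" "b = map_poly \<psi> h" "poly h z \<in> P"
      unfolding Q_def by blast
    then show "a - b \<in> Q"
      using Q_iff[of "f - h"] f ideal_diff by (simp add: C.poly_closed C.map_diff)
  qed
  have "F \<in> Q \<or> G \<in> Q" if FG: "F \<in> polys_over ?E" "G \<in> polys_over ?E" "F * G \<in> Q" for F G
  proof -
    obtain f where f: "f \<in> polys_over C" "map_poly \<psi> f = F"
      using C.lift_poly[OF FG(1)] .
    obtain h where h: "h \<in> polys_over C" "map_poly \<psi> h = G"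
      using C.lift_poly[OF FG(2)] .
    have "poly (f * h) z \<in> P"
      using Q_iff[of "f * h"] f h FG(3) by (simp add: C.poly_closed C.map_mult)
    then have "poly f z \<in> P \<or> poly h z \<in> P"
      using prime[OF inD[OF f(1)] inD[OF h(1)]] by simp
    then show ?thesis
      using Q_iff f h by blast
  qed
  moreover have "c = 0" if "[:c:] \<in> Q" for c
  proof -
    have "[:c:] \<in> polys_over ?E" using that Qsub by blast
    then obtain b where b: "b \<in> C" "c = \<psi> b"
      by (auto simp: E.const_mem_iff)
    then have "b \<in> P"
      using Q_iff[of "[:b:]"] that by (simp add: C.const_mem_iff C.map_const)
    then show ?thesis
      using kernel b by simp
  qed
  moreover have "Q \<noteq> {0}"
  proof -
    have "\<psi> (coeff g i) \<noteq> 0"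
      using kernel g coeff_mem by metis
    then have "map_poly \<psi> g \<noteq> 0"
      by (metis C.coeff_map coeff_0)
    then show ?thesis
      using Q_iff[OF g(1)] g(3) by blast
  qed
  ultimately obtain w where w: "\<And>F. F \<in> polys_over ?E \<Longrightarrow> poly F w = 0 \<longleftrightarrow> F \<in> Q"
    using generic_root[OF E Q] by blast
  have root: "poly (map_poly \<psi> f) w = 0 \<longleftrightarrow> poly f z \<in> P" if "f \<in> polys_over C" for f
    using w[OF C.map_poly_mem_image[OF that]] Q_iff[OF that] by blast
  then obtain \<psi>' where "subring_hom (adjoin C z) \<psi>'"
    "\<forall>f\<in>polys_over C. \<psi>' (poly f z) = poly (map_poly \<psi> f) w"
    using C.extend_hom[of z w] ideal_zero by auto
  then show ?thesis
    using root unfolding adjoin_def by (intro exI[of _ \<psi>']) auto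
qed

end

text \<open>
  The variables in a maximal set B that is algebraically independent modulo P are mapped to
  themselves. All other variables are algebraic modulo P over those in B, so that the algebraic closure
  is large enough for a generic point.
\<close>

lemma exists_generic_hom:
  fixes P :: "((nat \<Rightarrow>\<^sub>0 nat) \<Rightarrow>\<^sub>0 'k::field) set"
  assumes "subring_prime_ideal (mpolys {..<n}) P"
  obtains \<psi> :: "((nat \<Rightarrow>\<^sub>0 nat) \<Rightarrow>\<^sub>0 'k) \<Rightarrow> ((nat \<Rightarrow>\<^sub>0 nat) \<Rightarrow>\<^sub>0 'k) fract alg_closure"
  where "subring_hom (mpolys {..<n}) \<psi>" "\<And>a. a \<in> mpolys {..<n} \<Longrightarrow> \<psi> a = 0 \<longleftrightarrow> a \<in> P"
proof -
  interpret subring_prime_ideal "mpolys {..<n}" P by fact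
  define \<B> where "\<B> = {B. B \<subseteq> {..<n} \<and> mpolys B \<inter> P = {0}}"
  have "finite \<B>"
    unfolding \<B>_def by (rule finite_subset[of _ "Pow {..<n}"]) auto
  moreover have "{} \<in> \<B>"
  proof -
    have "p = 0" if p: "p \<in> mpolys {}" "p \<in> P" for p :: "(nat \<Rightarrow>\<^sub>0 nat) \<Rightarrow>\<^sub>0 'k"
    proof -
      obtain c where pc: "p = mconst c"
        using p(1) unfolding mpolys_empty by blast
      show ?thesis
      proof (rule ccontr)
        assume "p \<noteq> 0"
        then have "mconst (inverse c) * p = 1"
          unfolding pc by (simp flip: mconst_simps(4)) 
        moreover have "mconst (inverse c) * p \<in> P"
          by (intro ideal_mult p(2) mconst_mem)
        ultimately show False
          using one_notin by simp
      qed
    qed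
    moreover have "(0 :: (nat \<Rightarrow>\<^sub>0 nat) \<Rightarrow>\<^sub>0 'k) \<in> mpolys {}"
      by (rule unital_subring.zero_mem[OF unital_subring_mpolys])
    ultimately show ?thesis
      unfolding \<B>_def using ideal_zero by auto
  qed
  ultimately obtain B where B: "B \<in> \<B>" "\<And>A. A \<in> \<B> \<Longrightarrow> B \<subseteq> A \<Longrightarrow> A = B"
    using finite_has_maximal[of \<B>] by (metis empty_iff)
  have Bsub: "B \<subseteq> {..<n}" and BP: "mpolys B \<inter> P = {0}"
    using B(1) by (auto simp: \<B>_def)
  let ?j = "\<lambda>p. to_ac (to_fract p)"
  have extend: "\<exists>\<psi> :: ((nat \<Rightarrow>\<^sub>0 nat) \<Rightarrow>\<^sub>0 'k) \<Rightarrow> ((nat \<Rightarrow>\<^sub>0 nat) \<Rightarrow>\<^sub>0 'k) fract alg_closure.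
      subring_hom (mpolys (B \<union> U)) \<psi> \<and> (\<forall>a\<in>mpolys (B \<union> U). \<psi> a = 0 \<longleftrightarrow> a \<in> P)"
    if "finite U" "U \<subseteq> {..<n}" for U
    using that
  proof (induction U rule: finite_induct)
    case empty
    have "subring_hom (mpolys (B \<union> {})) ?j"
      by (intro subring_hom.intro subring_hom_axioms.intro unital_subring_mpolys) auto
    moreover have "?j a = 0 \<longleftrightarrow> a \<in> P" if "a \<in> mpolys B" for a
      using that BP ideal_zero by auto
    ultimately show ?case by auto
  next
    case (insert i U)
    then obtain \<psi> :: "((nat \<Rightarrow>\<^sub>0 nat) \<Rightarrow>\<^sub>0 'k) \<Rightarrow> ((nat \<Rightarrow>\<^sub>0 nat) \<Rightarrow>\<^sub>0 'k) fract alg_closure"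
      where \<psi>: "subring_hom (mpolys (B \<union> U)) \<psi>" "\<And>a. a \<in> mpolys (B \<union> U) \<Longrightarrow> \<psi> a = 0 \<longleftrightarrow> a \<in> P"
      by auto
    show ?case
    proof (cases "i \<in> B")
      case True
      then have "B \<union> insert i U = B \<union> U" by auto
      then show ?thesis using \<psi> by metis
    next
      case False
      \<comment> \<open>Maximality of B yields a nonzero q in P in the variables of B and the
        variable i. As a polynomial in this variable, its leading coefficient involves only
        variables of B and so is not in P.\<close>
      then have "insert i B \<notin> \<B>"
        using B(2)[of "insert i B"] by blast
      then have "mpolys (insert i B) \<inter> P \<noteq> {0}"
        using Bsub insert.prems by (auto simp: \<B>_def)
      moreover have "0 \<in> mpolys (insert i B) \<inter> P"
        using unital_subring.zero_mem[OF unital_subring_mpolys] ideal_zero by blast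
      ultimately obtain q where q: "q \<in> mpolys (insert i B)" "q \<in> P" "q \<noteq> 0"
        by blast
      then obtain g where g: "g \<in> polys_over (mpolys B)" "q = poly g (mvar i)"
        using mpolys_insert[of i B] unfolding adjoin_def by blast
      then have "g \<noteq> 0" using q(3) by auto
      then have "lead_coeff g \<noteq> 0" by simp
      then have "lead_coeff g \<notin> P"
        using coeff_mem[OF g(1)] BP by blast
      moreover have "g \<in> polys_over (mpolys (B \<union> U))"
        using g(1) polys_over_mono[OF mpolys_mono[of B "B \<union> U"]] by blast
      moreover have "mpolys (B \<union> U) \<subseteq> (mpolys {..<n} :: ((nat \<Rightarrow>\<^sub>0 nat) \<Rightarrow>\<^sub>0 'k) set)"
        using Bsub insert.prems by (intro mpolys_mono) auto
      moreover have "mvar i \<in> (mpolys {..<n} :: ((nat \<Rightarrow>\<^sub>0 nat) \<Rightarrow>\<^sub>0 'k) set)"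
        using insert.prems by (intro mvar_mem) auto
      moreover have "poly g (mvar i) \<in> P"
        using g(2) q(2) by simp
      ultimately have "\<exists>\<psi>' :: ((nat \<Rightarrow>\<^sub>0 nat) \<Rightarrow>\<^sub>0 'k) \<Rightarrow> ((nat \<Rightarrow>\<^sub>0 nat) \<Rightarrow>\<^sub>0 'k) fract alg_closure.
          subring_hom (adjoin (mpolys (B \<union> U)) (mvar i)) \<psi>' \<and>
          (\<forall>a\<in>adjoin (mpolys (B \<union> U)) (mvar i). \<psi>' a = 0 \<longleftrightarrow> a \<in> P)"
        by (intro extend_generic_hom[OF \<psi>(1) _ \<psi>(2)])
      then obtain \<psi>' :: "((nat \<Rightarrow>\<^sub>0 nat) \<Rightarrow>\<^sub>0 'k) \<Rightarrow> ((nat \<Rightarrow>\<^sub>0 nat) \<Rightarrow>\<^sub>0 'k) fract alg_closure"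
        where \<psi>': "subring_hom (adjoin (mpolys (B \<union> U)) (mvar i)) \<psi>'"
          "\<forall>a\<in>adjoin (mpolys (B \<union> U)) (mvar i). \<psi>' a = 0 \<longleftrightarrow> a \<in> P"
        by blast
      have sub: "mpolys (B \<union> insert i U) \<subseteq> adjoin (mpolys (B \<union> U)) (mvar i)"
        using mpolys_insert[of i "B \<union> U"] by simp
      then show ?thesis
        using \<psi>'(2) subring_hom_subset[OF \<psi>'(1) unital_subring_mpolys sub] by blast
    qed
  qed
  have "B \<union> {..<n} = {..<n}" using Bsub by auto
  then show thesis
    using extend[of "{..<n}"] that by auto
qed

section \<open>Existence of real closed subfields\<close>

text \<open>An element h of least degree in the ideal generated by f and g divides both. If h were
  not constant, f would be a constant multiple of h by irreducibility and would divide g.\<close>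

lemma (in field_subset) irreducible_bezout:
  assumes f: "f \<in> polys_over R" "f \<noteq> 0" and g: "g \<in> polys_over R"
    and irr: "\<And>p q. p \<in> polys_over R \<Longrightarrow> q \<in> polys_over R \<Longrightarrow> f = p * q \<Longrightarrow> degree p = 0 \<or> degree q = 0"
    and ndvd: "\<not> (\<exists>q\<in>polys_over R. g = f * q)"
  shows "\<exists>u\<in>polys_over R. \<exists>v\<in>polys_over R. u * g + v * f = 1"
proof -
  define J where "J = {u * g + v * f | u v. u \<in> polys_over R \<and> v \<in> polys_over R}"
  have JI: "u * g + v * f \<in> J" if "u \<in> polys_over R" "v \<in> polys_over R" for u v
    using that unfolding J_def by blast
  have "f \<in> J" "g \<in> J"
    using JI[OF poly_closed(1,2)] JI[OF poly_closed(2,1)] by simp_all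
  then obtain h where h: "h \<in> J" "h \<noteq> 0" "\<And>p. p \<in> J \<Longrightarrow> p \<noteq> 0 \<Longrightarrow> degree h \<le> degree p"
    using f(2) ex_has_least_nat[of "\<lambda>p. p \<in> J \<and> p \<noteq> 0" f degree] by blast
  obtain u v where uv: "u \<in> polys_over R" "v \<in> polys_over R" "h = u * g + v * f"
    using h(1) unfolding J_def by blast
  have hR: "h \<in> polys_over R"
    unfolding uv(3) using uv f g by (intro poly_closed)
  have dvd: "\<exists>q\<in>polys_over R. p = q * h" if p: "p \<in> J" for p
  proof -
    obtain u' v' where uv': "u' \<in> polys_over R" "v' \<in> polys_over R" "p = u' * g + v' * f"
      using p unfolding J_def by blast
    have pR: "p \<in> polys_over R"
      unfolding uv'(3) using uv' f g by (intro poly_closed)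
    obtain q r where qr: "q \<in> polys_over R" "r \<in> polys_over R" "p = q * h + r" "r = 0 \<or> degree r < degree h"
      using division_with_remainder[OF hR h(2) pR] .
    have "r = (u' - q * u) * g + (v' - q * v) * f"
      using qr(3) uv(3) uv'(3) by (simp add: algebra_simps)
    then have "r \<in> J"
      using JI[of "u' - q * u" "v' - q * v"] uv uv' qr by (simp add: poly_closed)
    then have "r = 0"
      using h(3)[of r] qr(4) by fastforce
    then show ?thesis using qr by auto
  qed
  obtain q where q: "q \<in> polys_over R" "f = q * h"
    using dvd[OF \<open>f \<in> J\<close>] by blast
  have "degree q \<noteq> 0"
  proof
    assume "degree q = 0"
    then obtain c where c: "q = [:c:]" by (rule degree_eq_zeroE)
    then have c': "c \<in> R" "c \<noteq> 0"
      using q f(2) by (auto simp: const_mem_iff)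
    obtain p where p: "p \<in> polys_over R" "g = p * h"
      using dvd[OF \<open>g \<in> J\<close>] by blast
    have "g = f * ([:inverse c:] * p)"
      unfolding p(2) q(2) c using c'(2) by simp
    moreover have "[:inverse c:] * p \<in> polys_over R"
      using c'(1) p(1) inverse_mem by (intro poly_closed) (simp_all add: const_mem_iff)
    ultimately show False using ndvd by blast
  qed
  then have "degree h = 0"
    using irr[OF q(1) hR q(2)] by auto
  then obtain c where c: "h = [:c:]" by (rule degree_eq_zeroE)
  then have c': "inverse c \<in> R" "c \<noteq> 0"
    using hR h(2) inverse_mem by (auto simp: const_mem_iff)
  have "smult (inverse c) u * g + smult (inverse c) v * f = smult (inverse c) h"
    unfolding uv(3) by (simp add: smult_add_right)
  then have "smult (inverse c) u * g + smult (inverse c) v * f = 1"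
    using c c'(2) by simp
  then show ?thesis
    using smult_mem[OF c'(1)] uv(1,2) by blast
qed

lemma (in unital_subring) sos_adjoin:
  "s \<in> sos (adjoin C z) \<Longrightarrow> \<exists>S\<in>sos (polys_over C). s = poly S z"
proof (induction s rule: sos.induct)
  case sos_zero
  show ?case by (rule bexI[OF _ sos.sos_zero]) simp
next
  case (sos_add_square a s)
  then obtain S f where S: "S \<in> sos (polys_over C)" "s = poly S z" "f \<in> polys_over C" "a = poly f z"
    by (auto simp: adjoin_def)
  then have "f\<^sup>2 + S \<in> sos (polys_over C)" "a\<^sup>2 + s = poly (f\<^sup>2 + S) z"
    by (auto intro: sos.sos_add_square)
  then show ?case by blast
qed

text \<open>Over a common denominator, a sum of squares of fractions is t / b^2 with t a sum of
  squares in A. Then 1 + s = 0 would mean b^2 + t = 0, which forces b = 0.\<close>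

lemma fraction_field:
  fixes F :: "'w::field set"
  assumes A: "unital_subring A" and real: "\<And>b s. b \<in> A \<Longrightarrow> s \<in> sos A \<Longrightarrow> b\<^sup>2 + s = 0 \<Longrightarrow> b = 0"
    and F: "F = {a / b | a b. a \<in> A \<and> b \<in> A \<and> b \<noteq> 0}"
  shows "field_subset F" "A \<subseteq> F" "s \<in> sos F \<Longrightarrow> 1 + s \<noteq> 0"
proof -
  interpret A: unital_subring A by fact
  have FI: "a / b \<in> F" if "a \<in> A" "b \<in> A" "b \<noteq> 0" for a b
    using that unfolding F by blast
  show "A \<subseteq> F"
    using FI[OF _ A.one_mem] by auto
  show "field_subset F"
  proof (intro field_subset.intro unital_subring.intro field_subset_axioms.intro)
    show "1 \<in> F"
      using \<open>A \<subseteq> F\<close> A.one_mem by blast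
    fix x assume "x \<in> F"
    then obtain a b where x: "x = a / b" "a \<in> A" "b \<in> A" "b \<noteq> 0"
      unfolding F by blast
    show "inverse x \<in> F"
      using x FI[of b a] FI[of 0 1] A.closed by (cases "a = 0") auto
    fix y assume "y \<in> F"
    then obtain c d where y: "y = c / d" "c \<in> A" "d \<in> A" "d \<noteq> 0"
      unfolding F by blast
    have "x - y = (a * d - c * b) / (b * d)"
      unfolding x(1) y(1) using x(4) y(4) by (simp add: field_simps)
    then show "x - y \<in> F"
      using FI[of "a * d - c * b" "b * d"] x y by (simp add: A.closed)
    have "x * y = (a * c) / (b * d)"
      unfolding x(1) y(1) by simp
    then show "x * y \<in> F"
      using FI[of "a * c" "b * d"] x y by (simp add: A.closed)
  qed
  have common: "\<exists>t\<in>sos A. \<exists>b\<in>A. b \<noteq> 0 \<and> s = t / b\<^sup>2" if "s \<in> sos F" for s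
    using that
  proof (induction s rule: sos.induct)
    case sos_zero
    show ?case
      using A.one_mem by (intro bexI[OF _ sos.sos_zero] bexI[of _ 1]) auto
  next
    case (sos_add_square x s)
    then obtain t b where t: "t \<in> sos A" "b \<in> A" "b \<noteq> 0" "s = t / b\<^sup>2" by blast
    obtain c d where x: "x = c / d" "c \<in> A" "d \<in> A" "d \<noteq> 0"
      using sos_add_square(1) unfolding F by blast
    have "x\<^sup>2 + s = ((c * b)\<^sup>2 + d\<^sup>2 * t) / (d * b)\<^sup>2"
      unfolding x(1) t(4) using x(4) t(3) by (simp add: field_simps)
    moreover have "(c * b)\<^sup>2 + d\<^sup>2 * t \<in> sos A"
      using x t by (intro sos.sos_add_square A.sos_mult_square A.closed)
    moreover have "d * b \<in> A" "d * b \<noteq> 0"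
      using x t by (auto intro: A.closed)
    ultimately show ?case by blast
  qed
  show "1 + s \<noteq> 0" if s: "s \<in> sos F"
  proof
    assume "1 + s = 0"
    moreover obtain t b where t: "t \<in> sos A" "b \<in> A" "b \<noteq> 0" "s = t / b\<^sup>2"
      using common[OF s] by blast
    ultimately have "b\<^sup>2 + t = 0"
      by (simp add: field_simps)
    then show False
      using real t by blast
  qed
qed

text \<open>Let R be a maximal real subfield that contains A. An irreducible f of degree at least 2
  has a root \<alpha> in the ambient field, outside R, so R[\<alpha>] is a strictly larger field and
  not real: 1 + S(\<alpha>) = 0 for a sum of squares S over R. If f did not divide 1 + S, then 1 +
  S(\<alpha>) would be invertible by Bezout's identity.\<close>

lemma exists_real_closed_subfield:
  fixes A :: "'w::alg_closed_field set"
  assumes A: "unital_subring A" and realA: "\<And>b s. b \<in> A \<Longrightarrow> s \<in> sos A \<Longrightarrow> b\<^sup>2 + s = 0 \<Longrightarrow> b = 0"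
  shows "\<exists>R. real_closed_subfield R \<and> A \<subseteq> R"
proof -
  define \<R> where "\<R> = {R. A \<subseteq> R \<and> field_subset R \<and> (\<forall>s\<in>sos R. 1 + s \<noteq> 0)}"
  have "\<exists>R\<in>\<R>. \<forall>J\<in>\<R>. R \<subseteq> J \<longrightarrow> J = R"
  proof (rule subset_Zorn_nonempty)
    note fraction_field[OF A realA refl]
    then have "{a / b | a b. a \<in> A \<and> b \<in> A \<and> b \<noteq> 0} \<in> \<R>"
      unfolding \<R>_def by simp
    then show "\<R> \<noteq> {}" by blast
    fix \<C> assume ne: "\<C> \<noteq> {}" and chain: "subset.chain \<R> \<C>"
    have sub: "J \<in> \<R>" if "J \<in> \<C>" for J
      using chain that unfolding subset.chain_def by blast
    have fs: "field_subset J" if "J \<in> \<C>" for J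
      using sub[OF that] unfolding \<R>_def by blast
    have us: "unital_subring J" if "J \<in> \<C>" for J
      using fs[OF that] by (rule field_subset.axioms(1))
    have common: "\<exists>Z\<in>\<C>. a \<in> Z \<and> b \<in> Z" if ab: "a \<in> \<Union>\<C>" "b \<in> \<Union>\<C>" for a b
    proof -
      obtain J L where JL: "J \<in> \<C>" "L \<in> \<C>" "a \<in> J" "b \<in> L" using ab by blast
      then have "J \<subseteq> L \<or> L \<subseteq> J"
        using chain unfolding subset.chain_def by blast
      then show ?thesis
        using JL by blast
    qed
    obtain J0 where J0: "J0 \<in> \<C>"
      using ne by blast
    have field: "field_subset (\<Union>\<C>)"
    proof (intro field_subset.intro unital_subring.intro field_subset_axioms.intro)
      show "1 \<in> \<Union>\<C>"
        using unital_subring.one_mem[OF us[OF J0]] J0 by blast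
      show "inverse a \<in> \<Union>\<C>" if "a \<in> \<Union>\<C>" for a
        using that field_subset.inverse_mem[OF fs] by blast
      fix a b assume "a \<in> \<Union>\<C>" "b \<in> \<Union>\<C>"
      from common[OF this] obtain Z where Z: "Z \<in> \<C>" "a \<in> Z" "b \<in> Z" by blast
      then show "a - b \<in> \<Union>\<C>" "a * b \<in> \<Union>\<C>"
        using unital_subring.diff_mem[OF us[OF Z(1)]] unital_subring.mult_mem[OF us[OF Z(1)]] by blast+
    qed
    have "\<exists>Z\<in>\<C>. s \<in> sos Z" if "s \<in> sos (\<Union>\<C>)" for s
      using that
    proof (induction s rule: sos.induct)
      case sos_zero
      show ?case using J0 sos.sos_zero by blast
    next
      case (sos_add_square a s)
      then obtain J L where JL: "J \<in> \<C>" "L \<in> \<C>" "a \<in> J" "s \<in> sos L" by blast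
      then have "J \<subseteq> L \<or> L \<subseteq> J"
        using chain unfolding subset.chain_def by blast
      then show ?case
      proof
        assume "J \<subseteq> L"
        then have "a\<^sup>2 + s \<in> sos L"
          using JL by (intro sos.sos_add_square) auto
        then show ?thesis using JL(2) by blast
      next
        assume "L \<subseteq> J"
        then have "a\<^sup>2 + s \<in> sos J"
          using JL sos_mono by (intro sos.sos_add_square) auto
        then show ?thesis using JL(1) by blast
      qed
    qed
    then have "\<forall>s\<in>sos (\<Union>\<C>). 1 + s \<noteq> 0"
      using sub unfolding \<R>_def by blast
    moreover have "A \<subseteq> \<Union>\<C>"
      using sub[OF J0] J0 unfolding \<R>_def by blast
    ultimately show "\<Union>\<C> \<in> \<R>"
      using field unfolding \<R>_def by blast
  qed
  then obtain R where R\<R>: "R \<in> \<R>" and max: "\<And>J. J \<in> \<R> \<Longrightarrow> R \<subseteq> J \<Longrightarrow> J = R"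
    by blast
  then have AR: "A \<subseteq> R" and "field_subset R" and real: "\<And>s. s \<in> sos R \<Longrightarrow> 1 + s \<noteq> 0"
    unfolding \<R>_def by blast+
  then interpret field_subset R by simp
  have "real_closed_subfield R"
  proof (intro real_closed_subfield.intro real_closed_subfield_axioms.intro real field_subset_axioms)
    fix f :: "'w poly" assume f: "f \<in> polys_over R" "2 \<le> degree f"
      and irr: "\<And>g h. g \<in> polys_over R \<Longrightarrow> h \<in> polys_over R \<Longrightarrow> f = g * h \<Longrightarrow> degree g = 0 \<or> degree h = 0"
    have f0: "f \<noteq> 0" using f(2) by auto
    obtain \<alpha> where \<alpha>: "poly f \<alpha> = 0"
      using alg_closed_imp_poly_has_root[of f] f(2) by auto
    let ?L = "adjoin R \<alpha>"
    have inv: "\<exists>u\<in>polys_over R. poly u \<alpha> * poly g \<alpha> = 1"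
      if g: "g \<in> polys_over R" "\<not> (\<exists>q\<in>polys_over R. g = f * q)" for g
    proof -
      obtain u v where uv: "u \<in> polys_over R" "u * g + v * f = 1"
        using irreducible_bezout[OF f(1) f0 g(1) irr g(2)] by blast
      then have "poly (u * g + v * f) \<alpha> = 1" by simp
      then show ?thesis using uv(1) \<alpha> by auto
    qed
    have "field_subset ?L"
    proof (intro field_subset.intro unital_subring_adjoin field_subset_axioms.intro)
      fix a assume "a \<in> ?L"
      then obtain g where g: "g \<in> polys_over R" "a = poly g \<alpha>"
        by (auto simp: adjoin_def)
      show "inverse a \<in> ?L"
      proof (cases "a = 0")
        case False
        then have "\<not> (\<exists>q\<in>polys_over R. g = f * q)"
          using g(2) \<alpha> by auto
        from inv[OF g(1) this] obtain u where "u \<in> polys_over R" "poly u \<alpha> * a = 1"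
          using g(2) by blast
        then have "inverse a = poly u \<alpha>"
          by (metis inverse_unique mult.commute)
        then show ?thesis
          using poly_mem_adjoin[OF \<open>u \<in> polys_over R\<close>] by simp
      qed (use unital_subring.zero_mem[OF unital_subring_adjoin] in simp)
    qed
    moreover have "\<alpha> \<notin> R"
    proof
      assume "\<alpha> \<in> R"
      then obtain g where g: "g \<in> polys_over R" "f = [:- \<alpha>, 1:] * g"
        using root_factor[OF f(1) _ \<alpha>] by blast
      then have "degree g = 0"
        using irr[OF X_minus_mem[OF \<open>\<alpha> \<in> R\<close>] g] by simp
      moreover have "degree f = Suc (degree g)"
        using f0 unfolding g(2) by (subst degree_mult_eq) auto
      ultimately show False using f(2) by simp
    qed
    then have "?L \<noteq> R" "R \<subseteq> ?L"
      using mem_adjoin[of \<alpha>] subset_adjoin[of \<alpha>] by auto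
    ultimately have "\<not> (\<forall>s\<in>sos ?L. 1 + s \<noteq> 0)"
      using max[of ?L] AR unfolding \<R>_def by blast
    then obtain s S where s: "S \<in> sos (polys_over R)" "s = poly S \<alpha>" "1 + s = 0"
      using sos_adjoin by blast
    have S: "1 + S \<in> polys_over R"
      using unital_subring.sos_mem[OF unital_subring_polys_over s(1)] by (intro poly_closed)
    have "\<exists>q\<in>polys_over R. 1 + S = f * q"
    proof (rule ccontr)
      assume "\<not> ?thesis"
      from inv[OF S this] show False
        using s(2,3) by simp
    qed
    then show "\<exists>s\<in>sos (polys_over R). \<exists>h\<in>polys_over R. 1 + s = f * h"
      using s(1) by blast
  qed
  then show ?thesis
    using AR by blast
qed

section \<open>Semi-real rings and real closed fields\<close>

text \<open>The link between rings given by a carrier and sums of squares given inductively: A is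
  presented as the image of a subring C of a type. It serves for K itself, for the quotient of K[X]
  by an irreducible polynomial and for the quotient by \<aa>.\<close>

lemma semi_real_iff:
  fixes A (structure)
  assumes "ring A" and C: "unital_subring C" and surj: "h ` C = carrier A" and one: "h 1 = \<one>"
    and add: "\<And>a b. a \<in> C \<Longrightarrow> b \<in> C \<Longrightarrow> h (a + b) = h a \<oplus> h b"
    and mult: "\<And>a b. a \<in> C \<Longrightarrow> b \<in> C \<Longrightarrow> h (a * b) = h a \<otimes> h b"
  shows "semi_real A \<longleftrightarrow> (\<forall>s\<in>sos C. h (1 + s) \<noteq> \<zero>)"
proof -
  interpret ring A by fact
  interpret C: unital_subring C by fact
  have closed: "h a \<in> carrier A" if "a \<in> C" for a
    using that surj by blast
  have zero: "h 0 = \<zero>"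
    using add[OF C.zero_mem C.zero_mem] closed[OF C.zero_mem] by (simp add: add.l_cancel_one')
  have square: "h (a\<^sup>2) = h a [^] (2::nat)" if "a \<in> C" for a
    using mult[OF that that] closed[OF that] by (simp add: power2_eq_square nat_pow_def numeral_2_eq_2)
  have to_sum: "\<exists>(m::nat) f. f \<in> {..<m} \<rightarrow> carrier A \<and> h s = (\<Oplus>i\<in>{..<m}. f i [^] (2::nat))"
    if "s \<in> sos C" for s
    using that
  proof (induction s rule: sos.induct)
    case sos_zero
    show ?case
      using zero by (intro exI[of _ 0]) auto
  next
    case (sos_add_square a s)
    then obtain m :: nat and f where f: "f \<in> {..<m} \<rightarrow> carrier A" "h s = (\<Oplus>i\<in>{..<m}. f i [^] (2::nat))"
      by blast
    let ?g = "f(m := h a)"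
    have g: "?g \<in> {..<Suc m} \<rightarrow> carrier A"
      using f(1) closed[OF sos_add_square(1)] by (auto simp: Pi_iff less_Suc_eq)
    have "(\<Oplus>i\<in>{..<Suc m}. ?g i [^] (2::nat)) = h a [^] (2::nat) \<oplus> (\<Oplus>i\<in>{..<m}. ?g i [^] (2::nat))"
      unfolding lessThan_Suc using f(1) closed[OF sos_add_square(1)]
      by (subst finsum_insert) (auto simp: Pi_iff)
    also have "(\<Oplus>i\<in>{..<m}. ?g i [^] (2::nat)) = (\<Oplus>i\<in>{..<m}. f i [^] (2::nat))"
      using f(1) by (intro finsum_cong') (auto simp: Pi_iff)
    finally have "h (a\<^sup>2 + s) = (\<Oplus>i\<in>{..<Suc m}. ?g i [^] (2::nat))"
      using add[OF C.power_mem[OF sos_add_square(1)] C.sos_mem[OF sos_add_square(2)]]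
        square[OF sos_add_square(1)] f(2) by simp
    with g show ?case by blast
  qed
  have from_sum: "\<exists>s\<in>sos C. h s = (\<Oplus>i\<in>{..<m}. f i [^] (2::nat))"
    if "f \<in> {..<m} \<rightarrow> carrier A" for f and m :: nat
    using that
  proof (induction m)
    case 0
    show ?case
      using zero by (intro bexI[OF _ sos.sos_zero]) simp
  next
    case (Suc m)
    have "f \<in> {..<m} \<rightarrow> carrier A"
      using Suc.prems by (auto simp: Pi_iff)
    from Suc.IH[OF this] obtain s where s: "s \<in> sos C" "h s = (\<Oplus>i\<in>{..<m}. f i [^] (2::nat))"
      by blast
    obtain a where a: "a \<in> C" "h a = f m"
      using Suc.prems surj by (metis PiE imageE lessThan_iff lessI)
    have "(\<Oplus>i\<in>{..<Suc m}. f i [^] (2::nat)) = f m [^] (2::nat) \<oplus> (\<Oplus>i\<in>{..<m}. f i [^] (2::nat))"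
      unfolding lessThan_Suc using Suc.prems
      by (subst finsum_insert) (auto simp: Pi_iff)
    then have "h (a\<^sup>2 + s) = (\<Oplus>i\<in>{..<Suc m}. f i [^] (2::nat))"
      using add[OF C.power_mem[OF a(1)] C.sos_mem[OF s(1)]] square[OF a(1)] s(2) a(2) by simp
    then show ?case
      using sos.sos_add_square[OF a(1) s(1)] by blast
  qed
  have "\<ominus> \<one> = h s \<longleftrightarrow> h (1 + s) = \<zero>" if "s \<in> sos C" for s
    using add[OF C.one_mem C.sos_mem[OF that]] closed[OF C.sos_mem[OF that]] one
    by (metis minus_equality a_comm one_closed r_neg)
  then show ?thesis
    unfolding semi_real_def using to_sum from_sum by metis
qed

section \<open>From the definition of a real closed field to the two axioms of a real closed
  subfield\<close>

lemma ring_of_type_algebra_simps: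
  "carrier ring_of_type_algebra = UNIV" "\<one>\<^bsub>ring_of_type_algebra\<^esub> = 1" "\<zero>\<^bsub>ring_of_type_algebra\<^esub> = 0"
  "a \<otimes>\<^bsub>ring_of_type_algebra\<^esub> b = a * b" "a \<oplus>\<^bsub>ring_of_type_algebra\<^esub> b = a + b"
  by (simp_all add: ring_of_type_algebra_def)

lemma unital_subring_UNIV: "unital_subring UNIV"
  by unfold_locales auto

text \<open>HOL-Algebra represents polynomials by coefficient lists with the leading coefficient first.\<close>

definition poly_list :: "'k::field poly \<Rightarrow> 'k list" where
  "poly_list q = rev (coeffs q)"

context
  fixes K :: "'k::field ring"
  defines "K \<equiv> ring_of_type_algebra"
begin

interpretation K: field K
  unfolding K_def by rule

lemma K_simps: "carrier K = UNIV" "\<one>\<^bsub>K\<^esub> = 1" "\<zero>\<^bsub>K\<^esub> = 0" "a \<otimes>\<^bsub>K\<^esub> b = a * b" "a \<oplus>\<^bsub>K\<^esub> b = a + b"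
  unfolding K_def by (simp_all add: ring_of_type_algebra_simps)

lemma finsum_K: "finite I \<Longrightarrow> finsum K f I = sum f I"
  by (induction I rule: finite_induct) (auto simp: K.finsum_insert K_simps)

lemma polynomial_poly_list: "polynomial\<^bsub>K\<^esub> (carrier K) (poly_list q)"
  by (auto simp: polynomial_def poly_list_def K_simps hd_rev last_coeffs_eq_coeff_degree)

lemma coeff_poly_list: "K.coeff (poly_list q) i = coeff q i"
proof (cases "i < length (coeffs q)")
  case True
  then show ?thesis
    by (simp add: K.coeff_nth poly_list_def rev_nth nth_default_coeffs_eq[symmetric] nth_default_def)
next
  case False
  then show ?thesis
    by (simp add: K.coeff_length poly_list_def K_simps nth_default_coeffs_eq[symmetric] nth_default_def)
qed

lemma poly_list_add: "poly_list (p + q) = K.poly_add (poly_list p) (poly_list q)"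
proof -
  have "polynomial\<^bsub>K\<^esub> (carrier K) (K.poly_add (poly_list p) (poly_list q))"
    by (intro K.poly_add_closed[OF K.carrier_is_subring] polynomial_poly_list)
  moreover have "K.coeff (K.poly_add (poly_list p) (poly_list q)) = (\<lambda>i. coeff p i + coeff q i)"
    by (subst K.poly_add_coeff) (auto simp: K_simps coeff_poly_list)
  ultimately show ?thesis
    by (subst K.coeff_iff_polynomial_cond[OF polynomial_poly_list])
      (auto simp: fun_eq_iff coeff_poly_list simp del: K.poly_add.simps)
qed

lemma poly_list_mult: "poly_list (p * q) = K.poly_mult (poly_list p) (poly_list q)"
proof -
  have "polynomial\<^bsub>K\<^esub> (carrier K) (K.poly_mult (poly_list p) (poly_list q))"
    by (intro K.poly_mult_closed[OF K.carrier_is_subring] polynomial_poly_list)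
  moreover have "K.coeff (K.poly_mult (poly_list p) (poly_list q)) = coeff (p * q)"
    by (subst K.poly_mult_coeff) (auto simp: fun_eq_iff K_simps coeff_poly_list finsum_K coeff_mult)
  ultimately show ?thesis
    by (subst K.coeff_iff_polynomial_cond[OF polynomial_poly_list])
      (auto simp: fun_eq_iff coeff_poly_list simp del: K.poly_mult.simps)
qed

lemma poly_list_one: "poly_list 1 = [\<one>\<^bsub>K\<^esub>]"
  by (simp add: poly_list_def K_simps)

lemma poly_list_const: "poly_list [:c:] = K.poly_of_const c"
  by (simp add: poly_list_def K.poly_of_const_def K_simps)

lemma range_poly_list: "range poly_list = carrier (univ_poly K (carrier K))"
proof
  show "range poly_list \<subseteq> carrier (univ_poly K (carrier K))"
    using polynomial_poly_list by (auto simp flip: univ_poly_carrier)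
  show "carrier (univ_poly K (carrier K)) \<subseteq> range poly_list"
  proof
    fix xs assume "xs \<in> carrier (univ_poly K (carrier K))"
    then have "xs = [] \<or> hd xs \<noteq> 0"
      by (auto simp: polynomial_def K_simps simp flip: univ_poly_carrier)
    then have "xs = poly_list (Poly (rev xs))"
      by (cases xs) (auto simp: poly_list_def)
    then show "xs \<in> range poly_list" by blast
  qed
qed

lemma poly_list_inj: "poly_list p = poly_list q \<longleftrightarrow> p = q"
  by (simp add: poly_list_def coeffs_eq_iff)

text \<open>If an irreducible f divided no 1 + s, the quotient L of K[X] by f would be a real field,
  algebraic over K because it has finite dimension. Its elements have the type over which the
  definition quantifies, so K maps onto L. Then X is congruent to some constant c modulo f, and f
  divides X - c although its degree is at least 2.\<close>

lemma real_closed_subfield_UNIV: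
  assumes rc: "real_closed_field K"
  shows "real_closed_subfield (UNIV :: 'k set)"
proof (intro real_closed_subfield.intro real_closed_subfield_axioms.intro field_subset.intro
    unital_subring_UNIV field_subset_axioms.intro)
  have "semi_real K"
    using rc by (simp add: real_closed_field_def real_field_def)
  then show "1 + s \<noteq> 0" if "s \<in> sos (UNIV :: 'k set)" for s
    using semi_real_iff[OF K.ring_axioms unital_subring_UNIV, of "\<lambda>x. x"] that by (simp add: K_simps)
next
  fix f :: "'k poly" assume deg: "2 \<le> degree f"
    and irr: "\<And>g h. g \<in> polys_over UNIV \<Longrightarrow> h \<in> polys_over UNIV \<Longrightarrow> f = g * h \<Longrightarrow> degree g = 0 \<or> degree h = 0"
  interpret F: field_subset "UNIV :: 'k set"
    by unfold_locales auto
  let ?p = "poly_list f"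
  let ?KX = "univ_poly K (carrier K)"
  define L where "L = Rupt\<^bsub>K\<^esub> (carrier K) ?p"
  define h where "h q = K.rupture_surj (carrier K) ?p (poly_list q)" for q
  have f0: "f \<noteq> 0" using deg by auto
  have p: "?p \<in> carrier ?KX"
    using polynomial_poly_list by (simp flip: univ_poly_carrier)
  have degp: "Polynomials.degree ?p = degree f"
    by (simp add: poly_list_def degree_eq_length_coeffs)
  interpret KX: domain ?KX
    by (rule K.univ_poly_is_domain[OF K.carrier_is_subring])
  have I: "ideal (PIdl\<^bsub>?KX\<^esub> ?p) ?KX"
    by (rule KX.cgenideal_ideal[OF p])
  interpret L: cring L
    unfolding L_def rupture_def by (rule ideal.quotient_is_cring[OF I]) unfold_locales
  have hom: "K.rupture_surj (carrier K) ?p \<in> ring_hom ?KX L"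
    unfolding L_def by (rule K.rupture_surj_hom(1)[OF K.carrier_is_subring p])
  have mem: "poly_list q \<in> carrier ?KX" for q
    using range_poly_list by blast
  have h_add: "h (a + b) = h a \<oplus>\<^bsub>L\<^esub> h b" for a b
    unfolding h_def poly_list_add using ring_hom_add[OF hom mem mem] by (simp add: univ_poly_add)
  have h_mult: "h (a * b) = h a \<otimes>\<^bsub>L\<^esub> h b" for a b
    unfolding h_def poly_list_mult using ring_hom_mult[OF hom mem mem] by (simp add: univ_poly_mult)
  have h_one: "h 1 = \<one>\<^bsub>L\<^esub>"
    unfolding h_def poly_list_one using ring_hom_one[OF hom] by (simp add: univ_poly_one)
  have "carrier L = K.rupture_surj (carrier K) ?p ` carrier ?KX"
    unfolding L_def rupture_def FactRing_def A_RCOSETS_def' by auto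
  then have h_surj: "range h = carrier L"
    unfolding h_def range_poly_list[symmetric] by (simp add: image_image)
  have h_zero: "h q = \<zero>\<^bsub>L\<^esub> \<longleftrightarrow> f dvd q" for q
  proof -
    have "h q = \<zero>\<^bsub>L\<^esub> \<longleftrightarrow> poly_list q \<in> PIdl\<^bsub>?KX\<^esub> ?p"
      unfolding h_def L_def rupture_def FactRing_def
      using ideal.rcos_const_imp_mem[OF I mem] KX.a_rcos_zero[OF I] by auto
    also have "\<dots> \<longleftrightarrow> (\<exists>r. poly_list q = poly_list r \<otimes>\<^bsub>?KX\<^esub> ?p)"
      unfolding cgenideal_def range_poly_list[symmetric] by auto
    also have "\<dots> \<longleftrightarrow> (\<exists>r. poly_list q = poly_list (r * f))"
      by (simp add: univ_poly_mult poly_list_mult)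
    also have "\<dots> \<longleftrightarrow> f dvd q"
      by (auto simp: poly_list_inj dvd_def mult.commute)
    finally show ?thesis .
  qed
  show "\<exists>s\<in>sos (polys_over UNIV). \<exists>h\<in>polys_over UNIV. 1 + s = f * h"
  proof (rule ccontr)
    assume "\<not> ?thesis"
    then have no: "\<not> f dvd 1 + s" if "s \<in> sos UNIV" for s
      using that by (auto simp: dvd_def)
    have one_zero: "\<one>\<^bsub>L\<^esub> \<noteq> \<zero>\<^bsub>L\<^esub>"
      using h_zero[of 1] no[OF sos_zero] h_one by simp
    have fieldL: "field L"
    proof (rule L.cring_fieldI2[OF one_zero[symmetric]])
      fix a assume "a \<in> carrier L" "a \<noteq> \<zero>\<^bsub>L\<^esub>"
      then obtain q where q: "a = h q" "\<not> f dvd q"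
        using h_surj h_zero by (metis imageE)
      have nd: "\<not> (\<exists>r\<in>polys_over UNIV. q = f * r)"
        using q(2) by (auto simp: dvd_def)
      have fU: "f \<in> polys_over UNIV" and qU: "q \<in> polys_over UNIV"
        by simp_all
      obtain u v where uv: "u * q + v * f = 1"
        using F.irreducible_bezout[OF fU f0 qU irr nd] by blast
      have "h u \<otimes>\<^bsub>L\<^esub> h q = h (1 + (- v) * f)"
        unfolding uv[symmetric] by (simp flip: h_mult)
      also have "\<dots> = \<one>\<^bsub>L\<^esub>"
        using h_zero[of "(- v) * f"] L.one_closed by (simp only: h_add h_one) simp
      finally have "a \<otimes>\<^bsub>L\<^esub> h u = \<one>\<^bsub>L\<^esub>"
        using q(1) h_surj L.m_comm by (metis rangeI)
      then show "\<exists>b\<in>carrier L. a \<otimes>\<^bsub>L\<^esub> b = \<one>\<^bsub>L\<^esub>"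
        using h_surj by blast
    qed
    interpret L: field L by fact
    have "semi_real L"
      using semi_real_iff[OF L.ring_axioms unital_subring_UNIV h_surj h_one h_add h_mult] no h_zero by blast
    moreover define e where "e c = h [:c:]" for c
    have e: "e \<in> ring_hom K L"
      unfolding e_def
      by (rule ring_hom_memI) (use h_surj in \<open>auto simp: K_simps h_one h_add[symmetric] h_mult[symmetric] mult.commute simp flip: one_pCons\<close>)
    moreover have "ring.algebraic L (e ` carrier K) y" if y: "y \<in> carrier L" for y
    proof -
      interpret E: ring_hom_ring K L e
        by (rule ring_hom_ringI2[OF K.ring_axioms L.ring_axioms e])
      have "ring.dimension L (Polynomials.degree ?p) (K.rupture_surj (carrier K) ?p ` K.poly_of_const ` carrier K) (carrier L)"
        unfolding L_def using deg degp by (intro K.rupture_dimension[OF K.carrier_is_subfield p]) simp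
      also have "K.rupture_surj (carrier K) ?p ` K.poly_of_const ` carrier K = e ` carrier K"
        by (simp add: image_image e_def h_def poly_list_const)
      finally have fin: "L.finite_dimension (e ` carrier K) (carrier L)"
        by (rule L.finite_dimensionI)
      have "subfield (e ` carrier K) L"
        by (rule E.img_is_subfield(2)[OF K.carrier_is_subfield one_zero])
      then show ?thesis
        by (rule L.finite_dimension_imp_algebraic[OF _ L.carrier_is_subring fin y, unfolded over_def])
    qed
    ultimately have "e ` carrier K = carrier L"
      using rc fieldL unfolding real_closed_field_def real_field_def by blast
    then obtain c where c: "h [:0, 1:] = h [:c:]"
      using h_surj unfolding e_def by blast
    have "h [:- c, 1:] = h [:0, 1:] \<oplus>\<^bsub>L\<^esub> h [:- c:]"
      by (simp flip: h_add)
    also have "\<dots> = h 0"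
      unfolding c by (simp flip: h_add)
    also have "\<dots> = \<zero>\<^bsub>L\<^esub>"
      by (simp add: h_zero)
    finally have "h [:- c, 1:] = \<zero>\<^bsub>L\<^esub>" .
    then have "degree f \<le> degree [:- c, 1:]"
      unfolding h_zero by (intro dvd_imp_degree_le) auto
    then show False using deg by simp
  qed
qed auto

end

section \<open>The real Nullstellensatz\<close>

lemma mpoly_eval_cong:
  assumes "p \<in> mpolys V" "\<And>i. i \<in> V \<Longrightarrow> x i = y i"
  shows "mpoly_eval p x = mpoly_eval p y"
  unfolding mpoly_eval_def
proof (intro sum.cong refl arg_cong2[of _ _ _ _ "(*)"] prod.cong)
  fix m i assume "m \<in> Poly_Mapping.keys p" "i \<in> Poly_Mapping.keys m"
  then show "x i ^ Poly_Mapping.lookup m i = y i ^ Poly_Mapping.lookup m i"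
    using assms unfolding mpolys_def by (metis (mono_tags, lifting) mem_Collect_eq subsetD)
qed

lemma subring_hom_mpoly_eval: "subring_hom UNIV (\<lambda>p. mpoly_eval p x)"
  by (intro subring_hom.intro subring_hom_axioms.intro unital_subring_UNIV)
    (simp_all add: mpoly_eval_one mpoly_eval_add mpoly_eval_mult)

lemma (in subring_hom) hom_sos: "s \<in> sos C \<Longrightarrow> \<phi> s \<in> sos (\<phi> ` C)"
proof (induction s rule: sos.induct)
  case (sos_add_square a s)
  then show ?case
    using sos_mem by (auto simp: hom_zero hom_add hom_power power_mem intro!: sos.sos_add_square)
qed (simp add: hom_zero sos.sos_zero)

lemma (in subring_hom) sos_image: "s \<in> sos (\<phi> ` C) \<Longrightarrow> \<exists>t\<in>sos C. s = \<phi> t"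
proof (induction s rule: sos.induct)
  case (sos_add_square a s)
  then obtain b t where bt: "b \<in> C" "a = \<phi> b" "t \<in> sos C" "s = \<phi> t"
    by auto
  then have "a\<^sup>2 + s = \<phi> (b\<^sup>2 + t)"
    by (simp add: hom_add hom_power power_mem sos_mem)
  then show ?case
    using sos.sos_add_square[OF bt(1,3)] by blast
qed (metis hom_zero sos.sos_zero)

text \<open>The subrings \<open>C j\<close> are the images of the polynomials in the first j
  variables. By induction on j, for every finite D in \<open>C j\<close> some homomorphism to K
  inverts \<iota> on constants and respects the signs of D. \<open>C 0\<close> is a copy of K, where
  the inverse of \<iota> does this for all elements.\<close>

lemma artin_lang:
  fixes \<psi> :: "((nat \<Rightarrow>\<^sub>0 nat) \<Rightarrow>\<^sub>0 'k::field) \<Rightarrow> 'w::field"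
  assumes K: "real_closed_subfield (UNIV :: 'k set)" and R: "real_closed_subfield R"
    and \<psi>: "subring_hom (mpolys {..<n}) \<psi>" and sub: "\<psi> ` mpolys {..<n} \<subseteq> R"
  obtains \<phi> where "subring_hom (\<psi> ` mpolys {..<n}) \<phi>" "\<And>c. \<phi> (\<psi> (mconst c)) = (c::'k)"
proof -
  interpret real_closed_pair R "UNIV :: 'k set"
    by (intro real_closed_pair.intro K R)
  interpret subring_hom "mpolys {..<n}" \<psi> by fact
  define \<iota> where "\<iota> c = \<psi> (mconst c)" for c
  have \<iota>_hom: "\<iota> 1 = 1" "\<iota> (a + b) = \<iota> a + \<iota> b" "\<iota> (a * b) = \<iota> a * \<iota> b" for a b
    by (simp_all add: \<iota>_def hom_one hom_add hom_mult mconst_mem)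
  have \<iota>_R: "\<iota> c \<in> R" for c
    using sub mconst_mem unfolding \<iota>_def by blast
  have \<iota>_0: "\<iota> c = 0 \<longleftrightarrow> c = 0" for c
  proof
    assume "\<iota> c = 0"
    show "c = 0"
    proof (rule ccontr)
      assume "c \<noteq> 0"
      then have "\<iota> c * \<iota> (inverse c) = 1"
        by (simp flip: \<iota>_hom(1,3))
      then show False using \<open>\<iota> c = 0\<close> by simp
    qed
  qed (simp add: \<iota>_def hom_zero)
  have "inj \<iota>"
  proof (rule injI)
    fix a b assume "\<iota> a = \<iota> b"
    then have "\<iota> (a - b) = 0"
      using \<iota>_hom(2)[of "a - b" b] by simp
    then show "a = b" using \<iota>_0 by simp
  qed
  define \<phi>0 where "\<phi>0 = inv_into UNIV \<iota>"
  have \<phi>0: "\<phi>0 (\<iota> c) = c" for c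
    using \<open>inj \<iota>\<close> by (simp add: \<phi>0_def)
  \<comment> \<open>Signs are defined by squares, every element of K is a square or the negative of
    one, and \<iota> maps squares to squares; so it preserves signs.\<close>
  have sign: "S.sg c = R.sg (\<iota> c)" for c
  proof -
    have pos: "R.sg (\<iota> (b\<^sup>2)) = 1" if "b \<noteq> 0" for b
      using R.sg_square[OF \<iota>_R] \<iota>_0 that by (simp add: power2_eq_square \<iota>_hom)
    have "(\<exists>b. c = b\<^sup>2) \<or> (\<exists>b. - c = b\<^sup>2)"
      using S.square_or_minus_square[of c] by blast
    then obtain b where b: "c = b\<^sup>2 \<or> c = - (b\<^sup>2)"
      by (metis minus_minus)
    show ?thesis
    proof (cases "b = 0")
      case True
      then show ?thesis
        using b \<iota>_0 by simp
    next
      case False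
      have "\<iota> (- (b\<^sup>2)) = - \<iota> (b\<^sup>2)"
        using \<iota>_hom(2)[of "- (b\<^sup>2)" "b\<^sup>2"] \<iota>_0[of 0] by (simp add: eq_neg_iff_add_eq_0)
      then show ?thesis
        using b pos[OF False] R.sg_minus[OF \<iota>_R] S.sg_minus[of "b\<^sup>2"] S.sg_square[of b] False by auto
    qed
  qed
  define C where "C j = \<psi> ` mpolys {..<j}" for j
  have C: "unital_subring (C j)" "C j \<subseteq> R" "range \<iota> \<subseteq> C j" if "j \<le> n" for j
  proof -
    have sub': "mpolys {..<j} \<subseteq> (mpolys {..<n} :: ((nat \<Rightarrow>\<^sub>0 nat) \<Rightarrow>\<^sub>0 'k) set)"
      using that by (intro mpolys_mono) auto
    show "unital_subring (C j)"
      unfolding C_def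
      by (rule subring_hom.unital_subring_image[OF subring_hom_subset[OF \<psi> unital_subring_mpolys sub']])
    show "C j \<subseteq> R"
      using sub sub' unfolding C_def by blast
    show "range \<iota> \<subseteq> C j"
      using mconst_mem unfolding C_def \<iota>_def by blast
  qed
  have "\<exists>\<phi>. subring_hom (C j) \<phi> \<and> \<phi> ` C j \<subseteq> UNIV \<and> (\<forall>b\<in>range \<iota>. \<phi> b = \<phi>0 b) \<and> (\<forall>d\<in>D. S.sg (\<phi> d) = R.sg d)"
    if "j \<le> n" "finite D" "D \<subseteq> C j" for j D
    using that
  proof (induction j arbitrary: D)
    case 0
    have C0: "C 0 = range \<iota>"
      by (auto simp: C_def mpolys_empty \<iota>_def)
    have "subring_hom (C 0) \<phi>0"
    proof (intro subring_hom.intro subring_hom_axioms.intro C(1))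
      show "\<phi>0 1 = 1"
        using \<phi>0[of 1] by (simp add: \<iota>_hom)
      fix a b assume "a \<in> C 0" "b \<in> C 0"
      then obtain c d where "a = \<iota> c" "b = \<iota> d"
        unfolding C0 by blast
      then show "\<phi>0 (a + b) = \<phi>0 a + \<phi>0 b" "\<phi>0 (a * b) = \<phi>0 a * \<phi>0 b"
        using \<phi>0[of "c + d"] \<phi>0[of "c * d"] by (simp_all add: \<iota>_hom \<phi>0)
    qed simp
    moreover have "\<forall>d\<in>D. S.sg (\<phi>0 d) = R.sg d"
      using 0(3) sign \<phi>0 unfolding C0 by auto
    ultimately show ?case by blast
  next
    case (Suc j)
    have step: "C (Suc j) \<subseteq> adjoin (C j) (\<psi> (mvar j))"
    proof
      fix a assume "a \<in> C (Suc j)"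
      then obtain p where p: "p \<in> mpolys {..<Suc j}" "a = \<psi> p"
        unfolding C_def by blast
      then obtain g where g: "g \<in> polys_over (mpolys {..<j})" "p = poly g (mvar j)"
        using mpolys_insert[of j "{..<j}"] unfolding lessThan_Suc adjoin_def by blast
      have "g \<in> polys_over (mpolys {..<n})"
        using g(1) polys_over_mono[OF mpolys_mono[of "{..<j}" "{..<n}"]] Suc.prems(1) by auto
      moreover have "mvar j \<in> mpolys {..<n}"
        using Suc.prems(1) by (intro mvar_mem) simp
      ultimately have "a = poly (map_poly \<psi> g) (\<psi> (mvar j))"
        using hom_poly p(2) g(2) by simp
      moreover have "map_poly \<psi> g \<in> polys_over (C j)"
        using g(1) by (auto simp: polys_over_def coeff_map C_def)
      ultimately show "a \<in> adjoin (C j) (\<psi> (mvar j))"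
        unfolding adjoin_def by blast
    qed
    have j: "j \<le> n" using Suc.prems(1) by simp
    have z: "\<psi> (mvar j) \<in> R"
      using sub mvar_mem[of j "{..<n}"] Suc.prems(1) by auto
    have D: "D \<subseteq> adjoin (C j) (\<psi> (mvar j))"
      using Suc.prems(3) step by blast
    from specialize_adjoin[OF C(1)[OF j] C(2)[OF j] z Suc.prems(2) D Suc.IH[OF j] C(3)[OF j]]
    obtain \<phi> where "subring_hom (adjoin (C j) (\<psi> (mvar j))) \<phi>"
      "\<forall>b\<in>range \<iota>. \<phi> b = \<phi>0 b" "\<forall>d\<in>D. S.sg (\<phi> d) = R.sg d"
      by blast
    then show ?case
      using subring_hom_subset[OF _ C(1)[OF Suc.prems(1)] step] by blast
  qed
  \<comment> \<open>The sign conditions have served the induction, and the final homomorphism is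
    taken with an empty set of them.\<close>
  from this[of n "{}"] obtain \<phi> where "subring_hom (C n) \<phi>" "\<forall>b\<in>range \<iota>. \<phi> b = \<phi>0 b"
    by auto
  then show thesis
    using that[of \<phi>] \<phi>0 by (simp add: C_def \<iota>_def)
qed

lemma carrier_mpoly_ring: "carrier (mpoly_ring n) = mpolys {..<n}"
  by (simp add: mpoly_ring_def mpolys_def)

lemma mpoly_ring_simps:
  "\<one>\<^bsub>mpoly_ring n\<^esub> = 1" "\<zero>\<^bsub>mpoly_ring n\<^esub> = 0" "a \<otimes>\<^bsub>mpoly_ring n\<^esub> b = a * b" "a \<oplus>\<^bsub>mpoly_ring n\<^esub> b = a + b"
  by (simp_all add: mpoly_ring_def ring_of_type_algebra_def)

theorem theorem3p16:
  fixes n :: nat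
    and \<aa> :: "((nat \<Rightarrow>\<^sub>0 nat) \<Rightarrow>\<^sub>0 'k::field) set"
  assumes "real_closed_field (ring_of_type_algebra :: 'k ring)"
    and "ideal \<aa> (mpoly_ring n)"
  shows "semi_real (mpoly_ring n Quot \<aa>) \<longleftrightarrow> zero_set n \<aa> \<noteq> {}"
proof -
  let ?D = "mpolys {..<n} :: ((nat \<Rightarrow>\<^sub>0 nat) \<Rightarrow>\<^sub>0 'k) set"
  have K: "real_closed_subfield (UNIV :: 'k set)"
    using assms(1) by (rule real_closed_subfield_UNIV)
  interpret K: real_closed_subfield "UNIV :: 'k set" by fact
  interpret M: cring "mpoly_ring n :: ((nat \<Rightarrow>\<^sub>0 nat) \<Rightarrow>\<^sub>0 'k) ring"
    by (rule cring_mpoly_ring)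
  interpret I: ideal \<aa> "mpoly_ring n" by fact
  interpret D: unital_subring ?D
    by (rule unital_subring_mpolys)
  have \<aa>: "\<aa> \<subseteq> ?D"
    using I.a_subset by (simp add: carrier_mpoly_ring)
  have \<aa>_add: "a + b \<in> \<aa>" if "a \<in> \<aa>" "b \<in> \<aa>" for a b
    using I.a_closed[OF that] by (simp add: mpoly_ring_simps)
  have \<aa>_mult: "c * a \<in> \<aa>" if "a \<in> \<aa>" "c \<in> ?D" for a c
    using I.I_l_closed[OF that(1)] that(2) by (simp add: mpoly_ring_simps carrier_mpoly_ring)
  have "a - b \<in> \<aa>" if "a \<in> \<aa>" "b \<in> \<aa>" for a b
    using \<aa>_add[OF that(1) \<aa>_mult[OF that(2), of "- 1"]] by (simp add: D.closed)
  moreover have "0 \<in> \<aa>"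
    using I.zero_closed by (simp add: mpoly_ring_simps)
  ultimately interpret \<aa>: subring_ideal ?D \<aa>
    using \<aa> \<aa>_mult by unfold_locales
  \<comment> \<open>Semi-reality of the quotient is restated upstairs: no 1 + s with s a sum of
    squares of polynomials lies in \<aa>.\<close>
  have "semi_real (mpoly_ring n Quot \<aa>) \<longleftrightarrow>
      (\<forall>s\<in>sos ?D. \<aa> +>\<^bsub>mpoly_ring n\<^esub> (1 + s) \<noteq> \<zero>\<^bsub>mpoly_ring n Quot \<aa>\<^esub>)"
  proof (rule semi_real_iff)
    show "ring (mpoly_ring n Quot \<aa>)"
      by (rule I.quotient_is_ring)
    show "(\<lambda>p. \<aa> +>\<^bsub>mpoly_ring n\<^esub> p) ` ?D = carrier (mpoly_ring n Quot \<aa>)"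
      unfolding FactRing_def A_RCOSETS_def' by (auto simp: carrier_mpoly_ring)
    note hom = I.rcos_ring_hom
    show "\<aa> +>\<^bsub>mpoly_ring n\<^esub> 1 = \<one>\<^bsub>mpoly_ring n Quot \<aa>\<^esub>"
      using ring_hom_one[OF hom] by (simp add: mpoly_ring_simps)
    show "\<aa> +>\<^bsub>mpoly_ring n\<^esub> (a + b) = (\<aa> +>\<^bsub>mpoly_ring n\<^esub> a) \<oplus>\<^bsub>mpoly_ring n Quot \<aa>\<^esub> (\<aa> +>\<^bsub>mpoly_ring n\<^esub> b)"
      "\<aa> +>\<^bsub>mpoly_ring n\<^esub> (a * b) = (\<aa> +>\<^bsub>mpoly_ring n\<^esub> a) \<otimes>\<^bsub>mpoly_ring n Quot \<aa>\<^esub> (\<aa> +>\<^bsub>mpoly_ring n\<^esub> b)"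
      if "a \<in> ?D" "b \<in> ?D" for a b
      using ring_hom_add[OF hom, of a b] ring_hom_mult[OF hom, of a b] that
      by (simp_all add: mpoly_ring_simps carrier_mpoly_ring)
  qed (rule unital_subring_mpolys)
  also have "\<dots> \<longleftrightarrow> (\<forall>s\<in>sos ?D. 1 + s \<notin> \<aa>)"
  proof (intro ball_cong refl arg_cong[of _ _ Not])
    fix s assume "s \<in> sos ?D"
    then have "1 + s \<in> carrier (mpoly_ring n)"
      using D.sos_mem by (simp add: carrier_mpoly_ring D.closed)
    then show "\<aa> +>\<^bsub>mpoly_ring n\<^esub> (1 + s) = \<zero>\<^bsub>mpoly_ring n Quot \<aa>\<^esub> \<longleftrightarrow> 1 + s \<in> \<aa>"
      using I.rcos_const_imp_mem I.a_rcos_const by (auto simp: FactRing_def)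
  qed
  also have "\<dots> \<longleftrightarrow> zero_set n \<aa> \<noteq> {}"
  proof
    assume real: "\<forall>s\<in>sos ?D. 1 + s \<notin> \<aa>"
    obtain P where P: "\<aa> \<subseteq> P" "subring_prime_ideal ?D P"
      "\<And>b s. b \<in> ?D \<Longrightarrow> s \<in> sos ?D \<Longrightarrow> b\<^sup>2 + s \<in> P \<Longrightarrow> b \<in> P"
      using \<aa>.exists_real_prime real by blast
    obtain \<psi> :: "((nat \<Rightarrow>\<^sub>0 nat) \<Rightarrow>\<^sub>0 'k) \<Rightarrow> ((nat \<Rightarrow>\<^sub>0 nat) \<Rightarrow>\<^sub>0 'k) fract alg_closure"
      where \<psi>: "subring_hom ?D \<psi>" "\<And>a. a \<in> ?D \<Longrightarrow> \<psi> a = 0 \<longleftrightarrow> a \<in> P"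
      using exists_generic_hom[OF P(2)] by blast
    interpret \<psi>: subring_hom ?D \<psi> by fact
    \<comment> \<open>The kernel of \<psi> is P, so the image is the ring modulo P, and it inherits
      from P that a sum of squares vanishes only if its terms do.\<close>
    have realD: "b = 0" if b: "b \<in> \<psi> ` ?D" "s \<in> sos (\<psi> ` ?D)" "b\<^sup>2 + s = 0" for b s
    proof -
      obtain a t where at: "a \<in> ?D" "b = \<psi> a" "t \<in> sos ?D" "s = \<psi> t"
        using b(1,2) \<psi>.sos_image by blast
      then have "\<psi> (a\<^sup>2 + t) = 0"
        using b(3) by (simp add: \<psi>.hom_add \<psi>.hom_power D.power_mem D.sos_mem)
      then have "a\<^sup>2 + t \<in> P"
        using \<psi>(2) at by (simp add: D.closed D.sos_mem)
      then show ?thesis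
        using P(3)[OF at(1,3)] \<psi>(2)[OF at(1)] at(2) by simp
    qed
    have "\<exists>R. real_closed_subfield R \<and> \<psi> ` ?D \<subseteq> R"
      by (intro exists_real_closed_subfield \<psi>.unital_subring_image) (rule realD)
    then obtain R where R: "real_closed_subfield R" "\<psi> ` ?D \<subseteq> R"
      by blast
    obtain \<phi> where \<phi>: "subring_hom (\<psi> ` ?D) \<phi>" "\<And>c. \<phi> (\<psi> (mconst c)) = (c::'k)"
      using artin_lang[OF K R(1) \<psi>(1) R(2)] by blast
    interpret \<phi>: subring_hom "\<psi> ` ?D" \<phi> by fact
    have \<theta>: "subring_hom ?D (\<phi> \<circ> \<psi>)"
      by unfold_locales (simp_all add: \<psi>.hom_one \<phi>.hom_one \<psi>.hom_add \<phi>.hom_add \<psi>.hom_mult \<phi>.hom_mult)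
    \<comment> \<open>The restriction makes x a point in the sense of \<open>zero_set\<close>;
      polynomials in the first n variables do not see it.\<close>
    define x where "x = restrict (\<lambda>i. \<phi> (\<psi> (mvar i))) {..<n}"
    have "mpoly_eval f x = 0" if "f \<in> \<aa>" for f
    proof -
      have f: "f \<in> ?D" using that \<aa> by blast
      have "mpoly_eval f x = mpoly_eval f (\<lambda>i. (\<phi> \<circ> \<psi>) (mvar i))"
        by (rule mpoly_eval_cong[OF f]) (simp add: x_def)
      also have "\<dots> = \<phi> (\<psi> f)"
        using hom_eq_mpoly_eval[OF \<theta> _ f] \<phi>(2) by simp
      also have "\<dots> = 0"
        using \<psi>(2)[OF f] that P(1) \<phi>.hom_zero by auto
      finally show ?thesis .
    qed
    then have "x \<in> zero_set n \<aa>"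
      by (simp add: zero_set_def x_def)
    then show "zero_set n \<aa> \<noteq> {}" by blast
  next
    assume "zero_set n \<aa> \<noteq> {}"
    then obtain x where x: "\<And>f. f \<in> \<aa> \<Longrightarrow> mpoly_eval f x = 0"
      by (auto simp: zero_set_def)
    interpret ev: subring_hom UNIV "\<lambda>p. mpoly_eval p x"
      by (rule subring_hom_mpoly_eval)
    show "\<forall>s\<in>sos ?D. 1 + s \<notin> \<aa>"
    proof (intro ballI notI)
      fix s assume s: "s \<in> sos ?D" "1 + s \<in> \<aa>"
      \<comment> \<open>Evaluation is a ring homomorphism to K, so it would send 1 + s in \<aa> to
        an equation 1 + (sum of squares) = 0 in K.\<close>
      have "mpoly_eval s x \<in> sos (range (\<lambda>p. mpoly_eval p x))"
        using ev.hom_sos sos_mono[OF s(1)] by blast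
      then have "mpoly_eval s x \<in> sos UNIV"
        by (rule sos_mono) simp
      then show False
        using K.real[of "mpoly_eval s x"] x[OF s(2)] by (simp add: mpoly_eval_add mpoly_eval_one)
    qed
  qed
  finally show ?thesis .
qed

end
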